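(* Let the parametric control design problem of the context be given, with $c_\beta$ (for given $(\beta,\widehat{\mathbb X},\mathcal S,\delta)$) a minimizer of $L(\cdot;\beta,\widehat{\mathbb X},\mathcal S)$ over $\mathbb S_c$, denoted $c_0$ when $\beta=0$. (i) Assume: (A1) for every $c\in\mathbb S_c$ the class assumption of the context holds for $V(\cdot;c)$, $u(\cdot;c)$, $\mu$, $\sigma$; (A2) there exists $c\in\mathbb S_c$ such that $V(x;c)\ge\epsilon_V(x)$ and $W(x;c)\le-\epsilon_W(x)$ for all $x\in\widehat{\mathbb X}$; (A3) there exist $\bar\tau>0$, $C_V>0$, $C_W>0$ such that for every $c\in\mathbb S_c$ and every simplex collection $\mathcal S$ with maximum sampling interval $\tau$, the second-order margins $\underline m(V;c)$ and $\overline m(W;c)$ produced by the stability-region procedure (under (A1)) satisfy: $\tau\le\bar\tau$ implies $\underline m(V;c)\le C_V\tau^2$ and $\overline m(W;c)\le C_W\tau^2$; (A4) the set $\mathbb S_\tau$ is nonempty, where $\mathbb S_\tau\subset(0,\infty)$ is the set of $\tau>0$ for which there exist a simplex collection $\mathcal S=(\mathbb X_i)_{i\in\mathcal I}$ with maximum sampling interval $\tau$ and a nonempty $\widehat{\mathcal I}\subseteq\mathcal I$ with $\widehat{\mathbb X}=\bigcup_{i\in\widehat{\mathcal I}}\mathbb X_i$. Then there exists $\tau_{\mathrm U}>0$ such that for every $\tau\in(0,\tau_{\mathrm U}]\cap\mathbb S_\tau$ and every simplex collection $\mathcal S$ with maximum sampling interval $\tau$, there exist $\beta_{\mathrm U}>0$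 and $\delta_{\mathrm U}>0$ such that for any $\beta\in[0,\beta_{\mathrm U}]$ and $\delta\in[0,\delta_{\mathrm U}]$, the stability-region procedure applied with $V(\cdot;c_\beta)$, $M(\cdot;c_\beta)$, $S(\cdot;c_\beta)$ gives a stability region $\mathbb X_{\mathrm S}$ satisfying $\widehat{\mathbb X}\subseteq\mathbb X_{\mathrm S}$. (ii) For every simplex collection $\mathcal S$ (without assuming (A1)–(A4)), and for $\beta,\delta\in[0,\infty)$, $$J(c_\beta;\widehat{\mathbb X},\mathcal S)\le J(c_0;\widehat{\mathbb X},\mathcal S).$$
   Context: Simplexes. Let $n,n_{\mathrm u},n_{\mathrm c}\in\mathbb N=\{1,2,\dots\}$, let $\mathbb X\subset\mathbb R^n$ be a bounded closed set containing the origin, and let $\widetilde{\mathbb X}\subset\mathbb R^n$ be a bounded open set containing $\mathbb X$. A simplex collection $\mathcal S=(\mathbb X_i)_{i\in\mathcal I}$ consists of a finite set $\mathcal I\subset\mathbb N$ and, for each $i\in\mathcal I$, vertices $x_{i,1},\dots,x_{i,n+1}\in\mathbb X$ such that $x_{i,j}-x_{i,n+1}$, $j=1,\dots,n$, are linearly independent; with $x_i(w):=\sum_{j=1}^{n+1}w_jx_{i,j}$ and $\mathbb X_i:=\{x_i(w): w_j\ge 0\ \forall j,\ \sum_{j=1}^{n+1}w_j=1\}$, it is required that $\mathbb X=\bigcup_{i\in\mathcal I}\mathbb X_i$. Its maximum sampling interval is $\tau:=\max_{i,j,j'}\|x_{i,j}-x_{i,j'}\|$. For continuous $\xi:\widetilde{\mathbb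 X}\to\mathbb R$, the linear interpolation $\xi^{\mathrm I}:\mathbb X\to\mathbb R$ with respect to $\mathcal S$ is given by $\xi^{\mathrm I}(x_i(w)):=\sum_{j}w_j\xi(x_{i,j})$ for all $i$ and all $x_i(w)\in\mathbb X_i$ (simplex collections are understood to fit together so that this is well defined). Lower and upper margins of $\xi$ are any numbers $\underline m(\xi),\overline m(\xi)\ge 0$ with $-\underline m(\xi)\le \xi(x)-\xi^{\mathrm I}(x)\le\overline m(\xi)$ for all $x\in\mathbb X$. Given margins, $\underline b(\xi):=\min_{i,j}\xi(x_{i,j})-\underline m(\xi)$, $\overline b(\xi):=\max_{i,j}\xi(x_{i,j})+\overline m(\xi)$, $g(\xi):=\max_{i,j,j'}|\xi(x_{i,j})-\xi(x_{i,j'})|/\tau$. Control problem. $\mu:\mathbb R^n\times\mathbb R^{n_{\mathrm u}}\to\mathbb R^n$ (nominal dynamics) and $\sigma:\mathbb R^n\times\mathbb R^{n_{\mathrm u}}\to[0,\infty)^n$ (uncertainty) are given. $\mathbb S_c\subset\mathbb R^{n_{\mathrm c}}$ is a (nonempty) bounded closed set; for $c\in\mathbb S_c$, $V(\cdot;c):\mathbb R^n\to\mathbb R$ is a $C^1$ function and $u(\cdot;c):\mathbb R^n\to\mathbb R^{n_{\mathrm u}}$ a controller. Put (with $\partial V/\partial x$ the gradient) $M(x;c):=\frac{\partial V(x;c)}{\partial x}^\top\mu(x,u(x;c))$, $S(x;c):=\sum_{s=1}^n\big|[\frac{\partial V(x;c)}{\partial x}]_s\big|[\sigma(x,u(x;c))]_s$,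 $W:=M+S$. For each $x$, $V(x;c)$ and $W(x;c)$ are continuous in $c\in\mathbb S_c$. A stability region associated with $c$ is a set $\mathbb X_{\mathrm S}\subseteq\mathbb X$ with $V(x;c)>0$ and $W(x;c)<0$ for all $x\in\mathbb X_{\mathrm S}$. A candidate region $\widehat{\mathbb X}\subseteq\mathbb X$ is given, together with continuous functions $\epsilon_V,\epsilon_W:\mathbb X\to(0,\infty)$. $J(\cdot;\widehat{\mathbb X},\mathcal S):\mathbb S_c\to[0,\infty)$ is a continuous performance index. For each $\delta\ge0$, $\zeta(\cdot;\delta):\mathbb R\to[0,\infty)$ is a nondecreasing continuous function with $\zeta(z;\delta)\ge z+\delta$ for $z>0$ and $0\le\zeta(z;\delta)\le\delta$ for $z\le0$. With $X_{\mathrm S}:=\{x_{i,j}: x_{i,j}\in\widehat{\mathbb X}\}$ the set of vertices of $\mathcal S$ in $\widehat{\mathbb X}$ and $\beta\ge0$, the objective is $$L(c;\beta,\widehat{\mathbb X},\mathcal S):=\beta J(c;\widehat{\mathbb X},\mathcal S)+\sum_{x\in X_{\mathrm S}}\Big(\zeta\big(\epsilon_V(x)-V(x;c);\delta\big)+\zeta\big(\epsilon_W(x)+W(x;c);\delta\big)\Big).$$ Function classes. Let $T\in\mathbb N$ be a predefined number. "Known" means identifiable from the form of the function and given information. For continuous $y:\widetilde{\mathbb X}\to\mathbb R$ write $\mathbb Y:=\{y(x):x\in\mathbb X\}$, $\mathbb Y^{\mathrm I}:=\{y^{\mathrm I}(x):x\in\mathbb X\}$, and consider $h:\widetilde{\mathbb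 Y}\to\mathbb R$ satisfying (H1): $\widetilde{\mathbb Y}\subseteq\mathbb R$ is an open set containing $\{y(x):x\in\widetilde{\mathbb X}\}$. $\mathcal H(y)$: those $h$ with (H1) and (H2): $h$ is $C^2$, and for some $C_h>0$, for any $\mathcal S$ there exist known constants $\underline{\partial}(h),\overline{\partial}(h),\underline{\partial^2}(h),\overline{\partial^2}(h)$ with $|\underline{\partial^2}(h)|+|\overline{\partial^2}(h)|<C_h$, $\underline{\partial}(h)\le h'\le\overline{\partial}(h)$ on $\mathbb Y$, and $\underline{\partial^2}(h)\le h''\le\overline{\partial^2}(h)$ on $\mathbb Y^{\mathrm I}$. $\mathcal H_{\mathrm{ndec}}(y)$: those $h$ with (H1) and (H3): $h$ is monotonically nondecreasing and $C^2$, and for some $C_h>0$, for any $\mathcal S$ there exist known constants with $\underline{\partial^2}(h)\le h''$ on $\mathbb Y^{\mathrm I}$, $h'\le\overline\partial(h)$ on $[\min\mathbb Y^{\mathrm I},\max\mathbb Y]$, and $|\underline{\partial^2}(h)|+|\overline\partial(h)|<C_h$. $\mathcal H_{\mathrm{conv}}(y)$: those $h$ with (H1) and (H4): $h$ is convex and Lipschitz continuous with a known Lipschitz constant $h_{\mathrm{Lip}}\ge0$. $\mathcal F(1)$: $C^2$ functions $\xi:\widetilde{\mathbb X}\to\mathbb R$ with known constants such that $\underline{d^2}(\xi)\le \frac{\partial^2}{\partial\chi^2}\xi(x+\chi\nu)|_{\chi=0}\le\overline{d^2}(\xi)$ for all $x\in\mathbb X$, $\|\nu\|=1$. For $N\ge2$,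 $\mathcal F(N)$: functions $\Phi:\widetilde{\mathbb X}\to\mathbb R$ for which there are known $\phi_s,\psi_s\in\mathcal F(N-1)$, $s=1,\dots,T$, and $h\in\mathcal H(y)$ with ( * ) $\Phi=h(y)$, $y=\sum_{s=1}^T\phi_s\psi_s$. $\mathcal F_{\ge0}$: functions $\widetilde{\mathbb X}\to[0,\infty)$. $\mathcal F^+(1):=\mathcal F(1)\cap\mathcal F_{\ge0}$. For $N\ge2$: $\mathcal F^+_{\mathrm{ndec}}(N)$: $\Phi\in\mathcal F_{\ge0}$ with ( * ) for known $\phi_s,\psi_s\in\mathcal F^+(N-1)$, $h\in\mathcal H_{\mathrm{ndec}}(y)$; $\mathcal F^+_{\mathrm{conv}}(N)$: $\Phi\in\mathcal F_{\ge0}$ with ( * ) for known $\phi_s,\psi_s\in\mathcal F(N-1)$, $h\in\mathcal H_{\mathrm{conv}}(y)$; $\mathcal F^+(N):=\mathcal F^+_{\mathrm{ndec}}(N)\cup\mathcal F^+_{\mathrm{conv}}(N)$. Class assumption (for $V,u,\mu,\sigma$): $T\ge n$, and there are known positive integers $N_\mu,N_\sigma,N_V,N_{\partial V}$ such that for every $s\in\{1,\dots,n\}$, on $\widetilde{\mathbb X}$: $[\mu(\cdot,u(\cdot))]_s\in\mathcal F(N_\mu)$, $[\sigma(\cdot,u(\cdot))]_s\in\mathcal F(N_\sigma)\cup\mathcal F^+(N_\sigma+1)$, $V\in\mathcal F(N_V)$, $[\partial V/\partial x]_s\in\mathcal F(N_{\partial V})$. Then $M\in\mathcal F(N_M)$,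 $S\in\mathcal F^+(N_S)$ with $N_M:=\max\{N_{\partial V},N_\mu\}+1$, $N_S:=\max\{N_{\partial V},N_\sigma\}+2$. Procedure $\mathcal A(\Phi,N,\mathcal S)$ for $\Phi\in\mathcal F(N)$ (the bounds in (H2), (H3) being those for the given $\mathcal S$). Step 0: for $\xi\in\mathcal F(1)$ set $\underline m(\xi)=\frac{n\tau^2}{8}\max\{0,\overline{d^2}(\xi)\}$, $\overline m(\xi)=\frac{n\tau^2}{8}\max\{0,-\underline{d^2}(\xi)\}$, and compute $\underline b(\xi),\overline b(\xi),g(\xi)$; if $N=1$ return these. If $N\ge2$: decompose $\Phi$ by ( * ); treat each $\xi\in\{\phi_s,\psi_s\}$ by Step 0 if $\xi\in\mathcal F(1)$ and by $\mathcal A(\xi,N-1,\mathcal S)$ otherwise. With $\underline a(\phi,\psi):=\max\{\underline m(\phi)\overline b(\psi),-\overline m(\phi)\underline b(\psi)\}$, $\overline a(\phi,\psi):=\max\{\overline m(\phi)\overline b(\psi),-\underline m(\phi)\underline b(\psi)\}$, set (P) $\underline m(y)=\sum_s(\underline a(\phi_s,\psi_s)+\underline a(\psi_s,\phi_s)+\tau^2g(\phi_s)g(\psi_s))$, $\overline m(y)=\sum_s(\overline a(\phi_s,\psi_s)+\overline a(\psi_s,\phi_s)+\tau^2g(\phi_s)g(\psi_s))$; then $\underline m(\Phi)=\max\{-\overline m(y)\underline\partial(h),\underline m(y)\overline\partial(h)\}+\tau^2\frac{n g(y)^2}{8}\max\{0,\overline{\partial^2}(h)\}$, $\overline m(\Phi)=\max\{-\underline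 m(y)\underline\partial(h),\overline m(y)\overline\partial(h)\}+\tau^2\frac{n g(y)^2}{8}\max\{0,-\underline{\partial^2}(h)\}$, and compute $\underline b(\Phi),\overline b(\Phi),g(\Phi)$. Procedure $\mathcal A^+(\Phi,N,\mathcal S)$ for $\Phi\in\mathcal F^+(N)$: if $N=1$, Step 0. If $N\ge2$: decompose by ( * ); for each $\xi\in\{\phi_s,\psi_s\}$ use Step 0 if $\xi\in\mathcal F(1)$, else $\mathcal A(\xi,N-1,\mathcal S)$ if $\xi\in\mathcal F(N-1)$, else $\mathcal A^+(\xi,N-1,\mathcal S)$. Case ndec: $\overline m(y)=\sum_s(\overline m(\phi_s)\overline b(\psi_s)+\overline m(\psi_s)\overline b(\phi_s)+\tau^2g(\phi_s)g(\psi_s))$, $\overline m(\Phi)=\overline m(y)\overline\partial(h)+\tau^2\frac{n g(y)^2}{8}\max\{0,-\underline{\partial^2}(h)\}$. Case conv: $\underline m(y),\overline m(y)$ by (P), $\overline m(\Phi)=h_{\mathrm{Lip}}\max\{\underline m(y),\overline m(y)\}$. Finally compute $\overline b(\Phi),g(\Phi)$. Stability-region procedure (for $V,u,\mu,\sigma,\mathcal S$): obtain $\underline m(V)$ by $\mathcal A(V,N_V,\mathcal S)$, $\overline m(M)$ by $\mathcal A(M,N_M,\mathcal S)$, $\overline m(S)$ by $\mathcal A^+(S,N_S,\mathcal S)$, put $\overline m(W)=\overline m(M)+\overline m(S)$, and output $\mathbb X_{\mathrm S}:=\bigcup_{i\in\mathcal I_{\mathrm S}}\mathbb X_i$ with $\mathcal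 I_{\mathrm S}:=\{i\in\mathcal I:\min_jV(x_{i,j})-\underline m(V)>0,\ \max_jW(x_{i,j})+\overline m(W)<0\}$. The margins obtained with parameter $c$ are written $\underline m(V;c)$, $\overline m(W;c)$. *)

theory Defs
  imports "HOL-Analysis.Analysis"
begin

section \<open>Differentiability\<close>

definition C1_on :: "'a::real_normed_vector set \<Rightarrow> ('a \<Rightarrow> 'b::real_normed_vector) \<Rightarrow> bool" where
  "C1_on U f \<longleftrightarrow> (\<exists>f'. (\<forall>x\<in>U. (f has_derivative blinfun_apply (f' x)) (at x)) \<and> continuous_on U f')"

definition C2_on :: "'a::real_normed_vector set \<Rightarrow> ('a \<Rightarrow> 'b::real_normed_vector) \<Rightarrow> bool" where
  "C2_on U f \<longleftrightarrow> (\<exists>f'. (\<forall>x\<in>U. (f has_derivative blinfun_apply (f' x)) (at x)) \<and> C1_on U f')"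

definition grad :: "('a::real_inner \<Rightarrow> real) \<Rightarrow> 'a \<Rightarrow> 'a" where
  "grad f x = (THE D. GDERIV f x :> D)"


section \<open>Simplex collections and linear interpolation\<close>

text \<open>\<open>verts S i j\<close> is the vertex \<open>x\<^sub>i\<^sub>,\<^sub>j\<close>; it is meaningful only for \<open>i \<in> idx S\<close> and
  \<open>j \<in> {1..n+1}\<close> with \<open>n = CARD('n)\<close>.\<close>

datatype ('n::finite) simplexes =
  Simplexes (idx: "nat set") (verts: "nat \<Rightarrow> nat \<Rightarrow> real^'n")

definition corners :: "('n::finite) simplexes \<Rightarrow> nat set" where
  "corners S = {1..CARD('n) + 1}"

definition weights :: "('n::finite) simplexes \<Rightarrow> (nat \<Rightarrow> real) set" where
  "weights S = {w. (\<forall>j\<in>corners S. 0 \<le> w j) \<and> (\<Sum>j\<in>corners S. w j) = 1}"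

definition point :: "('n::finite) simplexes \<Rightarrow> nat \<Rightarrow> (nat \<Rightarrow> real) \<Rightarrow> real^'n" where
  "point S i w = (\<Sum>j\<in>corners S. w j *\<^sub>R verts S i j)"

definition cell :: "('n::finite) simplexes \<Rightarrow> nat \<Rightarrow> (real^'n) set" where
  "cell S i = point S i ` weights S"

definition weighted_value ::
    "('n::finite) simplexes \<Rightarrow> (real^'n \<Rightarrow> real) \<Rightarrow> nat \<Rightarrow> (nat \<Rightarrow> real) \<Rightarrow> real" where
  "weighted_value S \<xi> i w = (\<Sum>j\<in>corners S. w j * \<xi> (verts S i j))"

text \<open>The last conjunct says that the simplexes fit together, i.e. that linear interpolation is
  well defined. Quantifying over all \<open>\<xi>\<close> or over the continuous ones makes no difference, since
  only the values at the finitely many vertices enter.\<close>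

definition simplex_collection :: "(real^'n::finite) set \<Rightarrow> 'n simplexes \<Rightarrow> bool" where
  "simplex_collection X S \<longleftrightarrow>
     finite (idx S) \<and> idx S \<subseteq> {1..} \<and>
     (\<forall>i\<in>idx S. \<forall>j\<in>corners S. verts S i j \<in> X) \<and>
     (\<forall>i\<in>idx S.
        inj_on (\<lambda>j. verts S i j - verts S i (CARD('n) + 1)) {1..CARD('n)} \<and>
        independent ((\<lambda>j. verts S i j - verts S i (CARD('n) + 1)) ` {1..CARD('n)})) \<and>
     X = (\<Union>i\<in>idx S. cell S i) \<and>
     (\<forall>\<xi>. \<forall>i\<in>idx S. \<forall>i'\<in>idx S. \<forall>w\<in>weights S. \<forall>w'\<in>weights S.
        point S i w = point S i' w' \<longrightarrow> weighted_value S \<xi> i w = weighted_value S \<xi> i' w')"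

definition mesh :: "('n::finite) simplexes \<Rightarrow> real" where
  "mesh S = Max {norm (verts S i j - verts S i j') | i j j'.
                   i \<in> idx S \<and> j \<in> corners S \<and> j' \<in> corners S}"

definition interp :: "('n::finite) simplexes \<Rightarrow> (real^'n \<Rightarrow> real) \<Rightarrow> real^'n \<Rightarrow> real" where
  "interp S \<xi> x =
     (THE v. \<exists>i\<in>idx S. \<exists>w\<in>weights S. x = point S i w \<and> v = weighted_value S \<xi> i w)"

definition vertex_values :: "('n::finite) simplexes \<Rightarrow> (real^'n \<Rightarrow> real) \<Rightarrow> real set" where
  "vertex_values S \<xi> = {\<xi> (verts S i j) | i j. i \<in> idx S \<and> j \<in> corners S}"

text \<open>\<open>lower_bound S \<xi> m\<close> and \<open>upper_bound S \<xi> m\<close> are the bounds on \<open>\<xi>\<close> obtained from a lower,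
  respectively upper, margin \<open>m\<close> of \<open>\<xi>\<close>.\<close>

definition lower_bound :: "('n::finite) simplexes \<Rightarrow> (real^'n \<Rightarrow> real) \<Rightarrow> real \<Rightarrow> real" where
  "lower_bound S \<xi> m = Min (vertex_values S \<xi>) - m"

definition upper_bound :: "('n::finite) simplexes \<Rightarrow> (real^'n \<Rightarrow> real) \<Rightarrow> real \<Rightarrow> real" where
  "upper_bound S \<xi> m = Max (vertex_values S \<xi>) + m"

definition slope :: "('n::finite) simplexes \<Rightarrow> (real^'n \<Rightarrow> real) \<Rightarrow> real" where
  "slope S \<xi> = Max {\<bar>\<xi> (verts S i j) - \<xi> (verts S i j')\<bar> | i j j'.
                     i \<in> idx S \<and> j \<in> corners S \<and> j' \<in> corners S} / mesh S"


section \<open>Function classes\<close>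

text \<open>Functions on an open set \<open>Xt\<close> are total functions of which only the values on \<open>Xt\<close> matter.
  Constants that have to be known for every simplex collection are functions of the collection.
  The set \<open>Yt\<close> is the open domain of \<open>h\<close>. In the nondecreasing case the interval from
  \<open>min (interp S y ` X)\<close> to \<open>max (y ` X)\<close> is intersected with \<open>Yt\<close>, because it may leave \<open>Yt\<close>
  (where \<open>h\<close> has no derivative) if \<open>X\<close> is disconnected.\<close>

definition H_bounds ::
    "(real^'n::finite) set \<Rightarrow> (real^'n) set \<Rightarrow> (real^'n \<Rightarrow> real) \<Rightarrow> (real \<Rightarrow> real) \<Rightarrow>
     ('n simplexes \<Rightarrow> real) \<Rightarrow> ('n simplexes \<Rightarrow> real) \<Rightarrow>
     ('n simplexes \<Rightarrow> real) \<Rightarrow> ('n simplexes \<Rightarrow> real) \<Rightarrow> bool" where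
  "H_bounds X Xt y h d_lo d_up dd_lo dd_up \<longleftrightarrow>
     (\<exists>Yt. open Yt \<and> y ` Xt \<subseteq> Yt \<and> C2_on Yt h) \<and>
     (\<exists>C>0. \<forall>S. simplex_collection X S \<longrightarrow>
        \<bar>dd_lo S\<bar> + \<bar>dd_up S\<bar> < C \<and>
        (\<forall>z\<in>y ` X. d_lo S \<le> deriv h z \<and> deriv h z \<le> d_up S) \<and>
        (\<forall>z\<in>interp S y ` X. dd_lo S \<le> (deriv ^^ 2) h z \<and> (deriv ^^ 2) h z \<le> dd_up S))"

definition H_ndec_bounds ::
    "(real^'n::finite) set \<Rightarrow> (real^'n) set \<Rightarrow> (real^'n \<Rightarrow> real) \<Rightarrow> (real \<Rightarrow> real) \<Rightarrow>
     ('n simplexes \<Rightarrow> real) \<Rightarrow> ('n simplexes \<Rightarrow> real) \<Rightarrow> bool" where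
  "H_ndec_bounds X Xt y h d_up dd_lo \<longleftrightarrow>
     (\<exists>Yt. open Yt \<and> y ` Xt \<subseteq> Yt \<and> C2_on Yt h \<and> mono_on Yt h \<and>
       (\<exists>C>0. \<forall>S. simplex_collection X S \<longrightarrow>
          (\<forall>z\<in>interp S y ` X. dd_lo S \<le> (deriv ^^ 2) h z) \<and>
          (\<forall>z\<in>{Inf (interp S y ` X)..Sup (y ` X)} \<inter> Yt. deriv h z \<le> d_up S) \<and>
          \<bar>dd_lo S\<bar> + \<bar>d_up S\<bar> < C))"

definition H_conv_bound ::
    "(real^'n::finite) set \<Rightarrow> (real^'n \<Rightarrow> real) \<Rightarrow> (real \<Rightarrow> real) \<Rightarrow> real \<Rightarrow> bool" where
  "H_conv_bound Xt y h L \<longleftrightarrow>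
     (\<exists>Yt. open Yt \<and> y ` Xt \<subseteq> Yt \<and> convex_on Yt h \<and> L-lipschitz_on Yt h)"

definition H_class ::
    "(real^'n::finite) set \<Rightarrow> (real^'n) set \<Rightarrow> (real^'n \<Rightarrow> real) \<Rightarrow> (real \<Rightarrow> real) set" where
  "H_class X Xt y = {h. \<exists>d_lo d_up dd_lo dd_up. H_bounds X Xt y h d_lo d_up dd_lo dd_up}"

definition H_ndec ::
    "(real^'n::finite) set \<Rightarrow> (real^'n) set \<Rightarrow> (real^'n \<Rightarrow> real) \<Rightarrow> (real \<Rightarrow> real) set" where
  "H_ndec X Xt y = {h. \<exists>d_up dd_lo. H_ndec_bounds X Xt y h d_up dd_lo}"

definition H_conv :: "(real^'n::finite) set \<Rightarrow> (real^'n \<Rightarrow> real) \<Rightarrow> (real \<Rightarrow> real) set" where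
  "H_conv Xt y = {h. \<exists>L. H_conv_bound Xt y h L}"

definition F1_bounds ::
    "(real^'n::finite) set \<Rightarrow> (real^'n) set \<Rightarrow> (real^'n \<Rightarrow> real) \<Rightarrow> real \<Rightarrow> real \<Rightarrow> bool" where
  "F1_bounds X Xt \<xi> d2_lo d2_up \<longleftrightarrow>
     C2_on Xt \<xi> \<and>
     (\<forall>x\<in>X. \<forall>\<nu>. norm \<nu> = 1 \<longrightarrow>
        d2_lo \<le> (deriv ^^ 2) (\<lambda>t. \<xi> (x + t *\<^sub>R \<nu>)) 0 \<and>
        (deriv ^^ 2) (\<lambda>t. \<xi> (x + t *\<^sub>R \<nu>)) 0 \<le> d2_up)"

definition F_nonneg :: "'a set \<Rightarrow> ('a \<Rightarrow> real) set" where
  "F_nonneg Xt = {\<xi>. \<forall>x\<in>Xt. 0 \<le> \<xi> x}"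

definition sum_prod :: "nat \<Rightarrow> (nat \<Rightarrow> 'a \<Rightarrow> real) \<Rightarrow> (nat \<Rightarrow> 'a \<Rightarrow> real) \<Rightarrow> 'a \<Rightarrow> real" where
  "sum_prod T \<phi> \<psi> x = (\<Sum>s = 1..T. \<phi> s x * \<psi> s x)"

definition compositions ::
    "'a set \<Rightarrow> nat \<Rightarrow> (('a \<Rightarrow> real) \<Rightarrow> (real \<Rightarrow> real) set) \<Rightarrow> ('a \<Rightarrow> real) set \<Rightarrow>
     ('a \<Rightarrow> real) set" where
  "compositions Xt T H A =
     {\<Phi>. \<exists>\<phi> \<psi>. (\<forall>s\<in>{1..T}. \<phi> s \<in> A \<and> \<psi> s \<in> A) \<and>
        (\<exists>h\<in>H (sum_prod T \<phi> \<psi>). \<forall>x\<in>Xt. \<Phi> x = h (sum_prod T \<phi> \<psi> x))}"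

fun F_class ::
    "(real^'n::finite) set \<Rightarrow> (real^'n) set \<Rightarrow> nat \<Rightarrow> nat \<Rightarrow> (real^'n \<Rightarrow> real) set" where
  "F_class X Xt T 0 = {}"
| "F_class X Xt T (Suc 0) = {\<xi>. \<exists>d2_lo d2_up. F1_bounds X Xt \<xi> d2_lo d2_up}"
| "F_class X Xt T (Suc (Suc N)) = compositions Xt T (H_class X Xt) (F_class X Xt T (Suc N))"

fun F_plus ::
    "(real^'n::finite) set \<Rightarrow> (real^'n) set \<Rightarrow> nat \<Rightarrow> nat \<Rightarrow> (real^'n \<Rightarrow> real) set" where
  "F_plus X Xt T 0 = {}"
| "F_plus X Xt T (Suc 0) = F_class X Xt T (Suc 0) \<inter> F_nonneg Xt"
| "F_plus X Xt T (Suc (Suc N)) =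
     F_nonneg Xt \<inter> compositions Xt T (H_ndec X Xt) (F_plus X Xt T (Suc N)) \<union>
     F_nonneg Xt \<inter> compositions Xt T (H_conv Xt) (F_class X Xt T (Suc N))"


section \<open>The margin procedures\<close>

text \<open>A decomposition tree records the known information from which the procedures compute: the
  functions of class 1 with their second-derivative bounds, and for every composition
  \<open>h (\<Sum>s=1..T. \<phi>\<^sub>s \<psi>\<^sub>s)\<close> the function \<open>h\<close>, its bounds, and the trees of the \<open>\<phi>\<^sub>s\<close> and \<open>\<psi>\<^sub>s\<close>.\<close>

datatype ('n::finite) h_info =
  Info_C2 "'n simplexes \<Rightarrow> real" "'n simplexes \<Rightarrow> real"
          "'n simplexes \<Rightarrow> real" "'n simplexes \<Rightarrow> real"
| Info_ndec "'n simplexes \<Rightarrow> real" "'n simplexes \<Rightarrow> real"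
| Info_conv real

datatype ('n::finite) tree =
  Leaf "real^'n \<Rightarrow> real" real real
| Node "real \<Rightarrow> real" "'n h_info" "nat \<Rightarrow> 'n tree" "nat \<Rightarrow> 'n tree"

primrec tree_fun :: "nat \<Rightarrow> ('n::finite) tree \<Rightarrow> real^'n \<Rightarrow> real" where
  "tree_fun T (Leaf \<xi> d2_lo d2_up) = \<xi>"
| "tree_fun T (Node h B \<phi> \<psi>) =
     (\<lambda>x. h (sum_prod T (\<lambda>s. tree_fun T (\<phi> s)) (\<lambda>s. tree_fun T (\<psi> s)) x))"

text \<open>Margins are pairs (lower margin, upper margin).\<close>

definition a_lower ::
    "('n::finite) simplexes \<Rightarrow> real \<times> real \<Rightarrow> (real^'n \<Rightarrow> real) \<Rightarrow> real \<times> real \<Rightarrow> real" where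
  "a_lower S m\<phi> \<psi> m\<psi> =
     max (fst m\<phi> * upper_bound S \<psi> (snd m\<psi>)) (- snd m\<phi> * lower_bound S \<psi> (fst m\<psi>))"

definition a_upper ::
    "('n::finite) simplexes \<Rightarrow> real \<times> real \<Rightarrow> (real^'n \<Rightarrow> real) \<Rightarrow> real \<times> real \<Rightarrow> real" where
  "a_upper S m\<phi> \<psi> m\<psi> =
     max (snd m\<phi> * upper_bound S \<psi> (snd m\<psi>)) (- fst m\<phi> * lower_bound S \<psi> (fst m\<psi>))"

definition sum_prod_margins ::
    "nat \<Rightarrow> ('n::finite) simplexes \<Rightarrow> (nat \<Rightarrow> real^'n \<Rightarrow> real) \<Rightarrow> (nat \<Rightarrow> real \<times> real) \<Rightarrow>
     (nat \<Rightarrow> real^'n \<Rightarrow> real) \<Rightarrow> (nat \<Rightarrow> real \<times> real) \<Rightarrow> real \<times> real" where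
  "sum_prod_margins T S \<phi> m\<phi> \<psi> m\<psi> =
     (\<Sum>s = 1..T. a_lower S (m\<phi> s) (\<psi> s) (m\<psi> s) + a_lower S (m\<psi> s) (\<phi> s) (m\<phi> s)
        + (mesh S)\<^sup>2 * slope S (\<phi> s) * slope S (\<psi> s),
      \<Sum>s = 1..T. a_upper S (m\<phi> s) (\<psi> s) (m\<psi> s) + a_upper S (m\<psi> s) (\<phi> s) (m\<phi> s)
        + (mesh S)\<^sup>2 * slope S (\<phi> s) * slope S (\<psi> s))"

definition sum_prod_upper_ndec ::
    "nat \<Rightarrow> ('n::finite) simplexes \<Rightarrow> (nat \<Rightarrow> real^'n \<Rightarrow> real) \<Rightarrow> (nat \<Rightarrow> real \<times> real) \<Rightarrow>
     (nat \<Rightarrow> real^'n \<Rightarrow> real) \<Rightarrow> (nat \<Rightarrow> real \<times> real) \<Rightarrow> real" where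
  "sum_prod_upper_ndec T S \<phi> m\<phi> \<psi> m\<psi> =
     (\<Sum>s = 1..T. snd (m\<phi> s) * upper_bound S (\<psi> s) (snd (m\<psi> s))
        + snd (m\<psi> s) * upper_bound S (\<phi> s) (snd (m\<phi> s))
        + (mesh S)\<^sup>2 * slope S (\<phi> s) * slope S (\<psi> s))"

text \<open>For nondecreasing and for convex \<open>h\<close> only an upper margin is produced; the lower component
  is then left unspecified, and it is never used for trees satisfying \<open>tree_F_plus\<close> below.\<close>

definition node_margins ::
    "nat \<Rightarrow> ('n::finite) simplexes \<Rightarrow> 'n h_info \<Rightarrow>
     (nat \<Rightarrow> real^'n \<Rightarrow> real) \<Rightarrow> (nat \<Rightarrow> real \<times> real) \<Rightarrow>
     (nat \<Rightarrow> real^'n \<Rightarrow> real) \<Rightarrow> (nat \<Rightarrow> real \<times> real) \<Rightarrow> real \<times> real" where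
  "node_margins T S B \<phi> m\<phi> \<psi> m\<psi> =
     (let q = (mesh S)\<^sup>2 * (real CARD('n) * (slope S (sum_prod T \<phi> \<psi>))\<^sup>2 / 8);
          (m_lo, m_up) = sum_prod_margins T S \<phi> m\<phi> \<psi> m\<psi>
      in case B of
           Info_C2 d_lo d_up dd_lo dd_up \<Rightarrow>
             (max (- m_up * d_lo S) (m_lo * d_up S) + q * max 0 (dd_up S),
              max (- m_lo * d_lo S) (m_up * d_up S) + q * max 0 (- dd_lo S))
         | Info_ndec d_up dd_lo \<Rightarrow>
             (undefined,
              sum_prod_upper_ndec T S \<phi> m\<phi> \<psi> m\<psi> * d_up S + q * max 0 (- dd_lo S))
         | Info_conv L \<Rightarrow> (undefined, L * max m_lo m_up))"

primrec margins :: "nat \<Rightarrow> ('n::finite) simplexes \<Rightarrow> 'n tree \<Rightarrow> real \<times> real" where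
  "margins T S (Leaf \<xi> d2_lo d2_up) =
     (real CARD('n) * (mesh S)\<^sup>2 / 8 * max 0 d2_up,
      real CARD('n) * (mesh S)\<^sup>2 / 8 * max 0 (- d2_lo))"
| "margins T S (Node h B \<phi> \<psi>) =
     node_margins T S B (\<lambda>s. tree_fun T (\<phi> s)) (\<lambda>s. margins T S (\<phi> s))
                        (\<lambda>s. tree_fun T (\<psi> s)) (\<lambda>s. margins T S (\<psi> s))"

definition lower_margin :: "nat \<Rightarrow> ('n::finite) simplexes \<Rightarrow> 'n tree \<Rightarrow> real" where
  "lower_margin T S D = fst (margins T S D)"

definition upper_margin :: "nat \<Rightarrow> ('n::finite) simplexes \<Rightarrow> 'n tree \<Rightarrow> real" where
  "upper_margin T S D = snd (margins T S D)"

text \<open>\<open>tree_F X Xt T N D\<close>: the procedure for class \<open>F_class X Xt T N\<close> can be run on \<open>D\<close>. An inner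
  function known to be of class 1 is a leaf whatever the level, so that it is treated directly;
  otherwise it is decomposed as a member of the class of the next lower level.
  \<open>tree_F_plus\<close> is the analogue for \<open>F_plus X Xt T N\<close>.\<close>

inductive tree_F ::
    "(real^'n::finite) set \<Rightarrow> (real^'n) set \<Rightarrow> nat \<Rightarrow> nat \<Rightarrow> 'n tree \<Rightarrow> bool"
  for X Xt T where
  leaf: "F1_bounds X Xt \<xi> d2_lo d2_up \<Longrightarrow> tree_F X Xt T 1 (Leaf \<xi> d2_lo d2_up)"
| node: "\<lbrakk>1 \<le> N;
          \<forall>s\<in>{1..T}. \<forall>D\<in>{\<phi> s, \<psi> s}. tree_fun T D \<in> F_class X Xt T N \<and>
             (tree_F X Xt T 1 D \<or> tree_F X Xt T N D);
          H_bounds X Xt (sum_prod T (\<lambda>s. tree_fun T (\<phi> s)) (\<lambda>s. tree_fun T (\<psi> s))) h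
            d_lo d_up dd_lo dd_up\<rbrakk>
         \<Longrightarrow> tree_F X Xt T (Suc N) (Node h (Info_C2 d_lo d_up dd_lo dd_up) \<phi> \<psi>)"

inductive tree_F_plus ::
    "(real^'n::finite) set \<Rightarrow> (real^'n) set \<Rightarrow> nat \<Rightarrow> nat \<Rightarrow> 'n tree \<Rightarrow> bool"
  for X Xt T where
  leaf: "\<lbrakk>F1_bounds X Xt \<xi> d2_lo d2_up; \<xi> \<in> F_nonneg Xt\<rbrakk>
         \<Longrightarrow> tree_F_plus X Xt T 1 (Leaf \<xi> d2_lo d2_up)"
| ndec: "\<lbrakk>1 \<le> N;
          \<forall>s\<in>{1..T}. \<forall>D\<in>{\<phi> s, \<psi> s}. tree_fun T D \<in> F_plus X Xt T N \<and>
             (tree_F X Xt T 1 D \<or> tree_F X Xt T N D \<or> tree_F_plus X Xt T N D);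
          H_ndec_bounds X Xt (sum_prod T (\<lambda>s. tree_fun T (\<phi> s)) (\<lambda>s. tree_fun T (\<psi> s))) h
            d_up dd_lo;
          tree_fun T (Node h (Info_ndec d_up dd_lo) \<phi> \<psi>) \<in> F_nonneg Xt\<rbrakk>
         \<Longrightarrow> tree_F_plus X Xt T (Suc N) (Node h (Info_ndec d_up dd_lo) \<phi> \<psi>)"
| conv: "\<lbrakk>1 \<le> N;
          \<forall>s\<in>{1..T}. \<forall>D\<in>{\<phi> s, \<psi> s}. tree_fun T D \<in> F_class X Xt T N \<and>
             (tree_F X Xt T 1 D \<or> tree_F X Xt T N D);
          H_conv_bound Xt (sum_prod T (\<lambda>s. tree_fun T (\<phi> s)) (\<lambda>s. tree_fun T (\<psi> s))) h L;
          tree_fun T (Node h (Info_conv L) \<phi> \<psi>) \<in> F_nonneg Xt\<rbrakk>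
         \<Longrightarrow> tree_F_plus X Xt T (Suc N) (Node h (Info_conv L) \<phi> \<psi>)"

definition decomposition_F ::
    "(real^'n::finite) set \<Rightarrow> (real^'n) set \<Rightarrow> nat \<Rightarrow> nat \<Rightarrow> 'n tree \<Rightarrow> (real^'n \<Rightarrow> real) \<Rightarrow> bool"
  where
  "decomposition_F X Xt T N D \<Phi> \<longleftrightarrow> tree_F X Xt T N D \<and> (\<forall>x\<in>Xt. \<Phi> x = tree_fun T D x)"

definition decomposition_F_plus ::
    "(real^'n::finite) set \<Rightarrow> (real^'n) set \<Rightarrow> nat \<Rightarrow> nat \<Rightarrow> 'n tree \<Rightarrow> (real^'n \<Rightarrow> real) \<Rightarrow> bool"
  where
  "decomposition_F_plus X Xt T N D \<Phi> \<longleftrightarrow>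
     tree_F_plus X Xt T N D \<and> (\<forall>x\<in>Xt. \<Phi> x = tree_fun T D x)"


section \<open>The control problem\<close>

text \<open>Below, \<open>v\<close> stands for \<open>V(\<cdot>;c)\<close>, \<open>k\<close> for the controller \<open>u(\<cdot>;c)\<close>.\<close>

definition M_fun ::
    "(real^'n::finite \<Rightarrow> real^'u::finite \<Rightarrow> real^'n) \<Rightarrow> (real^'n \<Rightarrow> real) \<Rightarrow>
     (real^'n \<Rightarrow> real^'u) \<Rightarrow> real^'n \<Rightarrow> real" where
  "M_fun \<mu> v k x = grad v x \<bullet> \<mu> x (k x)"

definition S_fun ::
    "(real^'n::finite \<Rightarrow> real^'u::finite \<Rightarrow> real^'n) \<Rightarrow> (real^'n \<Rightarrow> real) \<Rightarrow>
     (real^'n \<Rightarrow> real^'u) \<Rightarrow> real^'n \<Rightarrow> real" where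
  "S_fun \<sigma> v k x = (\<Sum>s\<in>UNIV. \<bar>grad v x $ s\<bar> * \<sigma> x (k x) $ s)"

definition W_fun ::
    "(real^'n::finite \<Rightarrow> real^'u::finite \<Rightarrow> real^'n) \<Rightarrow> (real^'n \<Rightarrow> real^'u \<Rightarrow> real^'n) \<Rightarrow>
     (real^'n \<Rightarrow> real) \<Rightarrow> (real^'n \<Rightarrow> real^'u) \<Rightarrow> real^'n \<Rightarrow> real" where
  "W_fun \<mu> \<sigma> v k x = M_fun \<mu> v k x + S_fun \<sigma> v k x"

definition stability_region ::
    "'a set \<Rightarrow> ('a \<Rightarrow> real) \<Rightarrow> ('a \<Rightarrow> real) \<Rightarrow> 'a set \<Rightarrow> bool" where
  "stability_region X v w R \<longleftrightarrow> R \<subseteq> X \<and> (\<forall>x\<in>R. v x > 0 \<and> w x < 0)"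

definition vertices_in :: "('n::finite) simplexes \<Rightarrow> (real^'n) set \<Rightarrow> (real^'n) set" where
  "vertices_in S Xh = {verts S i j | i j. i \<in> idx S \<and> j \<in> corners S \<and> verts S i j \<in> Xh}"

definition objective ::
    "('c \<Rightarrow> (real^'n::finite) set \<Rightarrow> 'n simplexes \<Rightarrow> real) \<Rightarrow> (real \<Rightarrow> real \<Rightarrow> real) \<Rightarrow>
     (real^'n \<Rightarrow> real) \<Rightarrow> (real^'n \<Rightarrow> real) \<Rightarrow>
     ('c \<Rightarrow> real^'n \<Rightarrow> real) \<Rightarrow> ('c \<Rightarrow> real^'n \<Rightarrow> real) \<Rightarrow>
     real \<Rightarrow> real \<Rightarrow> (real^'n) set \<Rightarrow> 'n simplexes \<Rightarrow> 'c \<Rightarrow> real" where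
  "objective J \<zeta> \<epsilon>V \<epsilon>W V W \<delta> \<beta> Xh S c =
     \<beta> * J c Xh S +
     (\<Sum>x\<in>vertices_in S Xh. \<zeta> (\<epsilon>V x - V c x) \<delta> + \<zeta> (\<epsilon>W x + W c x) \<delta>)"

definition class_assumption ::
    "(real^'n::finite) set \<Rightarrow> (real^'n) set \<Rightarrow> nat \<Rightarrow>
     (real^'n \<Rightarrow> real^'u::finite \<Rightarrow> real^'n) \<Rightarrow> (real^'n \<Rightarrow> real^'u \<Rightarrow> real^'n) \<Rightarrow>
     (real^'n \<Rightarrow> real) \<Rightarrow> (real^'n \<Rightarrow> real^'u) \<Rightarrow> nat \<Rightarrow> nat \<Rightarrow> nat \<Rightarrow> nat \<Rightarrow> bool" where
  "class_assumption X Xt T \<mu> \<sigma> v k N\<mu> N\<sigma> NV NdV \<longleftrightarrow>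
     CARD('n) \<le> T \<and> 0 < N\<mu> \<and> 0 < N\<sigma> \<and> 0 < NV \<and> 0 < NdV \<and>
     v \<in> F_class X Xt T NV \<and>
     (\<forall>s. (\<lambda>x. \<mu> x (k x) $ s) \<in> F_class X Xt T N\<mu> \<and>
          (\<lambda>x. \<sigma> x (k x) $ s) \<in> F_class X Xt T N\<sigma> \<union> F_plus X Xt T (N\<sigma> + 1) \<and>
          (\<lambda>x. grad v x $ s) \<in> F_class X Xt T NdV)"

text \<open>\<open>mV\<close> is the lower margin of \<open>v\<close>, \<open>mW\<close> the upper margin of \<open>w\<close>.\<close>

definition certified_region ::
    "('n::finite) simplexes \<Rightarrow> (real^'n \<Rightarrow> real) \<Rightarrow> (real^'n \<Rightarrow> real) \<Rightarrow> real \<Rightarrow> real \<Rightarrow>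
     (real^'n) set" where
  "certified_region S v w mV mW =
     (\<Union>i\<in>{i \<in> idx S. Min ((\<lambda>j. v (verts S i j)) ` corners S) - mV > 0 \<and>
                      Max ((\<lambda>j. w (verts S i j)) ` corners S) + mW < 0}. cell S i)"

definition admissible_intervals :: "(real^'n::finite) set \<Rightarrow> (real^'n) set \<Rightarrow> real set" where
  "admissible_intervals X Xh =
     {\<tau>. \<tau> > 0 \<and> (\<exists>S. simplex_collection X S \<and> mesh S = \<tau> \<and>
            (\<exists>Ih \<subseteq> idx S. Ih \<noteq> {} \<and> Xh = (\<Union>i\<in>Ih. cell S i)))}"


section \<open>Existence of decompositions\<close>

text \<open>\<open>decompositions_exist\<close>: under the class assumption the functions \<open>V\<close>, \<open>M\<close> and \<open>S\<close> have
  decomposition trees of the levels \<open>N\<^sub>V\<close>, \<open>N\<^sub>M\<close> and \<open>N\<^sub>S\<close>. Hence requiring given trees to be such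
  decompositions only names the input of the procedures and restricts nothing further.\<close>

lemma C2_on_const: "C2_on U (\<lambda>x. c)"
  unfolding C2_on_def C1_on_def
  by (rule exI[of _ "\<lambda>_. 0"]) (auto intro!: exI[of _ "\<lambda>_. 0"] simp: zero_blinfun.rep_eq)

lemma C2_on_ident: "C2_on U (\<lambda>x. x)"
  unfolding C2_on_def C1_on_def
  by (rule exI[of _ "\<lambda>_. id_blinfun"]) (auto intro!: exI[of _ "\<lambda>_. 0"] simp: zero_blinfun.rep_eq)

lemma deriv2_const: "(deriv ^^ 2) (\<lambda>x. c) (z::real) = (0::real)"
  by (simp add: numeral_2_eq_2)

lemma deriv2_ident: "(deriv ^^ 2) (\<lambda>x. x) (z::real) = (0::real)"
proof -
  have "deriv (\<lambda>x::real. x) = (\<lambda>_. 1)" by (simp add: fun_eq_iff)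
  thus ?thesis by (simp add: numeral_2_eq_2)
qed

lemma C2_on_cong:
  assumes "open U" "\<forall>x\<in>U. f x = g x" "C2_on U f" shows "C2_on U g"
proof -
  obtain f' where f': "\<forall>x\<in>U. (f has_derivative blinfun_apply (f' x)) (at x)" "C1_on U f'"
    using assms(3) unfolding C2_on_def by blast
  have "\<forall>x\<in>U. (g has_derivative blinfun_apply (f' x)) (at x)"
    using f'(1) assms(1,2) by (metis has_derivative_transform_within_open)
  thus ?thesis using f'(2) unfolding C2_on_def by blast
qed

lemma F1_bounds_cong:
  assumes "open Xt" "X \<subseteq> Xt" "\<forall>x\<in>Xt. f x = g x" "F1_bounds X Xt f a b"
  shows "F1_bounds X Xt g a b"
proof -
  have "(deriv ^^ 2) (\<lambda>t. f (x + t *\<^sub>R \<nu>)) 0 = (deriv ^^ 2) (\<lambda>t. g (x + t *\<^sub>R \<nu>)) 0"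
    if "x \<in> X" for x \<nu>
  proof -
    have t: "((\<lambda>t. x + t *\<^sub>R \<nu>) \<longlongrightarrow> x + 0 *\<^sub>R \<nu>) (nhds (0::real))"
      by (intro tendsto_intros filterlim_ident)
    have "eventually (\<lambda>t. x + t *\<^sub>R \<nu> \<in> Xt) (nhds (0::real))"
      by (rule topological_tendstoD[OF t]) (use assms that in auto)
    hence "eventually (\<lambda>t. f (x + t *\<^sub>R \<nu>) = g (x + t *\<^sub>R \<nu>)) (nhds (0::real))"
      by eventually_elim (use assms(3) in auto)
    hence e: "eventually (\<lambda>r. eventually (\<lambda>t. f (x + t *\<^sub>R \<nu>) = g (x + t *\<^sub>R \<nu>)) (nhds r)) (nhds (0::real))"
      by (simp add: eventually_eventually)
    have "eventually (\<lambda>r. deriv (\<lambda>t. f (x + t *\<^sub>R \<nu>)) r = deriv (\<lambda>t. g (x + t *\<^sub>R \<nu>)) r) (nhds (0::real))"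
      using e by eventually_elim (intro deriv_cong_ev, auto)
    thus ?thesis by (simp add: numeral_2_eq_2 deriv_cong_ev)
  qed
  thus ?thesis using assms C2_on_cong[of Xt f g] unfolding F1_bounds_def by metis
qed

lemma sum_prod_cong:
  assumes "\<forall>s\<in>{1..T}. \<phi> s x = \<phi>' s x \<and> \<psi> s x = \<psi>' s x"
  shows "sum_prod T \<phi> \<psi> x = sum_prod T \<phi>' \<psi>' x"
  using assms unfolding sum_prod_def by (intro sum.cong) auto

lemma F_class_cong:
  assumes "open Xt" "X \<subseteq> Xt" "\<forall>x\<in>Xt. f x = g x" "f \<in> F_class X Xt T N"
  shows "g \<in> F_class X Xt T N"
proof (cases "(X, Xt, T, N)" rule: F_class.cases)
  case (3 a b c d)
  have "f \<in> compositions Xt T H A \<Longrightarrow> g \<in> compositions Xt T H A" for H A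
    using assms(3) by (simp add: compositions_def)
  thus ?thesis using assms 3 by auto
qed (use assms F1_bounds_cong[of Xt X f g] in \<open>auto, blast\<close>)

lemma F_plus_cong:
  assumes "open Xt" "X \<subseteq> Xt" "\<forall>x\<in>Xt. f x = g x" "f \<in> F_plus X Xt T N"
  shows "g \<in> F_plus X Xt T N"
proof (cases "(X, Xt, T, N)" rule: F_plus.cases)
  case (3 a b c d)
  have n: "f \<in> F_nonneg Xt \<Longrightarrow> g \<in> F_nonneg Xt" using assms(3) by (auto simp: F_nonneg_def)
  have c: "f \<in> compositions Xt T H A \<Longrightarrow> g \<in> compositions Xt T H A" for H A
    using assms(3) by (simp add: compositions_def)
  show ?thesis using assms 3 n c by auto
qed (use assms F_class_cong[of Xt X f g] in \<open>auto simp: F_nonneg_def simp del: F_class.simps\<close>)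

lemma interp_cong:
  assumes "simplex_collection X S" "\<forall>x\<in>X. f x = g x"
  shows "interp S f = interp S g"
proof -
  have "weighted_value S f i w = weighted_value S g i w" if "i \<in> idx S" for i w
  proof -
    have "verts S i j \<in> X" if "j \<in> corners S" for j
      using assms(1) that \<open>i \<in> idx S\<close> unfolding simplex_collection_def by blast
    thus ?thesis using assms(2) unfolding weighted_value_def by (intro sum.cong) auto
  qed
  thus ?thesis unfolding interp_def by (simp cong: bex_cong)
qed

lemma H_bounds_cong:
  assumes "X \<subseteq> Xt" "\<forall>x\<in>Xt. y x = z x" "H_bounds X Xt y h a b c d"
  shows "H_bounds X Xt z h a b c d"
proof -
  have 1: "y ` Xt = z ` Xt" "y ` X = z ` X" using assms by (auto intro!: image_cong)
  have 2: "simplex_collection X S \<Longrightarrow> interp S y = interp S z" for S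
    using interp_cong assms(1,2) by (metis subsetD)
  show ?thesis using assms(3) 1 2 unfolding H_bounds_def by (simp cong: conj_cong)
qed

lemma H_ndec_bounds_cong:
  assumes "X \<subseteq> Xt" "\<forall>x\<in>Xt. y x = z x" "H_ndec_bounds X Xt y h a b"
  shows "H_ndec_bounds X Xt z h a b"
proof -
  have 1: "y ` Xt = z ` Xt" "y ` X = z ` X" using assms by (auto intro!: image_cong)
  have 2: "simplex_collection X S \<Longrightarrow> interp S y = interp S z" for S
    using interp_cong assms(1,2) by (metis subsetD)
  show ?thesis using assms(3) 1 2 unfolding H_ndec_bounds_def by (simp cong: conj_cong)
qed

lemma H_conv_bound_cong:
  assumes "\<forall>x\<in>Xt. y x = z x" "H_conv_bound Xt y h L"
  shows "H_conv_bound Xt z h L"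
proof -
  have "y ` Xt = z ` Xt" using assms by (auto intro!: image_cong)
  thus ?thesis using assms(2) unfolding H_conv_bound_def by simp
qed

lemma tree_F_ex:
  assumes "open Xt" "X \<subseteq> Xt"
  shows "\<Phi> \<in> F_class X Xt T N \<Longrightarrow> \<exists>D. decomposition_F X Xt T N D \<Phi>"
proof (induction N arbitrary: \<Phi>)
  case 0 thus ?case by simp
next
  case (Suc N)
  show ?case
  proof (cases N)
    case 0
    then obtain a b where "F1_bounds X Xt \<Phi> a b" using Suc by auto
    hence "decomposition_F X Xt T 1 (Leaf \<Phi> a b) \<Phi>"
      by (auto simp: decomposition_F_def intro: tree_F.leaf[unfolded One_nat_def])
    thus ?thesis using 0 by auto
  next
    case (Suc N')
    obtain \<phi> \<psi> h where 1: "\<forall>s\<in>{1..T}. \<phi> s \<in> F_class X Xt T N \<and> \<psi> s \<in> F_class X Xt T N"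
      "h \<in> H_class X Xt (sum_prod T \<phi> \<psi>)" "\<forall>x\<in>Xt. \<Phi> x = h (sum_prod T \<phi> \<psi> x)"
      using Suc.prems Suc by (auto simp: compositions_def)
    obtain a b c d where H: "H_bounds X Xt (sum_prod T \<phi> \<psi>) h a b c d"
      using 1(2) by (auto simp: H_class_def)
    have "\<forall>s. \<exists>D. s\<in>{1..T} \<longrightarrow> decomposition_F X Xt T N D (\<phi> s)" using 1(1) Suc.IH by blast
    then obtain P where P: "\<And>s. s\<in>{1..T} \<Longrightarrow> decomposition_F X Xt T N (P s) (\<phi> s)" by metis
    have "\<forall>s. \<exists>D. s\<in>{1..T} \<longrightarrow> decomposition_F X Xt T N D (\<psi> s)" using 1(1) Suc.IH by blast
    then obtain Q where Q: "\<And>s. s\<in>{1..T} \<Longrightarrow> decomposition_F X Xt T N (Q s) (\<psi> s)" by metis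
    have eq: "\<forall>x\<in>Xt. sum_prod T \<phi> \<psi> x = sum_prod T (\<lambda>s. tree_fun T (P s)) (\<lambda>s. tree_fun T (Q s)) x"
      using P Q by (intro ballI sum_prod_cong) (auto simp: decomposition_F_def)
    have "tree_F X Xt T (Suc N) (Node h (Info_C2 a b c d) P Q)"
    proof (rule tree_F.node)
      show "1 \<le> N" using Suc by simp
      show "\<forall>s\<in>{1..T}. \<forall>D\<in>{P s, Q s}. tree_fun T D \<in> F_class X Xt T N \<and>
             (tree_F X Xt T 1 D \<or> tree_F X Xt T N D)"
        using P Q 1(1) F_class_cong[OF assms] unfolding decomposition_F_def by fast
      show "H_bounds X Xt (sum_prod T (\<lambda>s. tree_fun T (P s)) (\<lambda>s. tree_fun T (Q s))) h a b c d"
        using H_bounds_cong[OF assms(2) eq H] .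
    qed
    thus ?thesis using eq 1(3) unfolding decomposition_F_def by fastforce
  qed
qed

lemma tree_F_plus_ex:
  assumes "open Xt" "X \<subseteq> Xt"
  shows "\<Phi> \<in> F_plus X Xt T N \<Longrightarrow> \<exists>D. decomposition_F_plus X Xt T N D \<Phi>"
proof (induction N arbitrary: \<Phi>)
  case 0 thus ?case by simp
next
  case (Suc N)
  show ?case
  proof (cases N)
    case 0
    then obtain a b where "F1_bounds X Xt \<Phi> a b" "\<Phi> \<in> F_nonneg Xt" using Suc by auto
    hence "decomposition_F_plus X Xt T 1 (Leaf \<Phi> a b) \<Phi>"
      by (auto simp: decomposition_F_plus_def intro: tree_F_plus.leaf[unfolded One_nat_def])
    thus ?thesis using 0 by auto
  next
    case (Suc N')
    have nn: "\<Phi> \<in> F_nonneg Xt" using Suc.prems Suc by auto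
    consider "\<Phi> \<in> compositions Xt T (H_ndec X Xt) (F_plus X Xt T N)"
      | "\<Phi> \<in> compositions Xt T (H_conv Xt) (F_class X Xt T N)" using Suc.prems Suc by auto
    thus ?thesis
    proof cases
      case A: 1
      then obtain \<phi> \<psi> h where 1: "\<forall>s\<in>{1..T}. \<phi> s \<in> F_plus X Xt T N \<and> \<psi> s \<in> F_plus X Xt T N"
        "h \<in> H_ndec X Xt (sum_prod T \<phi> \<psi>)" "\<forall>x\<in>Xt. \<Phi> x = h (sum_prod T \<phi> \<psi> x)"
        by (auto simp: compositions_def)
      obtain a b where H: "H_ndec_bounds X Xt (sum_prod T \<phi> \<psi>) h a b"
        using 1(2) by (auto simp: H_ndec_def)
      have "\<forall>s. \<exists>D. s\<in>{1..T} \<longrightarrow> decomposition_F_plus X Xt T N D (\<phi> s)" using 1(1) Suc.IH by blast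
      then obtain P where P: "\<And>s. s\<in>{1..T} \<Longrightarrow> decomposition_F_plus X Xt T N (P s) (\<phi> s)" by metis
      have "\<forall>s. \<exists>D. s\<in>{1..T} \<longrightarrow> decomposition_F_plus X Xt T N D (\<psi> s)" using 1(1) Suc.IH by blast
      then obtain Q where Q: "\<And>s. s\<in>{1..T} \<Longrightarrow> decomposition_F_plus X Xt T N (Q s) (\<psi> s)" by metis
      have eq: "\<forall>x\<in>Xt. sum_prod T \<phi> \<psi> x = sum_prod T (\<lambda>s. tree_fun T (P s)) (\<lambda>s. tree_fun T (Q s)) x"
        using P Q by (intro ballI sum_prod_cong) (auto simp: decomposition_F_plus_def)
      have "tree_F_plus X Xt T (Suc N) (Node h (Info_ndec a b) P Q)"
      proof (rule tree_F_plus.ndec)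
        show "1 \<le> N" using Suc by simp
        show "\<forall>s\<in>{1..T}. \<forall>D\<in>{P s, Q s}. tree_fun T D \<in> F_plus X Xt T N \<and>
             (tree_F X Xt T 1 D \<or> tree_F X Xt T N D \<or> tree_F_plus X Xt T N D)"
          using P Q 1(1) F_plus_cong[OF assms] unfolding decomposition_F_plus_def by fast
        show "H_ndec_bounds X Xt (sum_prod T (\<lambda>s. tree_fun T (P s)) (\<lambda>s. tree_fun T (Q s))) h a b"
          using H_ndec_bounds_cong[OF assms(2) eq H] .
        show "tree_fun T (Node h (Info_ndec a b) P Q) \<in> F_nonneg Xt"
          using nn eq 1(3) by (auto simp: F_nonneg_def)
      qed
      thus ?thesis using eq 1(3) unfolding decomposition_F_plus_def by fastforce
    next
      case A: 2
      then obtain \<phi> \<psi> h where 1: "\<forall>s\<in>{1..T}. \<phi> s \<in> F_class X Xt T N \<and> \<psi> s \<in> F_class X Xt T N"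
        "h \<in> H_conv Xt (sum_prod T \<phi> \<psi>)" "\<forall>x\<in>Xt. \<Phi> x = h (sum_prod T \<phi> \<psi> x)"
        by (auto simp: compositions_def)
      obtain a where H: "H_conv_bound Xt (sum_prod T \<phi> \<psi>) h a"
        using 1(2) by (auto simp: H_conv_def)
      have "\<forall>s. \<exists>D. s\<in>{1..T} \<longrightarrow> decomposition_F X Xt T N D (\<phi> s)" using 1(1) tree_F_ex[OF assms] by blast
      then obtain P where P: "\<And>s. s\<in>{1..T} \<Longrightarrow> decomposition_F X Xt T N (P s) (\<phi> s)" by metis
      have "\<forall>s. \<exists>D. s\<in>{1..T} \<longrightarrow> decomposition_F X Xt T N D (\<psi> s)" using 1(1) tree_F_ex[OF assms] by blast
      then obtain Q where Q: "\<And>s. s\<in>{1..T} \<Longrightarrow> decomposition_F X Xt T N (Q s) (\<psi> s)" by metis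
      have eq: "\<forall>x\<in>Xt. sum_prod T \<phi> \<psi> x = sum_prod T (\<lambda>s. tree_fun T (P s)) (\<lambda>s. tree_fun T (Q s)) x"
        using P Q by (intro ballI sum_prod_cong) (auto simp: decomposition_F_def)
      have "tree_F_plus X Xt T (Suc N) (Node h (Info_conv a) P Q)"
      proof (rule tree_F_plus.conv)
        show "1 \<le> N" using Suc by simp
        show "\<forall>s\<in>{1..T}. \<forall>D\<in>{P s, Q s}. tree_fun T D \<in> F_class X Xt T N \<and>
             (tree_F X Xt T 1 D \<or> tree_F X Xt T N D)"
          using P Q 1(1) F_class_cong[OF assms] unfolding decomposition_F_def by fast
        show "H_conv_bound Xt (sum_prod T (\<lambda>s. tree_fun T (P s)) (\<lambda>s. tree_fun T (Q s))) h a"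
          using H_conv_bound_cong[OF eq H] .
        show "tree_fun T (Node h (Info_conv a) P Q) \<in> F_nonneg Xt"
          using nn eq 1(3) by (auto simp: F_nonneg_def)
      qed
      thus ?thesis using eq 1(3) unfolding decomposition_F_plus_def by fastforce
    qed
  qed
qed

lemma ident_H: "(\<lambda>z. z) \<in> H_class X Xt y"
proof -
  have "H_bounds X Xt y (\<lambda>z. z) (\<lambda>_. 1) (\<lambda>_. 1) (\<lambda>_. 0) (\<lambda>_. 0)"
    unfolding H_bounds_def
    by (intro conjI exI[of _ UNIV] exI[of _ 1]) (auto simp: C2_on_ident deriv2_ident)
  thus ?thesis unfolding H_class_def by blast
qed

lemma ident_H_ndec: "(\<lambda>z. z) \<in> H_ndec X Xt y"
proof -
  have "H_ndec_bounds X Xt y (\<lambda>z. z) (\<lambda>_. 1) (\<lambda>_. 0)"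
    unfolding H_ndec_bounds_def
    by (intro conjI exI[of _ UNIV] exI[of _ 2]) (auto simp: C2_on_ident deriv2_ident mono_on_def)
  thus ?thesis unfolding H_ndec_def by blast
qed

lemma abs_H_conv: "abs \<in> H_conv Xt y"
proof -
  have "convex_on UNIV (abs :: real \<Rightarrow> real)"
    by (rule convex_onI) (auto intro!: order_trans[OF abs_triangle_ineq] simp: abs_mult)
  moreover have "1-lipschitz_on UNIV (abs :: real \<Rightarrow> real)"
    by (rule lipschitz_onI) (auto simp: dist_real_def)
  ultimately have "H_conv_bound Xt y abs 1"
    unfolding H_conv_bound_def by (intro exI[of _ UNIV]) auto
  thus ?thesis unfolding H_conv_def by blast
qed

lemma const_F1: "(\<lambda>x. c) \<in> F_class X Xt T (Suc 0)"
  by (auto simp: F1_bounds_def C2_on_const deriv2_const intro!: exI[of _ 0])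

lemma sum_prod_single: "1 \<le> T \<Longrightarrow> sum_prod T (\<lambda>s. if s = 1 then f else (\<lambda>_. 0)) (\<lambda>_ _. 1) x = f x"
  by (simp add: sum_prod_def if_distrib[of "\<lambda>f. f _"] cong: if_cong)

lemma compositions_single:
  assumes "1 \<le> T" "f \<in> A" "(\<lambda>_. 0) \<in> A" "(\<lambda>_. 1) \<in> A" "\<And>y. h \<in> H y"
  shows "(\<lambda>x. h (f x)) \<in> compositions Xt T H A"
proof -
  have "\<forall>s\<in>{1..T}. (if s = 1 then f else (\<lambda>_. 0)) \<in> A \<and> (\<lambda>_. 1) \<in> A" using assms by auto
  moreover have "\<exists>h'\<in>H (sum_prod T (\<lambda>s. if s = 1 then f else (\<lambda>_. 0)) (\<lambda>_ _. 1)). \<forall>x\<in>Xt.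
     h (f x) = h' (sum_prod T (\<lambda>s. if s = 1 then f else (\<lambda>_. 0)) (\<lambda>_ _. 1) x)"
    by (rule bexI[of _ h]) (simp_all only: sum_prod_single[OF assms(1)] assms(5) ball_triv simp_thms)
  ultimately show ?thesis unfolding compositions_def
    by (intro CollectI exI[of _ "\<lambda>s. if s = 1 then f else (\<lambda>_. 0)"] exI[of _ "\<lambda>_ _. 1"] conjI)
qed

lemma F_const_mono:
  assumes "1 \<le> T"
  shows "(\<lambda>x. c) \<in> F_class X Xt T (Suc N) \<and> F_class X Xt T (Suc N) \<subseteq> F_class X Xt T (Suc (Suc N))"
proof -
  have step: "F_class X Xt T (Suc N) \<subseteq> F_class X Xt T (Suc (Suc N))"
    if "\<And>c. (\<lambda>x. c) \<in> F_class X Xt T (Suc N)" for N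
  proof
    fix f assume "f \<in> F_class X Xt T (Suc N)"
    thus "f \<in> F_class X Xt T (Suc (Suc N))"
      using compositions_single[OF assms, of f, OF _ that that ident_H] by simp
  qed
  have "\<And>c. (\<lambda>x. c) \<in> F_class X Xt T (Suc N)"
    by (induction N) (use const_F1 step in blast)+
  thus ?thesis using step by blast
qed

lemma F_mono:
  assumes "1 \<le> T" "1 \<le> N" "N \<le> N'" shows "F_class X Xt T N \<subseteq> F_class X Xt T N'"
  using assms(3,2)
proof (induction rule: dec_induct)
  case (step k) thus ?case using F_const_mono[OF assms(1), of _ X Xt "k - 1"] by (cases k) auto
qed auto

lemma F_plus_const_mono:
  assumes "1 \<le> T"
  shows "(0 \<le> c \<longrightarrow> (\<lambda>x. c) \<in> F_plus X Xt T (Suc N)) \<and> F_plus X Xt T (Suc N) \<subseteq> F_plus X Xt T (Suc (Suc N))"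
proof -
  have step: "F_plus X Xt T (Suc N) \<subseteq> F_plus X Xt T (Suc (Suc N))"
    if "\<And>c. 0 \<le> c \<Longrightarrow> (\<lambda>x. c) \<in> F_plus X Xt T (Suc N)" for N
  proof
    fix f assume f: "f \<in> F_plus X Xt T (Suc N)"
    hence "f \<in> F_nonneg Xt" by (cases N) auto
    moreover have "f \<in> compositions Xt T (H_ndec X Xt) (F_plus X Xt T (Suc N))"
      using compositions_single[OF assms f that that ident_H_ndec] by simp
    ultimately show "f \<in> F_plus X Xt T (Suc (Suc N))" by simp
  qed
  have "\<And>c. 0 \<le> c \<Longrightarrow> (\<lambda>x. c) \<in> F_plus X Xt T (Suc N)"
  proof (induction N)
    case 0 thus ?case using const_F1 by (auto simp: F_nonneg_def simp del: F_class.simps)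
  next
    case (Suc N) thus ?case using step by blast
  qed
  thus ?thesis using step by blast
qed

lemma F_plus_mono:
  assumes "1 \<le> T" "1 \<le> N" "N \<le> N'" shows "F_plus X Xt T N \<subseteq> F_plus X Xt T N'"
  using assms(3,2)
proof (induction rule: dec_induct)
  case (step k) thus ?case using F_plus_const_mono[OF assms(1), of 0 X Xt "k - 1"] by (cases k) auto
qed auto

lemma abs_F_plus:
  assumes "1 \<le> T" "1 \<le> N" "f \<in> F_class X Xt T N"
  shows "(\<lambda>x. \<bar>f x\<bar>) \<in> F_plus X Xt T (Suc N)"
proof -
  obtain M where N: "N = Suc M" using assms(2) by (cases N) auto
  have "(\<lambda>x. \<bar>f x\<bar>) \<in> compositions Xt T (H_conv Xt) (F_class X Xt T N)"
    by (rule compositions_single[OF assms(1,3) _ _ abs_H_conv])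
      (use F_const_mono[OF assms(1), of _ X Xt M] N in \<open>simp_all only:\<close>)
  thus ?thesis using N by (auto simp: F_nonneg_def)
qed

lemma sum_prod_UNIV:
  assumes "CARD('n::finite) \<le> T" "bij_betw b {1..CARD('n)} (UNIV::'n set)"
  shows "sum_prod T (\<lambda>s. if s \<le> CARD('n) then f (b s) else (\<lambda>_. 0)) (\<lambda>s. if s \<le> CARD('n) then g (b s) else (\<lambda>_. 0)) x
    = (\<Sum>s\<in>UNIV. f s x * g s x)"
proof -
  have "(\<Sum>s\<in>UNIV. f s x * g s x) = (\<Sum>s = 1..CARD('n). f (b s) x * g (b s) x)"
    using sum.reindex_bij_betw[OF assms(2), of "\<lambda>s. f s x * g s x"] by simp
  also have "\<dots> = sum_prod T (\<lambda>s. if s \<le> CARD('n) then f (b s) else (\<lambda>_. 0)) (\<lambda>s. if s \<le> CARD('n) then g (b s) else (\<lambda>_. 0)) x"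
    unfolding sum_prod_def by (rule sum.mono_neutral_cong_left) (use assms in auto)
  finally show ?thesis by simp
qed

lemma decompositions_exist:
  fixes \<mu> \<sigma> :: "real^'n::finite \<Rightarrow> real^'u::finite \<Rightarrow> real^'n"
  assumes "open Xt" "X \<subseteq> Xt" "\<And>x a s. 0 \<le> \<sigma> x a $ s"
    and "class_assumption X Xt T \<mu> \<sigma> v k N\<mu> N\<sigma> NV NdV"
  shows "(\<exists>D. decomposition_F X Xt T NV D v) \<and>
    (\<exists>D. decomposition_F X Xt T (max NdV N\<mu> + 1) D (M_fun \<mu> v k)) \<and>
    (\<exists>D. decomposition_F_plus X Xt T (max NdV N\<sigma> + 2) D (S_fun \<sigma> v k))"
proof -
  note A = assms(4)[unfolded class_assumption_def]
  have n: "1 \<le> CARD('n)" by (simp add: Suc_leI)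
  have T: "1 \<le> T" using A n by linarith
  obtain b where b: "bij_betw b {1..CARD('n)} (UNIV::'n set)"
    using ex_bij_betw_nat_finite_1[of "UNIV::'n set"] by auto
  define m where "m = max NdV N\<mu>"
  obtain m' where m': "m = Suc m'" using A unfolding m_def by (cases m) (auto simp: m_def)
  have d: "(\<lambda>x. grad v x $ s) \<in> F_class X Xt T m" for s
    using A F_mono[OF T, of NdV m X Xt] unfolding m_def by auto
  have mu: "(\<lambda>x. \<mu> x (k x) $ s) \<in> F_class X Xt T m" for s
    using A F_mono[OF T, of N\<mu> m X Xt] unfolding m_def by auto
  have z: "(\<lambda>_. 0) \<in> F_class X Xt T m" using F_const_mono[OF T, of 0 X Xt m'] m' by auto
  have "M_fun \<mu> v k \<in> compositions Xt T (H_class X Xt) (F_class X Xt T m)"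
    unfolding compositions_def M_fun_def inner_vec_def
    apply (rule CollectI)
    apply (rule exI[of _ "\<lambda>s. if s \<le> CARD('n) then (\<lambda>x. grad v x $ b s) else (\<lambda>_. 0)"])
    apply (rule exI[of _ "\<lambda>s. if s \<le> CARD('n) then (\<lambda>x. \<mu> x (k x) $ b s) else (\<lambda>_. 0)"])
    using d mu z ident_H sum_prod_UNIV[OF conjunct1[OF A] b, of "\<lambda>s x. grad v x $ s" "\<lambda>s x. \<mu> x (k x) $ s"]
    by (auto intro!: bexI[of _ "\<lambda>z. z"])
  hence M: "M_fun \<mu> v k \<in> F_class X Xt T (m + 1)" using m' by simp
  define q where "q = max NdV N\<sigma>"
  have q1: "1 \<le> q" using A unfolding q_def by auto
  have ad: "(\<lambda>x. \<bar>grad v x $ s\<bar>) \<in> F_plus X Xt T (Suc q)" for s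
    using A F_mono[OF T, of NdV q X Xt] abs_F_plus[OF T q1, of "\<lambda>x. grad v x $ s" X Xt] unfolding q_def by auto
  have sg: "(\<lambda>x. \<sigma> x (k x) $ s) \<in> F_plus X Xt T (Suc q)" for s
  proof (cases "(\<lambda>x. \<sigma> x (k x) $ s) \<in> F_class X Xt T N\<sigma>")
    case True
    hence "(\<lambda>x. \<bar>\<sigma> x (k x) $ s\<bar>) \<in> F_plus X Xt T (Suc q)"
      using A F_mono[OF T, of N\<sigma> q X Xt] abs_F_plus[OF T q1, of "\<lambda>x. \<sigma> x (k x) $ s" X Xt] unfolding q_def by auto
    thus ?thesis using assms(3) by simp
  next
    case False
    hence "(\<lambda>x. \<sigma> x (k x) $ s) \<in> F_plus X Xt T (N\<sigma> + 1)" using A by blast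
    moreover have "F_plus X Xt T (N\<sigma> + 1) \<subseteq> F_plus X Xt T (Suc q)"
      by (rule F_plus_mono[OF T]) (auto simp: q_def)
    ultimately show ?thesis by blast
  qed
  have zp: "(\<lambda>_. 0) \<in> F_plus X Xt T (Suc q)" using F_plus_const_mono[OF T, of 0 X Xt q] by auto
  have "S_fun \<sigma> v k \<in> compositions Xt T (H_ndec X Xt) (F_plus X Xt T (Suc q))"
    unfolding compositions_def S_fun_def
    apply (rule CollectI)
    apply (rule exI[of _ "\<lambda>s. if s \<le> CARD('n) then (\<lambda>x. \<bar>grad v x $ b s\<bar>) else (\<lambda>_. 0)"])
    apply (rule exI[of _ "\<lambda>s. if s \<le> CARD('n) then (\<lambda>x. \<sigma> x (k x) $ b s) else (\<lambda>_. 0)"])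
    using ad sg zp ident_H_ndec sum_prod_UNIV[OF conjunct1[OF A] b, of "\<lambda>s x. \<bar>grad v x $ s\<bar>" "\<lambda>s x. \<sigma> x (k x) $ s"]
    by (auto intro!: bexI[of _ "\<lambda>z. z"] simp del: F_plus.simps)
  moreover have "S_fun \<sigma> v k \<in> F_nonneg Xt"
    unfolding F_nonneg_def S_fun_def using assms(3) by (auto intro!: sum_nonneg)
  ultimately have S: "S_fun \<sigma> v k \<in> F_plus X Xt T (q + 2)" by simp
  show ?thesis
    using A M S tree_F_ex[OF assms(1,2)] tree_F_plus_ex[OF assms(1,2)] unfolding m_def q_def by blast
qed

end

theory Submission
  imports Defs
begin

text \<open>The proof of the first part has three components.

  \<^item> \<^emph>\<open>The margins are correct.\<close> The margins computed along a decomposition tree bound the error of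
  linear interpolation (\<open>tree_F_margins\<close>, \<open>tree_F_plus_margin\<close>). For leaves and outer functions this
  is a Taylor expansion at the interpolation point, where the linear terms average out and the
  remainder is bounded by the variance of the vertices (\<open>interpolation_error_lower\<close>,
  \<open>interpolation_error_upper\<close>); for products the defect is a covariance of the vertex values
  (\<open>product_defect\<close>). Consequently a certified region is always a stability region.

  \<^item> \<^emph>\<open>Minimizers are nearly feasible.\<close> For small \<open>\<beta>\<close> and \<open>\<delta>\<close> the objective of a feasible parameter is
  small, hence so is every penalty of the minimizer, and \<open>V\<close> and \<open>- W\<close> are bounded below by a fixed
  \<open>a > 0\<close> at all vertices in the candidate region (\<open>minimizer_nearly_feasible\<close>).

  \<^item> \<^emph>\<open>Positivity at these vertices certifies the candidate region\<close> if the collection is fine enough,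
  uniformly in the parameter (\<open>fine_collections_certify\<close>). The candidate region need not be a
  union of cells of the collection at hand, so cells that meet it can have vertices outside, about
  which the objective says nothing. The uniform quadratic margins close this gap by a compactness
  argument: along a sequence of ever finer collections with convergent parameters, positivity passes
  to the limit parameter on the interior of the region, by continuity to a neighbourhood of the
  region, and from there, by interpolation on one fixed fine collection, back to the parameters of
  the sequence (\<open>positive_near_region_along_sequence\<close>).

  The second part adds the optimality inequalities of the minimizers for \<open>\<beta>\<close> and for \<open>0\<close>
  (\<open>performance_of_minimizer_le\<close>).\<close>

section \<open>Weighted means, covariances and variances\<close>

lemma sum_scaleR_in_convex_hull:
  assumes "finite J" "\<And>j. j \<in> J \<Longrightarrow> 0 \<le> w j" "sum w J = 1"
  shows "(\<Sum>j\<in>J. w j *\<^sub>R v j) \<in> convex hull (v ` J)"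
  using assms by (intro convex_sum) (auto intro: hull_inc)

lemma convex_mixtures:
  fixes v :: "'i \<Rightarrow> 'a::real_vector"
  shows "convex {\<Sum>j\<in>J. w j *\<^sub>R v j | w. (\<forall>j\<in>J. 0 \<le> w j) \<and> sum w J = 1}"
proof (rule convexI)
  fix x y :: 'a and a b :: real
  assume xy: "x \<in> {\<Sum>j\<in>J. w j *\<^sub>R v j | w. (\<forall>j\<in>J. 0 \<le> w j) \<and> sum w J = 1}"
    "y \<in> {\<Sum>j\<in>J. w j *\<^sub>R v j | w. (\<forall>j\<in>J. 0 \<le> w j) \<and> sum w J = 1}"
    and ab: "0 \<le> a" "0 \<le> b" "a + b = 1"
  obtain w w' where w: "x = (\<Sum>j\<in>J. w j *\<^sub>R v j)" "\<forall>j\<in>J. 0 \<le> w j" "sum w J = 1"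
    and w': "y = (\<Sum>j\<in>J. w' j *\<^sub>R v j)" "\<forall>j\<in>J. 0 \<le> w' j" "sum w' J = 1"
    using xy by blast
  have "a *\<^sub>R x + b *\<^sub>R y = (\<Sum>j\<in>J. (a * w j + b * w' j) *\<^sub>R v j)"
    by (simp add: w w' scaleR_sum_right scaleR_add_left sum.distrib)
  moreover have "(\<Sum>j\<in>J. a * w j + b * w' j) = 1"
    using w w' ab by (simp add: sum.distrib flip: sum_distrib_left)
  moreover have "\<forall>j\<in>J. 0 \<le> a * w j + b * w' j" using w w' ab by simp
  ultimately show "a *\<^sub>R x + b *\<^sub>R y \<in> {\<Sum>j\<in>J. w j *\<^sub>R v j | w. (\<forall>j\<in>J. 0 \<le> w j) \<and> sum w J = 1}"
    by (intro CollectI exI[of _ "\<lambda>j. a * w j + b * w' j"] conjI)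
qed

lemma mixtures_eq_convex_hull:
  fixes v :: "'i \<Rightarrow> 'a::real_vector"
  assumes "finite J"
  shows "{\<Sum>j\<in>J. w j *\<^sub>R v j | w. (\<forall>j\<in>J. 0 \<le> w j) \<and> sum w J = 1} = convex hull (v ` J)" (is "?M = _")
proof
  show "?M \<subseteq> convex hull (v ` J)" using sum_scaleR_in_convex_hull[OF assms] by fast
  have "v j \<in> ?M" if "j \<in> J" for j
    by (rule CollectI, rule exI[of _ "\<lambda>k. if k = j then 1 else 0"])
      (use that assms in \<open>simp add: if_distrib[of "\<lambda>r. r *\<^sub>R _"] cong: if_cong\<close>)
  thus "convex hull (v ` J) \<subseteq> ?M" by (intro hull_minimal convex_mixtures) blast
qed

text \<open>Under the probability weights \<open>w\<close>, the covariance is half the mean of the products of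
  increments over independent pairs. This turns bounds on increments between vertices, which are
  what the mesh and the slope provide, into bounds on interpolation defects.\<close>

lemma weighted_covariance:
  fixes a b :: "'i \<Rightarrow> 'a::real_inner"
  assumes "sum w J = 1"
  shows "(\<Sum>j\<in>J. w j * (a j \<bullet> b j)) - (\<Sum>j\<in>J. w j *\<^sub>R a j) \<bullet> (\<Sum>k\<in>J. w k *\<^sub>R b k) =
    (\<Sum>j\<in>J. \<Sum>k\<in>J. w j * w k * ((a j - a k) \<bullet> (b j - b k))) / 2"
proof -
  let ?D = "\<Sum>j\<in>J. w j * (a j \<bullet> b j)"
  have diag1: "(\<Sum>j\<in>J. \<Sum>k\<in>J. w j * w k * (a j \<bullet> b j)) = ?D"
  proof (intro sum.cong refl)
    fix j
    have "(\<Sum>k\<in>J. w j * w k * (a j \<bullet> b j)) = (\<Sum>k\<in>J. w j * (a j \<bullet> b j) * w k)"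
      by (simp add: mult_ac)
    also have "\<dots> = w j * (a j \<bullet> b j) * sum w J"
      by (rule sum_distrib_left[symmetric])
    finally have "(\<Sum>k\<in>J. w j * w k * (a j \<bullet> b j)) = w j * (a j \<bullet> b j) * sum w J" .
    thus "(\<Sum>k\<in>J. w j * w k * (a j \<bullet> b j)) = w j * (a j \<bullet> b j)" using assms by simp
  qed
  have diag2: "(\<Sum>j\<in>J. \<Sum>k\<in>J. w j * w k * (a k \<bullet> b k)) = ?D"
    using diag1 by (subst sum.swap) (simp add: mult_ac)
  have mix1: "(\<Sum>j\<in>J. \<Sum>k\<in>J. w j * w k * (a j \<bullet> b k)) = (\<Sum>j\<in>J. w j *\<^sub>R a j) \<bullet> (\<Sum>k\<in>J. w k *\<^sub>R b k)"
    by (subst sum.swap) (simp add: inner_sum_left inner_sum_right sum_distrib_left mult_ac)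
  have mix2: "(\<Sum>j\<in>J. \<Sum>k\<in>J. w j * w k * (a k \<bullet> b j)) = (\<Sum>j\<in>J. w j *\<^sub>R a j) \<bullet> (\<Sum>k\<in>J. w k *\<^sub>R b k)"
    using mix1 by (subst sum.swap) (simp add: mult_ac)
  have "(\<Sum>j\<in>J. \<Sum>k\<in>J. w j * w k * ((a j - a k) \<bullet> (b j - b k))) =
     (\<Sum>j\<in>J. \<Sum>k\<in>J. w j * w k * (a j \<bullet> b j)) + (\<Sum>j\<in>J. \<Sum>k\<in>J. w j * w k * (a k \<bullet> b k))
     - (\<Sum>j\<in>J. \<Sum>k\<in>J. w j * w k * (a j \<bullet> b k)) - (\<Sum>j\<in>J. \<Sum>k\<in>J. w j * w k * (a k \<bullet> b j))"
    by (simp add: inner_diff_left inner_diff_right algebra_simps sum.distrib sum_subtractf)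
  thus ?thesis unfolding diag1 diag2 mix1 mix2 by simp
qed

text \<open>Only pairs \<open>j \<noteq> k\<close> contribute, and their total weight is one minus the sum of the squared
  weights.\<close>

lemma abs_weighted_covariance_le:
  fixes a b :: "'i \<Rightarrow> 'a::real_inner"
  assumes J: "finite J" and w: "\<And>j. j \<in> J \<Longrightarrow> 0 \<le> w j" "sum w J = 1"
    and a: "\<And>j k. j \<in> J \<Longrightarrow> k \<in> J \<Longrightarrow> norm (a j - a k) \<le> \<alpha>"
    and b: "\<And>j k. j \<in> J \<Longrightarrow> k \<in> J \<Longrightarrow> norm (b j - b k) \<le> \<gamma>"
  shows "\<bar>(\<Sum>j\<in>J. w j * (a j \<bullet> b j)) - (\<Sum>j\<in>J. w j *\<^sub>R a j) \<bullet> (\<Sum>k\<in>J. w k *\<^sub>R b k)\<bar>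
    \<le> \<alpha> * \<gamma> / 2 * (1 - (\<Sum>j\<in>J. (w j)\<^sup>2))"
proof -
  (* The diagonal terms vanish; keeping track of this is what yields the sum of squared weights. *)
  have ij: "\<bar>w j * w k * ((a j - a k) \<bullet> (b j - b k))\<bar> \<le> w j * w k * (\<alpha> * \<gamma>) * of_bool (j \<noteq> k)"
    if "j \<in> J" "k \<in> J" for j k
  proof -
    have "\<bar>(a j - a k) \<bullet> (b j - b k)\<bar> \<le> norm (a j - a k) * norm (b j - b k)"
      by (rule Cauchy_Schwarz_ineq2)
    also have "\<dots> \<le> \<alpha> * \<gamma>"
      using a b that by (intro mult_mono) (auto intro: order_trans[OF norm_ge_zero])
    finally show ?thesis
      using w(1) that by (cases "j = k") (auto simp: abs_mult intro!: mult_left_mono)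
  qed
  have off_diagonal: "(\<Sum>k\<in>J. w j * w k * (\<alpha> * \<gamma>) * of_bool (j \<noteq> k)) = \<alpha> * \<gamma> * (w j - (w j)\<^sup>2)"
    if "j \<in> J" for j
  proof -
    have "(\<Sum>k\<in>J. w j * w k * (\<alpha> * \<gamma>) * of_bool (j \<noteq> k)) =
        (\<Sum>k\<in>J. w j * w k * (\<alpha> * \<gamma>) - (if j = k then w j * w k * (\<alpha> * \<gamma>) else 0))"
      by (intro sum.cong) auto
    also have "\<dots> = \<alpha> * \<gamma> * w j * sum w J - \<alpha> * \<gamma> * (w j)\<^sup>2"
      using J that by (simp add: sum_subtractf sum_distrib_left mult_ac power2_eq_square)
    finally show ?thesis using w(2) by (simp add: algebra_simps)
  qed
  have "\<bar>\<Sum>j\<in>J. \<Sum>k\<in>J. w j * w k * ((a j - a k) \<bullet> (b j - b k))\<bar> \<le>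
      (\<Sum>j\<in>J. \<Sum>k\<in>J. \<bar>w j * w k * ((a j - a k) \<bullet> (b j - b k))\<bar>)"
    by (intro order_trans[OF sum_abs] sum_mono sum_abs)
  also have "\<dots> \<le> (\<Sum>j\<in>J. \<Sum>k\<in>J. w j * w k * (\<alpha> * \<gamma>) * of_bool (j \<noteq> k))"
    by (intro sum_mono ij)
  also have "\<dots> = \<alpha> * \<gamma> * (1 - (\<Sum>j\<in>J. (w j)\<^sup>2))"
    by (simp add: off_diagonal sum_subtractf w(2) flip: sum_distrib_left)
  finally show ?thesis unfolding weighted_covariance[OF w(2)] by simp
qed

text \<open>With \<open>N\<close> points the sum of squared weights is at least \<open>1 / N\<close>, so that the pair formula gives
  \<open>(N - 1) / (2 * N)\<close> times \<open>\<alpha>\<^sup>2\<close>. For \<open>N \<ge> 2\<close> this is at most the bound below, which for the \<open>n + 1\<close>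
  corners of a simplex is the origin of the factor \<open>n\<close> in the margin \<open>n * \<tau>\<^sup>2 / 8\<close>.\<close>

lemma weighted_variance_le:
  fixes a :: "'i \<Rightarrow> 'a::real_inner"
  assumes J: "finite J" "2 \<le> card J" and w: "\<And>j. j \<in> J \<Longrightarrow> 0 \<le> w j" "sum w J = 1"
    and a: "\<And>j k. j \<in> J \<Longrightarrow> k \<in> J \<Longrightarrow> norm (a j - a k) \<le> \<alpha>"
  shows "(\<Sum>j\<in>J. w j * (norm (a j - (\<Sum>k\<in>J. w k *\<^sub>R a k)))\<^sup>2) \<le> (real (card J) - 1) * \<alpha>\<^sup>2 / 4"
proof -
  define x where "x = (\<Sum>k\<in>J. w k *\<^sub>R a k)"
  let ?N = "real (card J)"
  have "(\<Sum>j\<in>J. w j * (norm (a j - x))\<^sup>2) =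
      (\<Sum>j\<in>J. w j * (a j \<bullet> a j)) - 2 * ((\<Sum>j\<in>J. w j *\<^sub>R a j) \<bullet> x) + sum w J * (x \<bullet> x)"
    by (simp add: power2_norm_eq_inner inner_diff_left inner_diff_right algebra_simps sum.distrib
        sum_subtractf inner_sum_left inner_sum_right sum_distrib_left sum_distrib_right inner_commute mult_ac)
  also have "\<dots> = (\<Sum>j\<in>J. w j * (a j \<bullet> a j)) - x \<bullet> x" by (simp add: w x_def)
  also have "\<dots> \<le> \<alpha> * \<alpha> / 2 * (1 - (\<Sum>j\<in>J. (w j)\<^sup>2))"
    using abs_weighted_covariance_le[of J w a \<alpha> a \<alpha>, OF J(1) w a a] unfolding x_def by linarith
  also have "\<dots> \<le> (?N - 1) * \<alpha>\<^sup>2 / 4"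
  proof -
    have "1 \<le> ?N * (\<Sum>j\<in>J. (w j)\<^sup>2)"
      using Cauchy_Schwarz_ineq_sum[of "\<lambda>_. 1" w J] w(2) by simp
    hence "1 / ?N \<le> (\<Sum>j\<in>J. (w j)\<^sup>2)" using J by (simp add: field_simps)
    moreover have "1 - 1 / ?N \<le> (?N - 1) / 2"
    proof -
      have "1 - 1 / ?N = (?N - 1) / ?N" using J(2) by (simp add: field_simps)
      also have "\<dots> \<le> (?N - 1) / 2" using J(2) by (intro divide_left_mono) auto
      finally show ?thesis .
    qed
    ultimately have "1 - (\<Sum>j\<in>J. (w j)\<^sup>2) \<le> (?N - 1) / 2" by linarith
    from mult_left_mono[OF this, of "\<alpha> * \<alpha> / 2"] show ?thesis by (simp add: power2_eq_square mult_ac)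
  qed
  finally show ?thesis unfolding x_def .
qed

section \<open>Second-order interpolation error\<close>

text \<open>The form of an iterated \<open>deriv\<close> along a line is the one of \<open>F1_bounds\<close>. For a \<open>C\<^sup>2\<close> function it
  is the quadratic form of the second derivative, by \<open>C2_on_second_derivative\<close> below.\<close>

definition second_along :: "('a::real_normed_vector \<Rightarrow> real) \<Rightarrow> 'a \<Rightarrow> 'a \<Rightarrow> real" where
  "second_along f p v = (deriv ^^ 2) (\<lambda>t. f (p + t *\<^sub>R v)) 0"

lemma C2_on_second_derivative:
  fixes f :: "'a::real_normed_vector \<Rightarrow> real"
  assumes "open U" "C2_on U f"
  obtains f' :: "'a \<Rightarrow> 'a \<Rightarrow>\<^sub>L real" and f'' :: "'a \<Rightarrow> 'a \<Rightarrow>\<^sub>L 'a \<Rightarrow>\<^sub>L real"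
  where "\<And>x v t. x + t *\<^sub>R v \<in> U \<Longrightarrow> ((\<lambda>t. f (x + t *\<^sub>R v)) has_real_derivative f' (x + t *\<^sub>R v) v) (at t)"
    "\<And>x v t. x + t *\<^sub>R v \<in> U \<Longrightarrow>
       ((\<lambda>t. f' (x + t *\<^sub>R v) v) has_real_derivative f'' (x + t *\<^sub>R v) v v) (at t)"
    "\<And>p v. p \<in> U \<Longrightarrow> second_along f p v = f'' p v v"
proof -
  obtain f' where f': "\<And>x. x \<in> U \<Longrightarrow> (f has_derivative blinfun_apply (f' x)) (at x)" "C1_on U f'"
    using assms(2) unfolding C2_on_def by blast
  obtain f'' where f'': "\<And>x. x \<in> U \<Longrightarrow> (f' has_derivative blinfun_apply (f'' x)) (at x)"
    using f'(2) unfolding C1_on_def by blast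
  have line: "((\<lambda>t. x + t *\<^sub>R v) has_derivative (\<lambda>s. s *\<^sub>R v)) (at t)" for x v :: 'a and t
    by (auto intro!: derivative_eq_intros)
  have d1: "((\<lambda>t. f (x + t *\<^sub>R v)) has_real_derivative f' (x + t *\<^sub>R v) v) (at t)"
    if "x + t *\<^sub>R v \<in> U" for x v t
    using has_derivative_compose[OF line f'(1)[OF that]]
    by (simp add: has_field_derivative_def blinfun.scaleR_right mult.commute[of _ "blinfun_apply _ _"])
  have d2: "((\<lambda>t. f' (x + t *\<^sub>R v) v) has_real_derivative f'' (x + t *\<^sub>R v) v v) (at t)"
    if "x + t *\<^sub>R v \<in> U" for x v t
  proof -
    have "((\<lambda>t. f' (x + t *\<^sub>R v)) has_derivative (\<lambda>s. f'' (x + t *\<^sub>R v) (s *\<^sub>R v))) (at t)"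
      by (rule has_derivative_compose[OF line f''[OF that]])
    from bounded_linear.has_derivative[OF blinfun.bounded_linear_left this, of v]
    show ?thesis
      by (simp add: has_field_derivative_def blinfun.scaleR_right blinfun.scaleR_left
          mult.commute[of _ "blinfun_apply _ _"])
  qed
  have "second_along f p v = f'' p v v" if "p \<in> U" for p v
  proof -
    have t: "((\<lambda>t. p + t *\<^sub>R v) \<longlongrightarrow> p + 0 *\<^sub>R v) (nhds (0::real))"
      by (intro tendsto_intros filterlim_ident)
    have "eventually (\<lambda>t. p + t *\<^sub>R v \<in> U) (nhds (0::real))"
      by (rule topological_tendstoD[OF t]) (use assms that in auto)
    hence "eventually (\<lambda>t. deriv (\<lambda>t. f (p + t *\<^sub>R v)) t = f' (p + t *\<^sub>R v) v) (nhds (0::real))"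
      by eventually_elim (intro DERIV_imp_deriv d1)
    from deriv_cong_ev[OF this refl] DERIV_imp_deriv[OF d2[of p 0 v]] that
    show ?thesis by (simp add: second_along_def numeral_2_eq_2)
  qed
  thus ?thesis using that d1 d2 by blast
qed

lemma second_along_scale:
  assumes "open U" "C2_on U f" "p \<in> U"
  shows "second_along f p (r *\<^sub>R v) = r\<^sup>2 * second_along f p v"
proof -
  obtain f'' where "\<And>v. second_along f p v = blinfun_apply (blinfun_apply f'' v) v"
    using C2_on_second_derivative[OF assms(1,2)] assms(3) by (metis (no_types))
  thus ?thesis by (simp add: blinfun.scaleR_left blinfun.scaleR_right power2_eq_square)
qed

lemma second_along_real:
  fixes h :: "real \<Rightarrow> real"
  assumes "open U" "C2_on U h" "z \<in> U"
  shows "second_along h z v = v\<^sup>2 * (deriv ^^ 2) h z"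
proof -
  obtain h' h'' where h:
    "\<And>x v t. x + t *\<^sub>R v \<in> U \<Longrightarrow> ((\<lambda>t. h (x + t *\<^sub>R v)) has_real_derivative blinfun_apply (h' (x + t *\<^sub>R v)) v) (at t)"
    "\<And>x v t. x + t *\<^sub>R v \<in> U \<Longrightarrow>
       ((\<lambda>t. h' (x + t *\<^sub>R v) v) has_real_derivative blinfun_apply (blinfun_apply (h'' (x + t *\<^sub>R v)) v) v) (at t)"
    "\<And>p v. p \<in> U \<Longrightarrow> second_along h p v = blinfun_apply (blinfun_apply (h'' p) v) v"
    using C2_on_second_derivative[OF assms(1,2)] by blast
  have "eventually (\<lambda>t. t \<in> U) (nhds z)" using assms by (simp add: eventually_nhds_in_open)
  hence "eventually (\<lambda>t. deriv h t = h' t 1) (nhds z)"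
    by eventually_elim (use h(1)[of 0 _ 1] in \<open>auto intro!: DERIV_imp_deriv\<close>)
  from deriv_cong_ev[OF this refl] DERIV_imp_deriv[OF h(2)[of 0 z 1]] assms(3)
  have "(deriv ^^ 2) h z = h'' z 1 1" by (simp add: numeral_2_eq_2)
  thus ?thesis using second_along_scale[OF assms, of v 1] h(3)[OF assms(3), of 1] by simp
qed

text \<open>The remainder is taken in mean-value form: it is half the second derivative in direction
  \<open>z - x\<close> at some point of the segment. The linear functional \<open>D\<close> does not depend on \<open>z\<close>, so that
  it can be averaged over several \<open>z\<close>.\<close>

lemma C2_on_taylor:
  fixes f :: "'a::real_normed_vector \<Rightarrow> real"
  assumes "open U" "C2_on U f" "x \<in> A" "A \<subseteq> U" "convex A"
  obtains D :: "'a \<Rightarrow>\<^sub>L real" where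
    "\<And>z. z \<in> A \<Longrightarrow> \<exists>p\<in>A. f z = f x + D (z - x) + second_along f p (z - x) / 2"
proof -
  obtain f' f'' where f':
    "\<And>x v t. x + t *\<^sub>R v \<in> U \<Longrightarrow> ((\<lambda>t. f (x + t *\<^sub>R v)) has_real_derivative blinfun_apply (f' (x + t *\<^sub>R v)) v) (at t)"
    "\<And>x v t. x + t *\<^sub>R v \<in> U \<Longrightarrow>
       ((\<lambda>t. f' (x + t *\<^sub>R v) v) has_real_derivative blinfun_apply (blinfun_apply (f'' (x + t *\<^sub>R v)) v) v) (at t)"
    "\<And>p v. p \<in> U \<Longrightarrow> second_along f p v = blinfun_apply (blinfun_apply (f'' p) v) v"
    using C2_on_second_derivative[OF assms(1,2)] by blast
  show ?thesis
  proof (rule that[of "f' x"])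
    fix z assume z: "z \<in> A"
    define v where "v = z - x"
    have seg: "x + t *\<^sub>R v \<in> A" if "0 \<le> t" "t \<le> 1" for t
      using convexD_alt[OF assms(5,3) z that] by (simp add: v_def algebra_simps)
    define F where "F = (\<lambda>m::nat. if m = 0 then (\<lambda>t. f (x + t *\<^sub>R v))
       else if m = 1 then (\<lambda>t. f' (x + t *\<^sub>R v) v) else (\<lambda>t. f'' (x + t *\<^sub>R v) v v))"
    have "\<forall>m t. m < 2 \<and> 0 \<le> t \<and> t \<le> 1 \<longrightarrow> DERIV (F m) t :> F (Suc m) t"
    proof (intro allI impI)
      fix m :: nat and t :: real assume m: "m < 2 \<and> 0 \<le> t \<and> t \<le> 1"
      hence U: "x + t *\<^sub>R v \<in> U" using seg assms(4) by blast
      have "m = 0 \<or> m = 1" using m by auto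
      thus "DERIV (F m) t :> F (Suc m) t" using f'(1,2)[OF U] by (auto simp: F_def)
    qed
    from Maclaurin[of 1 2 F "\<lambda>t. f (x + t *\<^sub>R v)", OF _ _ _ this] obtain t where
      t: "0 < t" "t < 1" "f (x + 1 *\<^sub>R v) = (\<Sum>m<2. (F m 0 / fact m) * 1 ^ m) + (F 2 t / fact 2) * 1 ^ 2"
      by (auto simp: F_def)
    have "f z = f x + f' x v + second_along f (x + t *\<^sub>R v) v / 2"
      using t(3) f'(3)[of "x + t *\<^sub>R v" v] seg[of t] t(1,2) assms(4)
      by (auto simp: F_def numeral_2_eq_2 v_def)
    thus "\<exists>p\<in>A. f z = f x + f' x (z - x) + second_along f p (z - x) / 2"
      using seg[of t] t unfolding v_def by (intro bexI[of _ "x + t *\<^sub>R (z - x)"]) auto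
  qed
qed

text \<open>Expanding at the mean of the points makes the linear terms average to zero, and only the
  second-order remainders survive.\<close>

lemma weighted_average_taylor:
  fixes f :: "'a::euclidean_space \<Rightarrow> real"
  assumes U: "open U" "C2_on U f" and A: "convex A" "A \<subseteq> U"
    and J: "finite J" and w: "\<And>j. j \<in> J \<Longrightarrow> 0 \<le> w j" "sum w J = 1"
    and a: "\<And>j. j \<in> J \<Longrightarrow> a j \<in> A"
    and x: "x = (\<Sum>j\<in>J. w j *\<^sub>R a j)"
  obtains p where "\<And>j. j \<in> J \<Longrightarrow> p j \<in> A"
    "(\<Sum>j\<in>J. w j * f (a j)) - f x = (\<Sum>j\<in>J. w j * second_along f (p j) (a j - x)) / 2"
proof -
  have xA: "x \<in> A" unfolding x using J A(1) w a by (intro convex_sum) auto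
  obtain D :: "'a \<Rightarrow>\<^sub>L real" where
    D: "\<And>z. z \<in> A \<Longrightarrow> \<exists>p\<in>A. f z = f x + D (z - x) + second_along f p (z - x) / 2"
    using C2_on_taylor[OF U xA A(2,1)] by metis
  have "\<forall>j\<in>J. \<exists>p\<in>A. f (a j) = f x + D (a j - x) + second_along f p (a j - x) / 2"
    using D a by blast
  then obtain p where p: "\<And>j. j \<in> J \<Longrightarrow> p j \<in> A"
    "\<And>j. j \<in> J \<Longrightarrow> f (a j) = f x + D (a j - x) + second_along f (p j) (a j - x) / 2"
    by (auto simp: bchoice_iff Bex_def)
  have "(\<Sum>j\<in>J. w j *\<^sub>R (a j - x)) = x - sum w J *\<^sub>R x"
    unfolding x by (simp add: scaleR_diff_right sum_subtractf scaleR_sum_left)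
  hence "(\<Sum>j\<in>J. w j *\<^sub>R (a j - x)) = 0" using w(2) by simp
  from arg_cong[OF this, of "blinfun_apply D"]
  have lin: "(\<Sum>j\<in>J. w j * D (a j - x)) = 0"
    by (simp add: blinfun.sum_right blinfun.scaleR_right)
  have "(\<Sum>j\<in>J. w j * f (a j)) =
      (\<Sum>j\<in>J. w j * (f x + D (a j - x) + second_along f (p j) (a j - x) / 2))"
    using p(2) by (intro sum.cong) auto
  also have "\<dots> = sum w J * f x + (\<Sum>j\<in>J. w j * D (a j - x)) + (\<Sum>j\<in>J. w j * second_along f (p j) (a j - x)) / 2"
    by (simp add: algebra_simps sum.distrib sum_distrib_left sum_divide_distrib)
  finally have "(\<Sum>j\<in>J. w j * f (a j)) - f x = (\<Sum>j\<in>J. w j * second_along f (p j) (a j - x)) / 2"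
    using lin w(2) by simp
  with p(1) show ?thesis by (rule that)
qed

text \<open>The remainders are bounded by the weighted variance, since they are quadratic in the distance
  to the mean.\<close>

lemma interpolation_error_upper:
  fixes f :: "'a::euclidean_space \<Rightarrow> real"
  assumes U: "open U" "C2_on U f" and A: "convex A" "A \<subseteq> U"
    and J: "finite J" "2 \<le> card J" and w: "\<And>j. j \<in> J \<Longrightarrow> 0 \<le> w j" "sum w J = 1"
    and a: "\<And>j. j \<in> J \<Longrightarrow> a j \<in> A"
    and \<alpha>: "\<And>j k. j \<in> J \<Longrightarrow> k \<in> J \<Longrightarrow> norm (a j - a k) \<le> \<alpha>"
    and d: "\<And>p v. p \<in> A \<Longrightarrow> d * (norm v)\<^sup>2 \<le> second_along f p v"
  shows "f (\<Sum>j\<in>J. w j *\<^sub>R a j) \<le> (\<Sum>j\<in>J. w j * f (a j)) + (real (card J) - 1) * \<alpha>\<^sup>2 / 8 * max 0 (- d)"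
proof -
  define x where "x = (\<Sum>j\<in>J. w j *\<^sub>R a j)"
  obtain p where p: "\<And>j. j \<in> J \<Longrightarrow> p j \<in> A"
    "(\<Sum>j\<in>J. w j * f (a j)) - f x = (\<Sum>j\<in>J. w j * second_along f (p j) (a j - x)) / 2"
    using weighted_average_taylor[OF U A J(1) w a x_def] by metis
  define K where "K = (real (card J) - 1) * \<alpha>\<^sup>2 / 8"
  have "- max 0 (- d) * (w j * (norm (a j - x))\<^sup>2) \<le> w j * second_along f (p j) (a j - x)" if "j \<in> J" for j
  proof -
    have "- max 0 (- d) * (norm (a j - x))\<^sup>2 \<le> d * (norm (a j - x))\<^sup>2"
      by (intro mult_right_mono) auto
    also have "\<dots> \<le> second_along f (p j) (a j - x)" by (rule d[OF p(1)[OF that]])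
    finally show ?thesis using mult_left_mono[OF _ w(1)[OF that]] by (fastforce simp: mult_ac)
  qed
  hence "- max 0 (- d) * (\<Sum>j\<in>J. w j * (norm (a j - x))\<^sup>2) \<le> (\<Sum>j\<in>J. w j * second_along f (p j) (a j - x))"
    unfolding sum_distrib_left by (rule sum_mono)
  moreover have "max 0 (- d) * (\<Sum>j\<in>J. w j * (norm (a j - x))\<^sup>2) \<le> max 0 (- d) * (2 * K)"
    using weighted_variance_le[OF J w \<alpha>] unfolding x_def K_def by (intro mult_left_mono) auto
  ultimately have "f x \<le> (\<Sum>j\<in>J. w j * f (a j)) + K * max 0 (- d)" using p(2) by (simp add: mult_ac)
  thus ?thesis unfolding x_def K_def .
qed

lemma interpolation_error_lower:
  fixes f :: "'a::euclidean_space \<Rightarrow> real"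
  assumes U: "open U" "C2_on U f" and A: "convex A" "A \<subseteq> U"
    and J: "finite J" "2 \<le> card J" and w: "\<And>j. j \<in> J \<Longrightarrow> 0 \<le> w j" "sum w J = 1"
    and a: "\<And>j. j \<in> J \<Longrightarrow> a j \<in> A"
    and \<alpha>: "\<And>j k. j \<in> J \<Longrightarrow> k \<in> J \<Longrightarrow> norm (a j - a k) \<le> \<alpha>"
    and d: "\<And>p v. p \<in> A \<Longrightarrow> second_along f p v \<le> d * (norm v)\<^sup>2"
  shows "(\<Sum>j\<in>J. w j * f (a j)) - (real (card J) - 1) * \<alpha>\<^sup>2 / 8 * max 0 d \<le> f (\<Sum>j\<in>J. w j *\<^sub>R a j)"
proof -
  define x where "x = (\<Sum>j\<in>J. w j *\<^sub>R a j)"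
  obtain p where p: "\<And>j. j \<in> J \<Longrightarrow> p j \<in> A"
    "(\<Sum>j\<in>J. w j * f (a j)) - f x = (\<Sum>j\<in>J. w j * second_along f (p j) (a j - x)) / 2"
    using weighted_average_taylor[OF U A J(1) w a x_def] by metis
  define K where "K = (real (card J) - 1) * \<alpha>\<^sup>2 / 8"
  have "w j * second_along f (p j) (a j - x) \<le> max 0 d * (w j * (norm (a j - x))\<^sup>2)" if "j \<in> J" for j
  proof -
    have "second_along f (p j) (a j - x) \<le> d * (norm (a j - x))\<^sup>2" by (rule d[OF p(1)[OF that]])
    also have "\<dots> \<le> max 0 d * (norm (a j - x))\<^sup>2" by (intro mult_right_mono) auto
    finally show ?thesis using mult_left_mono[OF _ w(1)[OF that]] by (fastforce simp: mult_ac)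
  qed
  hence "(\<Sum>j\<in>J. w j * second_along f (p j) (a j - x)) \<le> max 0 d * (\<Sum>j\<in>J. w j * (norm (a j - x))\<^sup>2)"
    unfolding sum_distrib_left by (rule sum_mono)
  moreover have "max 0 d * (\<Sum>j\<in>J. w j * (norm (a j - x))\<^sup>2) \<le> max 0 d * (2 * K)"
    using weighted_variance_le[OF J w \<alpha>] unfolding x_def K_def by (intro mult_left_mono) auto
  ultimately have "(\<Sum>j\<in>J. w j * f (a j)) - K * max 0 d \<le> f x" using p(2) by (simp add: mult_ac)
  thus ?thesis unfolding x_def K_def .
qed

section \<open>Simplex collections and margins\<close>

lemma finite_corners: "finite (corners S)"
  and card_corners: "card (corners (S :: 'n::finite simplexes)) = CARD('n) + 1"
  unfolding corners_def by simp_all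

lemma weightsD:
  assumes "w \<in> weights S"
  shows "j \<in> corners S \<Longrightarrow> 0 \<le> w j" "sum w (corners S) = 1"
  using assms unfolding weights_def by auto

lemma cell_eq_convex_hull: "cell S i = convex hull (verts S i ` corners S)"
  unfolding mixtures_eq_convex_hull[OF finite_corners, symmetric] cell_def point_def weights_def
  by auto

lemma weighted_values_eq_convex_hull:
  "weighted_value S y i ` weights S = convex hull ((\<lambda>j. y (verts S i j)) ` corners S)"
  unfolding mixtures_eq_convex_hull[OF finite_corners, symmetric] weighted_value_def weights_def
  by auto

lemma vertex_weights:
  assumes "j \<in> corners S"
  obtains w where "w \<in> weights S" "point S i w = verts S i j" "weighted_value S f i w = f (verts S i j)"
proof (rule that[of "\<lambda>k. if k = j then 1 else 0"])
  show "(\<lambda>k. if k = j then 1 else 0) \<in> weights S"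
    unfolding weights_def using assms finite_corners[of S] by auto
  show "point S i (\<lambda>k. if k = j then 1 else 0) = verts S i j"
    unfolding point_def using assms finite_corners[of S]
    by (simp add: if_distrib[of "\<lambda>r. r *\<^sub>R _"] cong: if_cong)
  show "weighted_value S f i (\<lambda>k. if k = j then 1 else 0) = f (verts S i j)"
    unfolding weighted_value_def using assms finite_corners[of S]
    by (simp add: if_distrib[of "\<lambda>r. r * _"] cong: if_cong)
qed

lemma weighted_value_mono:
  assumes "w \<in> weights S" "\<And>j. j \<in> corners S \<Longrightarrow> f (verts S i j) \<le> g (verts S i j)"
  shows "weighted_value S f i w \<le> weighted_value S g i w"
  unfolding weighted_value_def using weightsD[OF assms(1)] assms(2)
  by (intro sum_mono mult_left_mono) auto

lemma weighted_value_const: "w \<in> weights S \<Longrightarrow> weighted_value S (\<lambda>_. a) i w = a"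
  unfolding weighted_value_def by (simp add: weightsD flip: sum_distrib_right)

lemma weighted_value_ge:
  "w \<in> weights S \<Longrightarrow> (\<And>j. j \<in> corners S \<Longrightarrow> a \<le> f (verts S i j)) \<Longrightarrow> a \<le> weighted_value S f i w"
  using weighted_value_mono[of w S "\<lambda>_. a" i f] weighted_value_const[of w S a i] by simp

lemma weighted_value_le:
  "w \<in> weights S \<Longrightarrow> (\<And>j. j \<in> corners S \<Longrightarrow> f (verts S i j) \<le> a) \<Longrightarrow> weighted_value S f i w \<le> a"
  using weighted_value_mono[of w S f i "\<lambda>_. a"] weighted_value_const[of w S a i] by simp

lemma weighted_value_add:
  "weighted_value S (\<lambda>x. f x + g x) i w = weighted_value S f i w + weighted_value S g i w"
  unfolding weighted_value_def by (simp add: distrib_left sum.distrib)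

lemma weighted_value_uminus: "weighted_value S (\<lambda>x. - f x) i w = - weighted_value S f i w"
  unfolding weighted_value_def by (simp add: sum_negf)

text \<open>Margins are stated cell by cell in barycentric coordinates, which avoids the definite
  description in the interpolation; by \<open>interp_point\<close> below this is the same notion.\<close>

definition is_lower_margin :: "('n::finite) simplexes \<Rightarrow> (real^'n \<Rightarrow> real) \<Rightarrow> real \<Rightarrow> bool" where
  "is_lower_margin S f m \<longleftrightarrow>
     (\<forall>i\<in>idx S. \<forall>w\<in>weights S. weighted_value S f i w - m \<le> f (point S i w))"

definition is_upper_margin :: "('n::finite) simplexes \<Rightarrow> (real^'n \<Rightarrow> real) \<Rightarrow> real \<Rightarrow> bool" where
  "is_upper_margin S f m \<longleftrightarrow>
     (\<forall>i\<in>idx S. \<forall>w\<in>weights S. f (point S i w) \<le> weighted_value S f i w + m)"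

text \<open>Facts that concern only the geometry of the collection are used with \<open>Xt = UNIV\<close>.\<close>

locale triangulation =
  fixes X Xt :: "(real^'n::finite) set" and S :: "'n simplexes"
  assumes coll: "simplex_collection X S" and X_ne: "X \<noteq> {}"
    and Xt_open: "open Xt" and X_Xt: "X \<subseteq> Xt"
begin

lemma finite_idx: "finite (idx S)"
  and cells: "X = (\<Union>i\<in>idx S. cell S i)"
  using coll unfolding simplex_collection_def by blast+

lemma idx_ne: "idx S \<noteq> {}"
  using cells X_ne by auto

lemma in_cell:
  assumes "x \<in> X" obtains i w where "i \<in> idx S" "w \<in> weights S" "x = point S i w"
  using assms cells unfolding cell_def by auto

lemma cell_subset: "i \<in> idx S \<Longrightarrow> cell S i \<subseteq> X"
  using cells by auto

lemma point_in: "i \<in> idx S \<Longrightarrow> w \<in> weights S \<Longrightarrow> point S i w \<in> X"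
  using cell_subset unfolding cell_def by auto

lemma vertex_in: "i \<in> idx S \<Longrightarrow> j \<in> corners S \<Longrightarrow> verts S i j \<in> X"
  using coll unfolding simplex_collection_def by blast

lemma lower_margin_nonneg: "is_lower_margin S f m \<Longrightarrow> 0 \<le> m"
  and upper_margin_nonneg: "is_upper_margin S f m \<Longrightarrow> 0 \<le> m"
proof -
  obtain i where i: "i \<in> idx S" using idx_ne by auto
  have "1 \<in> corners S" by (simp add: corners_def)
  then obtain w where "w \<in> weights S" "point S i w = verts S i 1" "weighted_value S f i w = f (verts S i 1)"
    by (rule vertex_weights)
  thus "is_lower_margin S f m \<Longrightarrow> 0 \<le> m" "is_upper_margin S f m \<Longrightarrow> 0 \<le> m"
    using i unfolding is_lower_margin_def is_upper_margin_def by fastforce+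
qed

lemma interp_point:
  assumes "i \<in> idx S" "w \<in> weights S"
  shows "interp S f (point S i w) = weighted_value S f i w"
proof -
  have "weighted_value S f i w = weighted_value S f i' w'"
    if "i' \<in> idx S" "w' \<in> weights S" "point S i w = point S i' w'" for i' w'
    using coll assms that unfolding simplex_collection_def by blast
  thus ?thesis unfolding interp_def using assms by (intro the_equality) metis+
qed

lemma interp_image: "interp S f ` X = (\<Union>i\<in>idx S. weighted_value S f i ` weights S)"
  unfolding cells cell_def by (auto simp: image_UN image_image interp_point)

lemma finite_pairs:
  "finite {F i j j' | i j j'. i \<in> idx S \<and> j \<in> corners S \<and> j' \<in> corners S}"
proof -
  have "{F i j j' | i j j'. i \<in> idx S \<and> j \<in> corners S \<and> j' \<in> corners S} =
    (\<lambda>(i, j, j'). F i j j') ` (idx S \<times> corners S \<times> corners S)" by force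
  thus ?thesis using finite_idx finite_corners[of S] by simp
qed

lemma edge_le_mesh:
  "i \<in> idx S \<Longrightarrow> j \<in> corners S \<Longrightarrow> j' \<in> corners S \<Longrightarrow> norm (verts S i j - verts S i j') \<le> mesh S"
  unfolding mesh_def using finite_pairs[of "\<lambda>i j j'. norm (verts S i j - verts S i j')"]
  by (intro Max_ge) blast+

text \<open>Positivity of the mesh is what makes the slope, a quotient by the mesh, bound increments
  between vertices.\<close>

lemma mesh_pos: "0 < mesh S"
proof -
  obtain i where i: "i \<in> idx S" using idx_ne by auto
  have n: "1 \<in> {1..CARD('n)}" by (simp add: Suc_leI)
  have "independent ((\<lambda>j. verts S i j - verts S i (CARD('n) + 1)) ` {1..CARD('n)})"
    using coll i unfolding simplex_collection_def by blast
  hence "verts S i 1 - verts S i (CARD('n) + 1) \<noteq> 0" using n dependent_zero by (metis (no_types, lifting) image_eqI)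
  hence "0 < norm (verts S i 1 - verts S i (CARD('n) + 1))" by simp
  also have "\<dots> \<le> mesh S" using i by (intro edge_le_mesh) (auto simp: corners_def)
  finally show ?thesis .
qed

lemma dist_vertex_le_mesh:
  assumes "i \<in> idx S" "x \<in> cell S i" "j \<in> corners S"
  shows "dist x (verts S i j) \<le> mesh S"
proof -
  have "cell S i \<subseteq> cball (verts S i j) (mesh S)"
    unfolding cell_eq_convex_hull
    by (rule hull_minimal) (use edge_le_mesh assms in \<open>auto simp: dist_norm\<close>)
  thus ?thesis using assms by (auto simp: dist_commute)
qed

lemma vertex_increment_le:
  "i \<in> idx S \<Longrightarrow> j \<in> corners S \<Longrightarrow> j' \<in> corners S \<Longrightarrow>
    \<bar>f (verts S i j) - f (verts S i j')\<bar> \<le> slope S f * mesh S"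
  unfolding slope_def using mesh_pos finite_pairs[of "\<lambda>i j j'. \<bar>f (verts S i j) - f (verts S i j')\<bar>"]
  by (simp, intro Max_ge) blast+

lemma slope_nonneg: "0 \<le> slope S f"
proof -
  obtain i where i: "i \<in> idx S" using idx_ne by auto
  have "0 \<le> slope S f * mesh S"
    using vertex_increment_le[OF i, of 1 1 f] by (auto simp: corners_def)
  thus ?thesis using mesh_pos by (simp add: zero_le_mult_iff)
qed

lemma finite_vertex_values: "finite (vertex_values S f)"
proof -
  have "vertex_values S f = (\<lambda>(i, j). f (verts S i j)) ` (idx S \<times> corners S)"
    unfolding vertex_values_def by auto
  thus ?thesis using finite_idx finite_corners[of S] by simp
qed

lemma weighted_value_bounds:
  assumes "i \<in> idx S" "w \<in> weights S" "0 \<le> m"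
  shows "lower_bound S f m \<le> weighted_value S f i w" "weighted_value S f i w \<le> upper_bound S f m"
proof -
  have "f (verts S i j) \<in> vertex_values S f" if "j \<in> corners S" for j
    using assms(1) that unfolding vertex_values_def by blast
  hence "Min (vertex_values S f) \<le> weighted_value S f i w" "weighted_value S f i w \<le> Max (vertex_values S f)"
    using finite_vertex_values[of f] assms(2) by (simp_all add: weighted_value_ge weighted_value_le)
  thus "lower_bound S f m \<le> weighted_value S f i w" "weighted_value S f i w \<le> upper_bound S f m"
    using assms(3) unfolding lower_bound_def upper_bound_def by linarith+
qed

lemma lower_bound_le:
  assumes "is_lower_margin S f m" "i \<in> idx S" "w \<in> weights S"
  shows "lower_bound S f m \<le> f (point S i w)"
  using weighted_value_bounds(1)[of i w 0 f] assms unfolding is_lower_margin_def lower_bound_def by fastforce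

lemma le_upper_bound:
  assumes "is_upper_margin S f m" "i \<in> idx S" "w \<in> weights S"
  shows "f (point S i w) \<le> upper_bound S f m"
  using weighted_value_bounds(2)[of i w 0 f] assms unfolding is_upper_margin_def upper_bound_def by fastforce

end

section \<open>Calculus for functions of class one and for outer functions\<close>

text \<open>The class of a function only controls second derivatives in unit directions; the
  general direction follows by homogeneity.\<close>

lemma F1_bounds_second_along:
  assumes "F1_bounds X Xt f lo up" "open Xt" "X \<subseteq> Xt" "p \<in> X"
  shows "lo * (norm v)\<^sup>2 \<le> second_along f p v" "second_along f p v \<le> up * (norm v)\<^sup>2"
proof -
  (* For v = 0 any unit vector serves. *)
  define \<nu> :: "real^'a" where "\<nu> = (if v = 0 then axis undefined 1 else v /\<^sub>R norm v)"
  have \<nu>: "norm \<nu> = 1" "v = norm v *\<^sub>R \<nu>" unfolding \<nu>_def by auto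
  have "C2_on Xt f" using assms(1) unfolding F1_bounds_def by blast
  hence "second_along f p v = (norm v)\<^sup>2 * second_along f p \<nu>"
    using second_along_scale[OF assms(2), of f p "norm v" \<nu>] \<nu>(2) assms(3,4) by auto
  moreover have "lo \<le> second_along f p \<nu>" "second_along f p \<nu> \<le> up"
    using assms(1,4) \<nu>(1) unfolding F1_bounds_def second_along_def by blast+
  ultimately show "lo * (norm v)\<^sup>2 \<le> second_along f p v" "second_along f p v \<le> up * (norm v)\<^sup>2"
    by (simp_all add: mult.commute[of _ "(norm v)\<^sup>2"] mult_left_mono)
qed

lemma C2_on_continuous: "C2_on U f \<Longrightarrow> continuous_on U f"
  unfolding C2_on_def by (meson continuous_at_imp_continuous_on has_derivative_continuous)

lemma C2_on_deriv:
  fixes h :: "real \<Rightarrow> real"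
  assumes "C2_on U h" "z \<in> U" shows "(h has_real_derivative deriv h z) (at z)"
proof -
  obtain h' where "(h has_derivative blinfun_apply (h' z)) (at z)"
    using assms unfolding C2_on_def by blast
  hence "h field_differentiable (at z)"
    using differentiableI real_differentiable_def field_differentiable_def by metis
  thus ?thesis by (rule field_differentiable_derivI)
qed

lemma mean_value_segment:
  fixes h :: "real \<Rightarrow> real"
  assumes "C2_on U h" "closed_segment a b \<subseteq> U"
  obtains z where "z \<in> closed_segment a b" "h b - h a = deriv h z * (b - a)"
proof -
  have D: "(h has_real_derivative deriv h z) (at z)" if "z \<in> closed_segment a b" for z
    using C2_on_deriv[OF assms(1)] assms(2) that by blast
  show ?thesis
  proof (cases a b rule: linorder_cases)
    case less
    then obtain z where "a < z" "z < b" "h b - h a = (b - a) * deriv h z"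
      using MVT2[of a b h "deriv h"] D by (force simp: closed_segment_eq_real_ivl)
    thus ?thesis using that[of z] by (simp add: closed_segment_eq_real_ivl mult.commute)
  next
    case greater
    then obtain z where "b < z" "z < a" "h a - h b = (a - b) * deriv h z"
      using MVT2[of b a h "deriv h"] D by (force simp: closed_segment_eq_real_ivl)
    thus ?thesis using that[of z] by (simp add: closed_segment_eq_real_ivl algebra_simps)
  qed (use that[of a] in auto)
qed

section \<open>Margins of products\<close>

text \<open>The product of two intervals is spanned by the products of their ends; as \<open>e\<close> ranges over an
  interval containing zero, only \<open>- ml * bu\<close> and \<open>mu * bl\<close> can be smallest.\<close>

lemma product_error_lower:
  fixes e b :: real
  assumes "- ml \<le> e" "e \<le> mu" "bl \<le> b" "b \<le> bu" "0 \<le> ml" "0 \<le> mu"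
  shows "- max (ml * bu) (- mu * bl) \<le> e * b"
proof (cases "0 \<le> e")
  case True
  have "min 0 (mu * bl) \<le> e * bl"
    using assms True mult_right_mono_neg[of e mu bl] by (cases "0 \<le> bl") (simp_all add: min_le_iff_disj)
  moreover have "e * bl \<le> e * b" using True assms by (intro mult_left_mono)
  moreover have "0 \<le> max (ml * bu) (- mu * bl)"
    using assms mult_nonneg_nonneg[of ml bu] mult_nonneg_nonpos[of mu bl]
    by (cases "0 \<le> bl") (simp_all add: le_max_iff_disj)
  ultimately show ?thesis by linarith
next
  case False
  have "min 0 (- ml * bu) \<le> e * bu"
    using assms False mult_right_mono[of "- ml" e bu] mult_nonpos_nonpos[of e bu]
    by (cases "0 \<le> bu") (simp_all add: min_le_iff_disj)
  moreover have "e * bu \<le> e * b" using False assms by (intro mult_left_mono_neg) auto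
  moreover have "0 \<le> max (ml * bu) (- mu * bl)"
    using assms mult_nonneg_nonneg[of ml bu] mult_nonneg_nonpos[of mu bl]
    by (cases "0 \<le> bl") (simp_all add: le_max_iff_disj)
  ultimately show ?thesis by linarith
qed

lemma product_error_upper:
  fixes e b :: real
  assumes "- ml \<le> e" "e \<le> mu" "bl \<le> b" "b \<le> bu" "0 \<le> ml" "0 \<le> mu"
  shows "e * b \<le> max (mu * bu) (- ml * bl)"
  using product_error_lower[of mu "- e" ml bl b bu] assms by simp

context triangulation
begin

lemma product_defect:
  assumes "i \<in> idx S" "w \<in> weights S"
  shows "\<bar>weighted_value S (\<lambda>x. f x * g x) i w - weighted_value S f i w * weighted_value S g i w\<bar>
    \<le> (mesh S)\<^sup>2 * slope S f * slope S g" (is "\<bar>?d\<bar> \<le> _")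
proof -
  have nn: "0 \<le> slope S f * mesh S * (slope S g * mesh S)" using slope_nonneg less_imp_le[OF mesh_pos] by (intro mult_nonneg_nonneg)
  have "\<bar>weighted_value S (\<lambda>x. f x * g x) i w - weighted_value S f i w * weighted_value S g i w\<bar>
      \<le> slope S f * mesh S * (slope S g * mesh S) / 2 * (1 - (\<Sum>j\<in>corners S. (w j)\<^sup>2))"
    using abs_weighted_covariance_le[of "corners S" w "\<lambda>j. f (verts S i j)" "slope S f * mesh S"
        "\<lambda>j. g (verts S i j)" "slope S g * mesh S"]
      finite_corners[of S] weightsD[OF assms(2)] vertex_increment_le[OF assms(1)]
    by (simp add: weighted_value_def)
  also have "\<dots> \<le> slope S f * mesh S * (slope S g * mesh S) / 2 * 1"
  proof (rule mult_left_mono)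
    show "1 - (\<Sum>j\<in>corners S. (w j)\<^sup>2) \<le> 1" by (simp add: sum_nonneg)
  qed (use nn in linarith)
  also have "\<dots> \<le> slope S f * mesh S * (slope S g * mesh S)" using nn by linarith
  also have "\<dots> = (mesh S)\<^sup>2 * slope S f * slope S g" by (simp add: power2_eq_square)
  finally show ?thesis .
qed

text \<open>The error of a product splits into the error of each factor, multiplied by a quantity bounded
  through the other factor, and the defect that interpolation is not multiplicative. That defect is a
  covariance of vertex values.\<close>

lemma product_split:
  "f x * g x - weighted_value S (\<lambda>x. f x * g x) i w =
     (f x - weighted_value S f i w) * g x + (g x - weighted_value S g i w) * weighted_value S f i w
     - (weighted_value S (\<lambda>x. f x * g x) i w - weighted_value S f i w * weighted_value S g i w)"
  by (simp add: algebra_simps)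

lemma product_margins:
  assumes f: "is_lower_margin S f (fst mf)" "is_upper_margin S f (snd mf)"
    and g: "is_lower_margin S g (fst mg)" "is_upper_margin S g (snd mg)"
  shows "is_lower_margin S (\<lambda>x. f x * g x)
      (a_lower S mf g mg + a_lower S mg f mf + (mesh S)\<^sup>2 * slope S f * slope S g)" (is ?lo)
    and "is_upper_margin S (\<lambda>x. f x * g x)
      (a_upper S mf g mg + a_upper S mg f mf + (mesh S)\<^sup>2 * slope S f * slope S g)" (is ?up)
proof -
  note nn = lower_margin_nonneg[OF f(1)] upper_margin_nonneg[OF f(2)] lower_margin_nonneg[OF g(1)] upper_margin_nonneg[OF g(2)]
  show ?lo ?up
    unfolding is_lower_margin_def is_upper_margin_def
  proof (safe)
    fix i w assume iw: "i \<in> idx S" "w \<in> weights S"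
    let ?x = "point S i w"
    let ?ef = "f ?x - weighted_value S f i w" and ?eg = "g ?x - weighted_value S g i w"
    have e: "- fst mf \<le> ?ef" "?ef \<le> snd mf" "- fst mg \<le> ?eg" "?eg \<le> snd mg"
      using f g iw unfolding is_lower_margin_def is_upper_margin_def by force+
    note bg = lower_bound_le[OF g(1) iw] le_upper_bound[OF g(2) iw]
    note bf = weighted_value_bounds(1)[OF iw lower_margin_nonneg[OF f(1)]]
      weighted_value_bounds(2)[OF iw upper_margin_nonneg[OF f(2)]]
    note defect = product_defect[OF iw, of f g]
    have "- a_lower S mf g mg \<le> ?ef * g ?x" "- a_lower S mg f mf \<le> ?eg * weighted_value S f i w"
      unfolding a_lower_def by (intro product_error_lower e bg bf nn)+
    thus "weighted_value S (\<lambda>x. f x * g x) i w -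
        (a_lower S mf g mg + a_lower S mg f mf + (mesh S)\<^sup>2 * slope S f * slope S g) \<le> f ?x * g ?x"
      using product_split[of f ?x g i w] defect by linarith
    have "?ef * g ?x \<le> a_upper S mf g mg" "?eg * weighted_value S f i w \<le> a_upper S mg f mf"
      unfolding a_upper_def by (intro product_error_upper e bg bf nn)+
    thus "f ?x * g ?x \<le> weighted_value S (\<lambda>x. f x * g x) i w +
        (a_upper S mf g mg + a_upper S mg f mf + (mesh S)\<^sup>2 * slope S f * slope S g)"
      using product_split[of f ?x g i w] defect by linarith
  qed
qed

text \<open>For nonnegative factors the upper margins alone suffice: multiplying by a nonnegative quantity
  keeps the one-sided error bounds.\<close>

lemma product_upper_margin_nonneg:
  assumes f: "is_upper_margin S f mf" "\<And>x. x \<in> X \<Longrightarrow> 0 \<le> f x"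
    and g: "is_upper_margin S g mg" "\<And>x. x \<in> X \<Longrightarrow> 0 \<le> g x"
  shows "is_upper_margin S (\<lambda>x. f x * g x)
      (mf * upper_bound S g mg + mg * upper_bound S f mf + (mesh S)\<^sup>2 * slope S f * slope S g)"
  unfolding is_upper_margin_def
proof (safe)
  fix i w assume iw: "i \<in> idx S" "w \<in> weights S"
  let ?x = "point S i w"
  note x = point_in[OF iw]
  have "(f ?x - weighted_value S f i w) * g ?x \<le> mf * g ?x"
    using f(1) g(2)[OF x] iw unfolding is_upper_margin_def by (intro mult_right_mono) force+
  also have "\<dots> \<le> mf * upper_bound S g mg"
    by (intro mult_left_mono le_upper_bound g iw upper_margin_nonneg[OF f(1)])
  finally have 1: "(f ?x - weighted_value S f i w) * g ?x \<le> mf * upper_bound S g mg" .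
  have "0 \<le> weighted_value S f i w" using iw f(2) vertex_in by (intro weighted_value_ge) auto
  hence "(g ?x - weighted_value S g i w) * weighted_value S f i w \<le> mg * weighted_value S f i w"
    using g(1) iw unfolding is_upper_margin_def by (intro mult_right_mono) force+
  also have "\<dots> \<le> mg * upper_bound S f mf"
    by (intro mult_left_mono weighted_value_bounds iw upper_margin_nonneg[OF f(1)] upper_margin_nonneg[OF g(1)])
  finally have 2: "(g ?x - weighted_value S g i w) * weighted_value S f i w \<le> mg * upper_bound S f mf" .
  show "f ?x * g ?x \<le> weighted_value S (\<lambda>x. f x * g x) i w +
      (mf * upper_bound S g mg + mg * upper_bound S f mf + (mesh S)\<^sup>2 * slope S f * slope S g)"
    using 1 2 product_split[of f ?x g i w] product_defect[OF iw, of f g] by linarith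
qed

lemma weighted_value_sum:
  "weighted_value S (\<lambda>x. \<Sum>s\<in>A. F s x) i w = (\<Sum>s\<in>A. weighted_value S (F s) i w)"
  unfolding weighted_value_def by (simp add: sum_distrib_left sum.swap[of _ A])

lemma sum_lower_margin:
  assumes "\<And>s. s \<in> A \<Longrightarrow> is_lower_margin S (F s) (m s)"
  shows "is_lower_margin S (\<lambda>x. \<Sum>s\<in>A. F s x) (\<Sum>s\<in>A. m s)"
  using assms unfolding is_lower_margin_def weighted_value_sum
  by (auto simp: sum_subtractf[symmetric] intro!: sum_mono)

lemma sum_upper_margin:
  assumes "\<And>s. s \<in> A \<Longrightarrow> is_upper_margin S (F s) (m s)"
  shows "is_upper_margin S (\<lambda>x. \<Sum>s\<in>A. F s x) (\<Sum>s\<in>A. m s)"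
  using assms unfolding is_upper_margin_def weighted_value_sum
  by (auto simp: sum.distrib[symmetric] intro!: sum_mono)

lemma sum_prod_margins_correct:
  assumes "\<And>s. s \<in> {1..T} \<Longrightarrow> is_lower_margin S (\<phi> s) (fst (m\<phi> s))"
    "\<And>s. s \<in> {1..T} \<Longrightarrow> is_upper_margin S (\<phi> s) (snd (m\<phi> s))"
    "\<And>s. s \<in> {1..T} \<Longrightarrow> is_lower_margin S (\<psi> s) (fst (m\<psi> s))"
    "\<And>s. s \<in> {1..T} \<Longrightarrow> is_upper_margin S (\<psi> s) (snd (m\<psi> s))"
  shows "is_lower_margin S (sum_prod T \<phi> \<psi>) (fst (sum_prod_margins T S \<phi> m\<phi> \<psi> m\<psi>))"
    and "is_upper_margin S (sum_prod T \<phi> \<psi>) (snd (sum_prod_margins T S \<phi> m\<phi> \<psi> m\<psi>))"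
  unfolding sum_prod_margins_def sum_prod_def[abs_def] fst_conv snd_conv
  by (intro sum_lower_margin sum_upper_margin product_margins assms; assumption)+

lemma sum_prod_upper_ndec_correct:
  assumes "\<And>s. s \<in> {1..T} \<Longrightarrow> is_upper_margin S (\<phi> s) (snd (m\<phi> s))"
    "\<And>s. s \<in> {1..T} \<Longrightarrow> is_upper_margin S (\<psi> s) (snd (m\<psi> s))"
    "\<And>s x. s \<in> {1..T} \<Longrightarrow> x \<in> X \<Longrightarrow> 0 \<le> \<phi> s x" "\<And>s x. s \<in> {1..T} \<Longrightarrow> x \<in> X \<Longrightarrow> 0 \<le> \<psi> s x"
  shows "is_upper_margin S (sum_prod T \<phi> \<psi>) (sum_prod_upper_ndec T S \<phi> m\<phi> \<psi> m\<psi>)"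
  unfolding sum_prod_upper_ndec_def sum_prod_def[abs_def]
  by (intro sum_upper_margin product_upper_margin_nonneg assms; assumption)

end

section \<open>Margins of functions of class one and of compositions\<close>

context triangulation
begin

lemma F1_margins:
  assumes "F1_bounds X Xt f lo up"
  shows "is_lower_margin S f (real CARD('n) * (mesh S)\<^sup>2 / 8 * max 0 up)"
    and "is_upper_margin S f (real CARD('n) * (mesh S)\<^sup>2 / 8 * max 0 (- lo))"
proof -
  have C2: "C2_on Xt f" using assms unfolding F1_bounds_def by blast
  have card: "2 \<le> card (corners S)" "real (card (corners S)) - 1 = real CARD('n)"
    by (simp_all add: card_corners Suc_leI)
  have d: "lo * (norm v)\<^sup>2 \<le> second_along f p v" "second_along f p v \<le> up * (norm v)\<^sup>2"
    if "p \<in> cell S i" "i \<in> idx S" for p v i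
    using F1_bounds_second_along[OF assms Xt_open X_Xt] cell_subset that by blast+
  have A: "convex (cell S i)" "cell S i \<subseteq> Xt" "\<And>j. j \<in> corners S \<Longrightarrow> verts S i j \<in> cell S i" if "i \<in> idx S" for i
    using that cell_subset X_Xt unfolding cell_eq_convex_hull by (auto simp: hull_inc)
  show "is_lower_margin S f (real CARD('n) * (mesh S)\<^sup>2 / 8 * max 0 up)"
    unfolding is_lower_margin_def weighted_value_def point_def card(2)[symmetric]
    by (intro ballI interpolation_error_lower[OF Xt_open C2 A(1,2) finite_corners card(1)])
      (auto simp: weightsD edge_le_mesh intro: A d)
  show "is_upper_margin S f (real CARD('n) * (mesh S)\<^sup>2 / 8 * max 0 (- lo))"
    unfolding is_upper_margin_def weighted_value_def point_def card(2)[symmetric]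
    by (intro ballI interpolation_error_upper[OF Xt_open C2 A(1,2) finite_corners card(1)])
      (auto simp: weightsD edge_le_mesh intro: A d)
qed

text \<open>The image of a cell is an interval that contains the vertex values, hence all their weighted
  means. So the outer function is defined, and its derivative is controlled, between the value of \<open>y\<close>
  and its interpolant, even when \<open>X\<close> is not connected.\<close>

lemma cell_values_interval:
  assumes "continuous_on X y" "i \<in> idx S"
  shows "convex (y ` cell S i)" "weighted_value S y i ` weights S \<subseteq> y ` cell S i"
proof -
  have "connected (cell S i)" unfolding cell_eq_convex_hull by (simp add: convex_connected)
  hence "connected (y ` cell S i)"
    by (rule connected_continuous_image[OF continuous_on_subset[OF assms(1) cell_subset[OF assms(2)]]])
  thus convex: "convex (y ` cell S i)" using is_interval_connected_1 is_interval_convex_1 by blast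
  have "(\<lambda>j. y (verts S i j)) ` corners S \<subseteq> y ` cell S i"
    unfolding cell_eq_convex_hull by (auto intro: hull_inc)
  thus "weighted_value S y i ` weights S \<subseteq> y ` cell S i"
    unfolding weighted_values_eq_convex_hull using convex by (rule hull_minimal)
qed

lemma segment_to_interpolant:
  assumes "continuous_on X y" "i \<in> idx S" "w \<in> weights S"
  shows "closed_segment (weighted_value S y i w) (y (point S i w)) \<subseteq> y ` cell S i"
  using cell_values_interval[OF assms(1,2)] assms(3)
  by (intro closed_segment_subset) (auto simp: cell_def)

text \<open>This is the error of interpolating \<open>h\<close> in one real variable between the vertex values
  of \<open>y\<close>, whose mutual distances are at most the slope times the mesh.\<close>

lemma composed_interpolation_upper:
  assumes iw: "i \<in> idx S" "w \<in> weights S" and y: "continuous_on X y" "y ` X \<subseteq> Yt"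
    and h: "open Yt" "C2_on Yt h"
    and d: "\<And>z. z \<in> interp S y ` X \<Longrightarrow> d \<le> (deriv ^^ 2) h z"
  shows "h (weighted_value S y i w) \<le> weighted_value S (\<lambda>x. h (y x)) i w +
    (mesh S)\<^sup>2 * (real CARD('n) * (slope S y)\<^sup>2 / 8) * max 0 (- d)"
proof -
  let ?A = "weighted_value S y i ` weights S"
  have A: "?A \<subseteq> Yt" using cell_values_interval(2)[OF y(1) iw(1)] cell_subset[OF iw(1)] y(2) by blast
  have card: "2 \<le> card (corners S)" "real (card (corners S)) - 1 = real CARD('n)"
    by (simp_all add: card_corners Suc_leI)
  have conv: "convex ?A" and v: "\<And>j. j \<in> corners S \<Longrightarrow> y (verts S i j) \<in> ?A"
    unfolding weighted_values_eq_convex_hull by (auto intro: hull_inc)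
  have sd: "d * (norm v)\<^sup>2 \<le> second_along h p v" if "p \<in> ?A" for p v
  proof -
    have "d \<le> (deriv ^^ 2) h p" using d that iw(1) unfolding interp_image by blast
    moreover have "second_along h p v = v\<^sup>2 * (deriv ^^ 2) h p"
      using that A by (intro second_along_real[OF h]) auto
    ultimately show ?thesis by (simp add: mult.commute[of d] mult_left_mono)
  qed
  have "h (\<Sum>j\<in>corners S. w j *\<^sub>R y (verts S i j)) \<le> (\<Sum>j\<in>corners S. w j * h (y (verts S i j)))
      + (real (card (corners S)) - 1) * (slope S y * mesh S)\<^sup>2 / 8 * max 0 (- d)"
    by (rule interpolation_error_upper[OF h conv A finite_corners card(1)])
      (use iw v sd vertex_increment_le in \<open>auto simp: weightsD\<close>)
  thus ?thesis unfolding card(2) by (simp add: weighted_value_def power_mult_distrib mult_ac)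
qed

lemma composed_interpolation_lower:
  assumes iw: "i \<in> idx S" "w \<in> weights S" and y: "continuous_on X y" "y ` X \<subseteq> Yt"
    and h: "open Yt" "C2_on Yt h"
    and d: "\<And>z. z \<in> interp S y ` X \<Longrightarrow> (deriv ^^ 2) h z \<le> d"
  shows "weighted_value S (\<lambda>x. h (y x)) i w -
    (mesh S)\<^sup>2 * (real CARD('n) * (slope S y)\<^sup>2 / 8) * max 0 d \<le> h (weighted_value S y i w)"
proof -
  let ?A = "weighted_value S y i ` weights S"
  have A: "?A \<subseteq> Yt" using cell_values_interval(2)[OF y(1) iw(1)] cell_subset[OF iw(1)] y(2) by blast
  have card: "2 \<le> card (corners S)" "real (card (corners S)) - 1 = real CARD('n)"
    by (simp_all add: card_corners Suc_leI)
  have conv: "convex ?A" and v: "\<And>j. j \<in> corners S \<Longrightarrow> y (verts S i j) \<in> ?A"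
    unfolding weighted_values_eq_convex_hull by (auto intro: hull_inc)
  have sd: "second_along h p v \<le> d * (norm v)\<^sup>2" if "p \<in> ?A" for p v
  proof -
    have "(deriv ^^ 2) h p \<le> d" using d that iw(1) unfolding interp_image by blast
    moreover have "second_along h p v = v\<^sup>2 * (deriv ^^ 2) h p"
      using that A by (intro second_along_real[OF h]) auto
    ultimately show ?thesis by (simp add: mult.commute[of d] mult_left_mono)
  qed
  have "(\<Sum>j\<in>corners S. w j * h (y (verts S i j))) -
      (real (card (corners S)) - 1) * (slope S y * mesh S)\<^sup>2 / 8 * max 0 d
      \<le> h (\<Sum>j\<in>corners S. w j *\<^sub>R y (verts S i j))"
    by (rule interpolation_error_lower[OF h conv A finite_corners card(1)])
      (use iw v sd vertex_increment_le in \<open>auto simp: weightsD\<close>)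
  thus ?thesis unfolding card(2) by (simp add: weighted_value_def power_mult_distrib mult_ac)
qed

text \<open>The error of \<open>h \<circ> y\<close> is the sum of \<open>h (y x) - h (y\<^sup>I x)\<close>, which the mean value theorem reduces to
  the error of \<open>y\<close>, and of the error of interpolating \<open>h\<close> itself.\<close>

lemma composition_margins:
  assumes y: "continuous_on X y" and H: "H_bounds X Xt y h d_lo d_up dd_lo dd_up"
    and m: "is_lower_margin S y m_lo" "is_upper_margin S y m_up"
  defines "q \<equiv> (mesh S)\<^sup>2 * (real CARD('n) * (slope S y)\<^sup>2 / 8)"
  shows "is_lower_margin S (\<lambda>x. h (y x))
      (max (- m_up * d_lo S) (m_lo * d_up S) + q * max 0 (dd_up S))" (is ?lo)
    and "is_upper_margin S (\<lambda>x. h (y x))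
      (max (- m_lo * d_lo S) (m_up * d_up S) + q * max 0 (- dd_lo S))" (is ?up)
proof -
  obtain Yt where Yt: "open Yt" "y ` Xt \<subseteq> Yt" "C2_on Yt h" using H unfolding H_bounds_def by blast
  hence yX: "y ` X \<subseteq> Yt" using X_Xt by blast
  have d: "\<And>z. z \<in> y ` X \<Longrightarrow> d_lo S \<le> deriv h z" "\<And>z. z \<in> y ` X \<Longrightarrow> deriv h z \<le> d_up S"
    and dd: "\<And>z. z \<in> interp S y ` X \<Longrightarrow> dd_lo S \<le> (deriv ^^ 2) h z"
    "\<And>z. z \<in> interp S y ` X \<Longrightarrow> (deriv ^^ 2) h z \<le> dd_up S"
    using H coll unfolding H_bounds_def by blast+
  note nn = lower_margin_nonneg[OF m(1)] upper_margin_nonneg[OF m(2)]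
  have mv: "- max (m_lo * d_up S) (- m_up * d_lo S) \<le> h (y (point S i w)) - h (weighted_value S y i w)"
    "h (y (point S i w)) - h (weighted_value S y i w) \<le> max (m_up * d_up S) (- m_lo * d_lo S)"
    if iw: "i \<in> idx S" "w \<in> weights S" for i w
  proof -
    have seg: "closed_segment (weighted_value S y i w) (y (point S i w)) \<subseteq> y ` X"
      using segment_to_interpolant[OF y iw] cell_subset[OF iw(1)] by blast
    then obtain z where z: "z \<in> y ` X"
      "h (y (point S i w)) - h (weighted_value S y i w) = deriv h z * (y (point S i w) - weighted_value S y i w)"
      using mean_value_segment[OF Yt(3)] yX by (metis subset_iff)
    have e: "- m_lo \<le> y (point S i w) - weighted_value S y i w" "y (point S i w) - weighted_value S y i w \<le> m_up"
      using m iw unfolding is_lower_margin_def is_upper_margin_def by force+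
    show "- max (m_lo * d_up S) (- m_up * d_lo S) \<le> h (y (point S i w)) - h (weighted_value S y i w)"
      unfolding z(2) mult.commute[of "deriv h z"] by (rule product_error_lower[OF e d[OF z(1)] nn])
    show "h (y (point S i w)) - h (weighted_value S y i w) \<le> max (m_up * d_up S) (- m_lo * d_lo S)"
      unfolding z(2) mult.commute[of "deriv h z"] by (rule product_error_upper[OF e d[OF z(1)] nn])
  qed
  show ?lo unfolding is_lower_margin_def
  proof (intro ballI)
    fix i w assume iw: "i \<in> idx S" "w \<in> weights S"
    show "weighted_value S (\<lambda>x. h (y x)) i w - (max (- m_up * d_lo S) (m_lo * d_up S) + q * max 0 (dd_up S))
        \<le> h (y (point S i w))"
      using mv(1)[OF iw] composed_interpolation_lower[OF iw y yX Yt(1,3) dd(2)] unfolding q_def by linarith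
  qed
  show ?up unfolding is_upper_margin_def
  proof (intro ballI)
    fix i w assume iw: "i \<in> idx S" "w \<in> weights S"
    show "h (y (point S i w)) \<le>
        weighted_value S (\<lambda>x. h (y x)) i w + (max (- m_lo * d_lo S) (m_up * d_up S) + q * max 0 (- dd_lo S))"
      using mv(2)[OF iw] composed_interpolation_upper[OF iw y yX Yt(1,3) dd(1)] unfolding q_def by linarith
  qed
qed

text \<open>For nondecreasing \<open>h\<close> an upper margin of \<open>y\<close> suffices: where \<open>y\<close> lies below its interpolant the
  first part of the error is not positive, and elsewhere the derivative is only needed between the
  interpolant and \<open>y\<close>.\<close>

lemma ndec_composition_margin:
  assumes X: "compact X" and y: "continuous_on X y" and H: "H_ndec_bounds X Xt y h d_up dd_lo"
    and m: "is_upper_margin S y m_up"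
  shows "is_upper_margin S (\<lambda>x. h (y x))
      (m_up * d_up S + (mesh S)\<^sup>2 * (real CARD('n) * (slope S y)\<^sup>2 / 8) * max 0 (- dd_lo S))"
  unfolding is_upper_margin_def
proof (intro ballI)
  fix i w assume iw: "i \<in> idx S" "w \<in> weights S"
  let ?I = "{Inf (interp S y ` X)..Sup (y ` X)}"
  obtain Yt where Yt: "open Yt" "y ` Xt \<subseteq> Yt" "C2_on Yt h" "mono_on Yt h"
    and dd: "\<And>z. z \<in> interp S y ` X \<Longrightarrow> dd_lo S \<le> (deriv ^^ 2) h z"
    and d: "\<And>z. z \<in> ?I \<inter> Yt \<Longrightarrow> deriv h z \<le> d_up S"
    using H coll unfolding H_ndec_bounds_def by blast
  have yX: "y ` X \<subseteq> Yt" using X_Xt Yt(2) by blast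
  have bdd: "bdd_above (y ` X)" "bdd_below (y ` X)"
    using compact_imp_bounded[OF compact_continuous_image[OF y X]]
    by (simp_all add: bounded_imp_bdd_above bounded_imp_bdd_below)
  have interp_sub: "interp S y ` X \<subseteq> y ` X"
    unfolding interp_image using cell_values_interval(2)[OF y] cell_subset by blast
  (* Inf and Sup of unbounded sets of reals have no meaning, hence the boundedness above. *)
  have in_I: "z \<in> ?I \<inter> Yt" if "a \<in> interp S y ` X" "a \<le> z" "z \<in> y ` X" for a z
    using that cInf_lower[OF that(1) bdd_below_mono[OF bdd(2) interp_sub]] cSup_upper[OF that(3) bdd(1)] yX by auto
  have wv: "weighted_value S y i w \<in> interp S y ` X" unfolding interp_image using iw by blast
  have "0 \<le> d_up S"
  proof -
    have z: "weighted_value S y i w \<in> ?I \<inter> Yt" using in_I[OF wv] wv interp_sub by blast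
    hence "0 \<le> deriv h (weighted_value S y i w)"
      using Yt(1) by (intro mono_on_imp_deriv_nonneg[OF Yt(4) C2_on_deriv[OF Yt(3)]]) (auto simp: interior_open)
    thus ?thesis using d[OF z] by linarith
  qed
  have mv: "h (y (point S i w)) - h (weighted_value S y i w) \<le> m_up * d_up S"
  proof (cases "weighted_value S y i w \<le> y (point S i w)")
    case True
    have seg: "closed_segment (weighted_value S y i w) (y (point S i w)) \<subseteq> y ` X"
      using segment_to_interpolant[OF y iw] cell_subset[OF iw(1)] by blast
    then obtain z where z: "z \<in> closed_segment (weighted_value S y i w) (y (point S i w))"
      "h (y (point S i w)) - h (weighted_value S y i w) = deriv h z * (y (point S i w) - weighted_value S y i w)"
      using mean_value_segment[OF Yt(3)] yX by (metis subset_trans)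
    have "deriv h z \<le> d_up S"
      using z(1) seg True by (intro d in_I[OF wv]) (auto simp: closed_segment_eq_real_ivl)
    hence "deriv h z * (y (point S i w) - weighted_value S y i w) \<le> d_up S * (y (point S i w) - weighted_value S y i w)"
      using True by (intro mult_right_mono) auto
    also have "\<dots> \<le> d_up S * m_up"
      using m iw \<open>0 \<le> d_up S\<close> unfolding is_upper_margin_def by (intro mult_left_mono) force+
    finally show ?thesis using z(2) by (simp add: mult.commute)
  next
    case False
    have "y (point S i w) \<in> Yt" "weighted_value S y i w \<in> Yt"
      using yX point_in[OF iw] interp_sub wv by blast+
    hence "h (y (point S i w)) \<le> h (weighted_value S y i w)"
      using Yt(4) False by (auto simp: mono_on_def)
    moreover have "0 \<le> m_up * d_up S" using \<open>0 \<le> d_up S\<close> upper_margin_nonneg[OF m] by simp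
    ultimately show ?thesis by linarith
  qed
  show "h (y (point S i w)) \<le> weighted_value S (\<lambda>x. h (y x)) i w +
      (m_up * d_up S + (mesh S)\<^sup>2 * (real CARD('n) * (slope S y)\<^sup>2 / 8) * max 0 (- dd_lo S))"
    using mv composed_interpolation_upper[OF iw y yX Yt(1,3) dd] by linarith
qed

text \<open>For convex \<open>h\<close> Jensen's inequality makes the interpolation error of \<open>h\<close> itself nonpositive.\<close>

lemma convex_composition_margin:
  assumes y: "continuous_on X y" and H: "H_conv_bound Xt y h L"
    and m: "is_lower_margin S y m_lo" "is_upper_margin S y m_up"
  shows "is_upper_margin S (\<lambda>x. h (y x)) (L * max m_lo m_up)"
  unfolding is_upper_margin_def
proof (intro ballI)
  fix i w assume iw: "i \<in> idx S" "w \<in> weights S"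
  obtain Yt where Yt: "y ` Xt \<subseteq> Yt" "convex_on Yt h" "L-lipschitz_on Yt h"
    using H unfolding H_conv_bound_def by blast
  have yX: "y ` X \<subseteq> Yt" using X_Xt Yt(1) by blast
  have in_Yt: "y (point S i w) \<in> Yt" "weighted_value S y i w \<in> Yt"
    using yX point_in[OF iw] cell_values_interval(2)[OF y iw(1)] iw(2) cell_subset[OF iw(1)] by blast+
  have "\<bar>y (point S i w) - weighted_value S y i w\<bar> \<le> max m_lo m_up"
    using m iw unfolding is_lower_margin_def is_upper_margin_def by (fastforce simp: abs_le_iff le_max_iff_disj)
  hence "L * \<bar>y (point S i w) - weighted_value S y i w\<bar> \<le> L * max m_lo m_up"
    using lipschitz_on_nonneg[OF Yt(3)] by (intro mult_left_mono)
  hence "\<bar>h (y (point S i w)) - h (weighted_value S y i w)\<bar> \<le> L * max m_lo m_up"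
    using lipschitz_onD[OF Yt(3) in_Yt] by (simp add: dist_real_def)
  moreover have "h (\<Sum>j\<in>corners S. w j *\<^sub>R y (verts S i j)) \<le> (\<Sum>j\<in>corners S. w j * h (y (verts S i j)))"
    by (rule convex_on_sum[OF finite_corners _ Yt(2)])
      (use weightsD[OF iw(2)] vertex_in[OF iw(1)] yX in \<open>auto simp: corners_def\<close>)
  hence "h (weighted_value S y i w) \<le> weighted_value S (\<lambda>x. h (y x)) i w"
    by (simp add: weighted_value_def)
  ultimately show "h (y (point S i w)) \<le> weighted_value S (\<lambda>x. h (y x)) i w + L * max m_lo m_up" by linarith
qed

end

section \<open>Correctness of the margin procedures\<close>

lemma F_plus_nonneg: "f \<in> F_plus X Xt T N \<Longrightarrow> x \<in> Xt \<Longrightarrow> 0 \<le> f x"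
  by (cases "(X, Xt, T, N)" rule: F_plus.cases) (auto simp: F_nonneg_def)

lemma continuous_on_sum_prod:
  assumes "\<And>s. s \<in> {1..T} \<Longrightarrow> continuous_on A (\<phi> s)" "\<And>s. s \<in> {1..T} \<Longrightarrow> continuous_on A (\<psi> s)"
  shows "continuous_on A (sum_prod T \<phi> \<psi>)"
  unfolding sum_prod_def[abs_def] by (intro continuous_intros assms; assumption)

lemma tree_F_continuous: "tree_F X Xt T N D \<Longrightarrow> continuous_on Xt (tree_fun T D)"
proof (induction rule: tree_F.induct)
  case (leaf \<xi> d2_lo d2_up)
  thus ?case by (auto simp: F1_bounds_def intro: C2_on_continuous)
next
  case (node N \<phi> \<psi> h d_lo d_up dd_lo dd_up)
  have "continuous_on Xt (sum_prod T (\<lambda>s. tree_fun T (\<phi> s)) (\<lambda>s. tree_fun T (\<psi> s)))"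
    using node.IH by (intro continuous_on_sum_prod) auto
  moreover obtain Yt where "sum_prod T (\<lambda>s. tree_fun T (\<phi> s)) (\<lambda>s. tree_fun T (\<psi> s)) ` Xt \<subseteq> Yt" "C2_on Yt h"
    using node.hyps unfolding H_bounds_def by blast
  ultimately show ?case using continuous_on_compose2[OF C2_on_continuous] by (simp, blast)
qed

lemma tree_F_plus_continuous: "tree_F_plus X Xt T N D \<Longrightarrow> continuous_on Xt (tree_fun T D)"
proof (induction rule: tree_F_plus.induct)
  case (leaf \<xi> d2_lo d2_up)
  thus ?case by (auto simp: F1_bounds_def intro: C2_on_continuous)
next
  case (ndec N \<phi> \<psi> h d_up dd_lo)
  have "continuous_on Xt (sum_prod T (\<lambda>s. tree_fun T (\<phi> s)) (\<lambda>s. tree_fun T (\<psi> s)))"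
    using ndec.IH tree_F_continuous by (intro continuous_on_sum_prod) blast+
  moreover obtain Yt where "sum_prod T (\<lambda>s. tree_fun T (\<phi> s)) (\<lambda>s. tree_fun T (\<psi> s)) ` Xt \<subseteq> Yt" "C2_on Yt h"
    using ndec.hyps unfolding H_ndec_bounds_def by blast
  ultimately show ?case using continuous_on_compose2[OF C2_on_continuous] by (simp, blast)
next
  case (conv N \<phi> \<psi> h L)
  have "continuous_on Xt (sum_prod T (\<lambda>s. tree_fun T (\<phi> s)) (\<lambda>s. tree_fun T (\<psi> s)))"
    using conv.hyps tree_F_continuous by (intro continuous_on_sum_prod) blast+
  moreover obtain Yt where "sum_prod T (\<lambda>s. tree_fun T (\<phi> s)) (\<lambda>s. tree_fun T (\<psi> s)) ` Xt \<subseteq> Yt" "L-lipschitz_on Yt h"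
    using conv.hyps unfolding H_conv_bound_def by blast
  ultimately show ?case using continuous_on_compose2[OF lipschitz_on_continuous_on] by (simp, blast)
qed

context triangulation
begin

text \<open>Each node applies the margins of a sum of products and then those of a composition. The
  interval property of cell images needs continuity of the inner functions, which the preceding
  lemmas supply.\<close>

lemma tree_F_margins:
  "tree_F X Xt T N D \<Longrightarrow>
     is_lower_margin S (tree_fun T D) (lower_margin T S D) \<and>
     is_upper_margin S (tree_fun T D) (upper_margin T S D)"
proof (induction rule: tree_F.induct)
  case (leaf \<xi> d2_lo d2_up)
  thus ?case using F1_margins by (simp add: lower_margin_def upper_margin_def)
next
  case (node N \<phi> \<psi> h d_lo d_up dd_lo dd_up)
  let ?\<phi> = "\<lambda>s. tree_fun T (\<phi> s)" and ?\<psi> = "\<lambda>s. tree_fun T (\<psi> s)"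
  have c: "continuous_on X (sum_prod T ?\<phi> ?\<psi>)"
    using node.IH tree_F_continuous
    by (intro continuous_on_subset[OF _ X_Xt] continuous_on_sum_prod) blast+
  have "is_lower_margin S (?\<phi> s) (fst (margins T S (\<phi> s)))" "is_upper_margin S (?\<phi> s) (snd (margins T S (\<phi> s)))"
    "is_lower_margin S (?\<psi> s) (fst (margins T S (\<psi> s)))" "is_upper_margin S (?\<psi> s) (snd (margins T S (\<psi> s)))"
    if "s \<in> {1..T}" for s
    using node.IH that unfolding lower_margin_def upper_margin_def by blast+
  from composition_margins[OF c node.hyps(2) sum_prod_margins_correct[OF this]]
  show ?case
    by (simp add: lower_margin_def upper_margin_def node_margins_def Let_def case_prod_beta)
qed

text \<open>Nondecreasing and convex nodes leave their lower margin unspecified. A nondecreasing node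
  consumes only upper margins, and the inner functions of a convex node come from \<open>tree_F\<close>, where
  both margins are available.\<close>

lemma tree_F_plus_margin:
  assumes "compact X"
  shows "tree_F_plus X Xt T N D \<Longrightarrow> is_upper_margin S (tree_fun T D) (upper_margin T S D)"
proof (induction rule: tree_F_plus.induct)
  case (leaf \<xi> d2_lo d2_up)
  thus ?case using F1_margins by (simp add: upper_margin_def)
next
  case (ndec N \<phi> \<psi> h d_up dd_lo)
  let ?\<phi> = "\<lambda>s. tree_fun T (\<phi> s)" and ?\<psi> = "\<lambda>s. tree_fun T (\<psi> s)"
  have c: "continuous_on X (sum_prod T ?\<phi> ?\<psi>)"
    using ndec.IH tree_F_continuous tree_F_plus_continuous
    by (intro continuous_on_subset[OF _ X_Xt] continuous_on_sum_prod) blast+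
  have "is_upper_margin S (?\<phi> s) (snd (margins T S (\<phi> s)))" "is_upper_margin S (?\<psi> s) (snd (margins T S (\<psi> s)))"
    if "s \<in> {1..T}" for s
    using ndec.IH that tree_F_margins unfolding upper_margin_def by blast+
  moreover have "0 \<le> ?\<phi> s x" "0 \<le> ?\<psi> s x" if "s \<in> {1..T}" "x \<in> X" for s x
    using ndec.IH that X_Xt F_plus_nonneg by blast+
  ultimately have "is_upper_margin S (sum_prod T ?\<phi> ?\<psi>)
      (sum_prod_upper_ndec T S ?\<phi> (\<lambda>s. margins T S (\<phi> s)) ?\<psi> (\<lambda>s. margins T S (\<psi> s)))"
    by (intro sum_prod_upper_ndec_correct)
  from ndec_composition_margin[OF assms c ndec.hyps(2) this]
  show ?case by (simp add: upper_margin_def node_margins_def Let_def case_prod_beta)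
next
  case (conv N \<phi> \<psi> h L)
  let ?\<phi> = "\<lambda>s. tree_fun T (\<phi> s)" and ?\<psi> = "\<lambda>s. tree_fun T (\<psi> s)"
  have c: "continuous_on X (sum_prod T ?\<phi> ?\<psi>)"
    using conv.hyps tree_F_continuous
    by (intro continuous_on_subset[OF _ X_Xt] continuous_on_sum_prod) blast+
  have "is_lower_margin S (?\<phi> s) (fst (margins T S (\<phi> s)))" "is_upper_margin S (?\<phi> s) (snd (margins T S (\<phi> s)))"
    "is_lower_margin S (?\<psi> s) (fst (margins T S (\<psi> s)))" "is_upper_margin S (?\<psi> s) (snd (margins T S (\<psi> s)))"
    if "s \<in> {1..T}" for s
    using conv.hyps that tree_F_margins unfolding lower_margin_def upper_margin_def by blast+
  from convex_composition_margin[OF c conv.hyps(3) sum_prod_margins_correct[OF this]]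
  show ?case by (simp add: upper_margin_def node_margins_def Let_def case_prod_beta)
qed

lemma margin_cong:
  assumes "\<And>x. x \<in> X \<Longrightarrow> f x = g x"
  shows "is_lower_margin S f m \<longleftrightarrow> is_lower_margin S g m" "is_upper_margin S f m \<longleftrightarrow> is_upper_margin S g m"
proof -
  have "weighted_value S f i w = weighted_value S g i w" if "i \<in> idx S" for i w
    unfolding weighted_value_def using assms vertex_in[OF that] by (intro sum.cong) auto
  thus "is_lower_margin S f m \<longleftrightarrow> is_lower_margin S g m" "is_upper_margin S f m \<longleftrightarrow> is_upper_margin S g m"
    unfolding is_lower_margin_def is_upper_margin_def using assms point_in by auto
qed

lemma decomposition_F_margins:
  assumes "decomposition_F X Xt T N D f"
  shows "is_lower_margin S f (lower_margin T S D)" "is_upper_margin S f (upper_margin T S D)"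
proof -
  have "\<And>x. x \<in> X \<Longrightarrow> f x = tree_fun T D x" and "tree_F X Xt T N D"
    using assms X_Xt unfolding decomposition_F_def by auto
  thus "is_lower_margin S f (lower_margin T S D)" "is_upper_margin S f (upper_margin T S D)"
    using margin_cong tree_F_margins by metis+
qed

lemma decomposition_F_plus_margin:
  assumes "compact X" "decomposition_F_plus X Xt T N D f"
  shows "is_upper_margin S f (upper_margin T S D)"
proof -
  have "\<And>x. x \<in> X \<Longrightarrow> f x = tree_fun T D x" and "tree_F_plus X Xt T N D"
    using assms X_Xt unfolding decomposition_F_plus_def by auto
  thus ?thesis using margin_cong(2) tree_F_plus_margin[OF assms(1)] by metis
qed

lemma upper_margin_add:
  assumes "is_upper_margin S f a" "is_upper_margin S g b"
  shows "is_upper_margin S (\<lambda>x. f x + g x) (a + b)"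
  unfolding is_upper_margin_def weighted_value_add
proof (intro ballI)
  fix i w assume "i \<in> idx S" "w \<in> weights S"
  hence "f (point S i w) \<le> weighted_value S f i w + a" "g (point S i w) \<le> weighted_value S g i w + b"
    using assms unfolding is_upper_margin_def by blast+
  thus "f (point S i w) + g (point S i w) \<le> weighted_value S f i w + weighted_value S g i w + (a + b)"
    by linarith
qed

end

lemma decomposition_F_continuous:
  "decomposition_F X Xt T N D f \<Longrightarrow> continuous_on Xt f"
  unfolding decomposition_F_def by (metis (full_types) continuous_on_cong tree_F_continuous)

lemma decomposition_F_plus_continuous:
  "decomposition_F_plus X Xt T N D f \<Longrightarrow> continuous_on Xt f"
  unfolding decomposition_F_plus_def by (metis (full_types) continuous_on_cong tree_F_plus_continuous)

section \<open>Certification by fine collections\<close>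

lemma cell_subset_closure_interior:
  fixes S :: "'n::finite simplexes"
  assumes "simplex_collection X S" "i \<in> idx S"
  shows "cell S i \<subseteq> closure (interior (cell S i))"
proof -
  define a where "a = verts S i (CARD('n) + 1)"
  define B where "B = (\<lambda>j. verts S i j - a) ` {1..CARD('n)}"
  have "independent B" "card B = CARD('n)"
    using assms unfolding simplex_collection_def B_def a_def by (auto simp: card_image)
  then obtain z where z: "z \<in> interior (convex hull (insert 0 B))"
    using interior_simplex_nonempty[of B] by (auto simp: B_def)
  have "corners S = insert (CARD('n) + 1) {1..CARD('n)}" unfolding corners_def by auto
  hence "verts S i ` corners S = (+) a ` insert 0 B" unfolding B_def a_def by (simp add: image_image)
  hence "cell S i = (+) a ` (convex hull (insert 0 B))"
    unfolding cell_eq_convex_hull by (simp only: convex_hull_translation)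
  hence "interior (cell S i) \<noteq> {}" using z by (auto simp: interior_translation)
  moreover have "convex (cell S i)" unfolding cell_eq_convex_hull by simp
  ultimately show ?thesis using convex_closure_interior closure_subset by metis
qed

text \<open>Cells are full-dimensional simplexes, so every point of a union of cells is a limit of
  interior points. The compactness argument below rests on this property of the candidate region.\<close>

lemma union_of_cells_subset_closure_interior:
  assumes "simplex_collection X S" "Ih \<subseteq> idx S" "Xh = (\<Union>i\<in>Ih. cell S i)"
  shows "Xh \<subseteq> closure (interior Xh)"
proof
  fix x assume "x \<in> Xh"
  then obtain i where i: "i \<in> Ih" "x \<in> cell S i" using assms(3) by auto
  hence "x \<in> closure (interior (cell S i))" using cell_subset_closure_interior assms(1,2) by blast
  moreover have "interior (cell S i) \<subseteq> interior Xh" using i(1) assms(3) by (intro interior_mono) auto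
  ultimately show "x \<in> closure (interior Xh)" using closure_mono by blast
qed

lemma certified_region_is_stability_region:
  assumes S: "simplex_collection X S"
    and "is_lower_margin S v mv" "is_upper_margin S w mw"
  shows "stability_region X v w (certified_region S v w mv mw)"
  unfolding stability_region_def
proof (intro conjI ballI)
  show "certified_region S v w mv mw \<subseteq> X"
    using S unfolding certified_region_def simplex_collection_def by blast
next
  fix x assume "x \<in> certified_region S v w mv mw"
  then obtain i \<omega> where i: "i \<in> idx S" "\<omega> \<in> weights S" "x = point S i \<omega>"
    "Min ((\<lambda>j. v (verts S i j)) ` corners S) - mv > 0" "Max ((\<lambda>j. w (verts S i j)) ` corners S) + mw < 0"
    unfolding certified_region_def cell_def by auto
  have "Min ((\<lambda>j. v (verts S i j)) ` corners S) \<le> weighted_value S v i \<omega>"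
    using i(2) finite_corners[of S] by (intro weighted_value_ge) auto
  moreover have "weighted_value S v i \<omega> - mv \<le> v x"
    using assms(2) i unfolding is_lower_margin_def by blast
  ultimately show "v x > 0" using i(4) by linarith
  have "weighted_value S w i \<omega> \<le> Max ((\<lambda>j. w (verts S i j)) ` corners S)"
    using i(2) finite_corners[of S] by (intro weighted_value_le) auto
  moreover have "w x \<le> weighted_value S w i \<omega> + mw"
    using assms(3) i unfolding is_upper_margin_def by blast
  ultimately show "w x < 0" using i(5) by linarith
qed

text \<open>The difficulty is that \<open>f\<close> is continuous in the parameter only pointwise, and that the cells of
  \<open>S k\<close> need not fit the region \<open>Xh\<close>. Lower margins compensate for this twice.

  Around an interior point \<open>p\<close> of the region a fine collection has a cell all of whose vertices lie
  in the region, so \<open>f (c k) p \<ge> a - o(1)\<close>, and pointwise continuity in the parameter gives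
  \<open>f c' p \<ge> a\<close>. By continuity of \<open>f c'\<close> this extends to the whole region and, up to a small loss, to a
  neighbourhood of it.

  Conversely, one fixed collection \<open>S k0\<close> that is fine enough transports the lower bound from the
  limit parameter back to \<open>c k\<close>: it has finitely many vertices, at which pointwise convergence is
  uniform, and its margin controls \<open>f (c k)\<close> everywhere else. This reaches the vertices of \<open>S k\<close>
  outside the region.\<close>

lemma positive_near_region_along_sequence:
  fixes f :: "'c::metric_space \<Rightarrow> real^'n::finite \<Rightarrow> real"
  assumes X: "compact X" "X \<noteq> {}" and Xh: "Xh \<subseteq> X" "Xh \<subseteq> closure (interior Xh)"
    and cont_c: "\<And>x. continuous_on Sc (\<lambda>c. f c x)"
    and c: "\<And>k. c k \<in> Sc" "c \<longlonglongrightarrow> c'" "c' \<in> Sc"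
    and cont: "continuous_on X (f c')"
    and S: "\<And>k. simplex_collection X (S k)" "(\<lambda>k. mesh (S k)) \<longlonglongrightarrow> 0"
    and margin: "\<forall>\<^sub>F k in sequentially. \<forall>c\<in>Sc. is_lower_margin (S k) (f c) (C * (mesh (S k))\<^sup>2)"
    and a: "0 < a" "\<And>k x. x \<in> vertices_in (S k) Xh \<Longrightarrow> a \<le> f (c k) x"
  shows "\<forall>\<^sub>F k in sequentially. \<forall>i\<in>idx (S k). cell (S k) i \<inter> Xh \<noteq> {} \<longrightarrow>
    (\<forall>j\<in>corners (S k). a / 2 \<le> f (c k) (verts (S k) i j))"
proof -
  have tri: "triangulation X UNIV (S k)" for k using S(1) X(2) by unfold_locales auto
  have err: "(\<lambda>k. C * (mesh (S k))\<^sup>2) \<longlonglongrightarrow> 0"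
    using tendsto_mult[OF tendsto_const[of C] tendsto_power[OF S(2), of 2]] by simp
  have at_point: "(\<lambda>k. f (c k) x) \<longlonglongrightarrow> f c' x" for x
    using continuous_on_tendsto_compose[OF cont_c c(2,3)] c(1) by simp
  have interior: "a \<le> f c' p" if p: "p \<in> interior Xh" for p
  proof -
    obtain r where r: "0 < r" "ball p r \<subseteq> Xh" using p by (auto simp: mem_interior)
    have "\<forall>\<^sub>F k in sequentially. a - C * (mesh (S k))\<^sup>2 \<le> f (c k) p"
      using margin order_tendstoD(2)[OF S(2) r(1)]
    proof eventually_elim
      case (elim k)
      interpret triangulation X UNIV "S k" by (rule tri)
      have "p \<in> X" using p Xh(1) interior_subset by blast
      then obtain i w where iw: "i \<in> idx (S k)" "w \<in> weights (S k)" "p = point (S k) i w"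
        by (rule in_cell)
      have "a \<le> weighted_value (S k) (f (c k)) i w"
      proof (rule weighted_value_ge[OF iw(2)])
        fix j assume j: "j \<in> corners (S k)"
        have "dist p (verts (S k) i j) < r"
          using dist_vertex_le_mesh[OF iw(1) _ j, of p] iw(2,3) elim(2) by (auto simp: cell_def)
        hence "verts (S k) i j \<in> Xh" using r(2) by auto
        thus "a \<le> f (c k) (verts (S k) i j)"
          using iw(1) j by (intro a(2)) (auto simp: vertices_in_def)
      qed
      moreover have "weighted_value (S k) (f (c k)) i w - C * (mesh (S k))\<^sup>2 \<le> f (c k) p"
        using elim(1) c(1) iw unfolding is_lower_margin_def by blast
      ultimately show ?case by linarith
    qed
    moreover have "(\<lambda>k. a - C * (mesh (S k))\<^sup>2) \<longlonglongrightarrow> a - 0" by (intro tendsto_intros err)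
    ultimately show ?thesis using tendsto_le[OF _ at_point[of p]] by force
  qed
  have closure_sub: "closure (interior Xh) \<subseteq> X"
    using Xh(1) interior_subset compact_imp_closed[OF X(1)] by (intro closure_minimal) auto
  have region: "a \<le> f c' q" if "q \<in> Xh" for q
    using continuous_ge_on_closure[OF continuous_on_subset[OF cont closure_sub]] that Xh(2) interior by blast
  (* Uniform continuity, pointwise convergence and the margin cost at most a / 8 each, in total
     less than a / 2. *)
  obtain d where d: "0 < d" "\<And>x x'. x \<in> X \<Longrightarrow> x' \<in> X \<Longrightarrow> dist x x' < d \<Longrightarrow> dist (f c' x) (f c' x') < a / 8"
    using compact_uniformly_continuous[OF cont X(1)] a(1) unfolding uniformly_continuous_on_def
    by (metis divide_pos_pos zero_less_numeral)
  have near: "7 * a / 8 \<le> f c' x" if "x \<in> X" "q \<in> Xh" "dist x q < d" for x q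
  proof -
    have "dist (f c' x) (f c' q) < a / 8" using d(2) that Xh(1) by blast
    thus ?thesis using region[OF that(2)] unfolding dist_real_def by linarith
  qed
  have "0 < a / 8" "0 < d / 2" using a(1) d(1) by simp_all
  from eventually_happens'[OF _ eventually_conj[OF margin eventually_conj[OF
        order_tendstoD(2)[OF err this(1)] order_tendstoD(2)[OF S(2) this(2)]]]]
  obtain k0 where k0: "\<forall>c\<in>Sc. is_lower_margin (S k0) (f c) (C * (mesh (S k0))\<^sup>2)"
    "C * (mesh (S k0))\<^sup>2 < a / 8" "mesh (S k0) < d / 2"
    by auto
  interpret fine: triangulation X UNIV "S k0" by (rule tri)
  have "\<forall>\<^sub>F k in sequentially. f c' x - a / 8 < f (c k) x" for x
    using order_tendstoD(1)[OF at_point[of x], of "f c' x - a / 8"] a(1) by simp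
  hence "\<forall>\<^sub>F k in sequentially. \<forall>i\<in>idx (S k0). \<forall>j\<in>corners (S k0).
      f c' (verts (S k0) i j) - a / 8 < f (c k) (verts (S k0) i j)"
    using fine.finite_idx finite_corners[of "S k0"] by (simp add: eventually_ball_finite)
  moreover have "\<forall>\<^sub>F k in sequentially. mesh (S k) < d / 2"
    using d(1) by (intro order_tendstoD(2)[OF S(2)]) simp
  ultimately show ?thesis
  proof eventually_elim
    case (elim k)
    interpret triangulation X UNIV "S k" by (rule tri)
    show ?case
    proof (intro ballI impI)
      fix i j assume i: "i \<in> idx (S k)" "cell (S k) i \<inter> Xh \<noteq> {}" and j: "j \<in> corners (S k)"
      let ?x = "verts (S k) i j"
      obtain q where q: "q \<in> cell (S k) i" "q \<in> Xh" using i(2) by auto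
      have xq: "dist ?x q < d / 2"
        using dist_vertex_le_mesh[OF i(1) q(1) j] elim(2) by (simp add: dist_commute)
      obtain i0 w0 where iw: "i0 \<in> idx (S k0)" "w0 \<in> weights (S k0)" "?x = point (S k0) i0 w0"
        using fine.in_cell[OF vertex_in[OF i(1) j]] .
      have "6 * a / 8 \<le> weighted_value (S k0) (f (c k)) i0 w0"
      proof (rule weighted_value_ge[OF iw(2)])
        fix l assume l: "l \<in> corners (S k0)"
        have "dist ?x (verts (S k0) i0 l) < d / 2"
          using fine.dist_vertex_le_mesh[OF iw(1) _ l, of ?x] iw(2,3) k0(3) by (auto simp: cell_def)
        hence "dist (verts (S k0) i0 l) q < d"
          using xq dist_triangle_half_r by blast
        hence "7 * a / 8 \<le> f c' (verts (S k0) i0 l)" using fine.vertex_in[OF iw(1) l] q(2) near by blast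
        thus "6 * a / 8 \<le> f (c k) (verts (S k0) i0 l)" using bspec[OF bspec[OF elim(1) iw(1)] l] by linarith
      qed
      moreover have "weighted_value (S k0) (f (c k)) i0 w0 - C * (mesh (S k0))\<^sup>2 \<le> f (c k) ?x"
        using k0(1) c(1) iw unfolding is_lower_margin_def by force
      ultimately show "a / 2 \<le> f (c k) ?x" using k0(2) a(1) by linarith
    qed
  qed
qed

text \<open>By compactness of the parameter set, a failure for arbitrarily fine collections would yield a
  sequence of collections with convergent parameters, to which the previous lemma applies both for
  \<open>V\<close> and for \<open>- W\<close>. Once \<open>V\<close> and \<open>- W\<close> are at least \<open>a / 2\<close> at all vertices of the cells that meet the region,
  quadratic margins are eventually too small to prevent certification.\<close>

lemma fine_collections_certify:
  fixes V W :: "'c::metric_space \<Rightarrow> real^'n::finite \<Rightarrow> real"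
  assumes X: "compact X" "X \<noteq> {}" and Xh: "Xh \<subseteq> X" "Xh \<subseteq> closure (interior Xh)"
    and Sc: "compact Sc"
    and cont_c: "\<And>x. continuous_on Sc (\<lambda>c. V c x)" "\<And>x. continuous_on Sc (\<lambda>c. W c x)"
    and cont: "\<And>c. c \<in> Sc \<Longrightarrow> continuous_on X (V c)" "\<And>c. c \<in> Sc \<Longrightarrow> continuous_on X (W c)"
    and margins: "\<And>c S. c \<in> Sc \<Longrightarrow> simplex_collection X S \<Longrightarrow> is_lower_margin S (V c) (mV c S)"
      "\<And>c S. c \<in> Sc \<Longrightarrow> simplex_collection X S \<Longrightarrow> is_upper_margin S (W c) (mW c S)"
    and small: "0 < \<tau>'"
      "\<And>c S. c \<in> Sc \<Longrightarrow> simplex_collection X S \<Longrightarrow> mesh S \<le> \<tau>' \<Longrightarrow> mV c S \<le> CV * (mesh S)\<^sup>2"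
      "\<And>c S. c \<in> Sc \<Longrightarrow> simplex_collection X S \<Longrightarrow> mesh S \<le> \<tau>' \<Longrightarrow> mW c S \<le> CW * (mesh S)\<^sup>2"
    and a: "0 < a"
  shows "\<exists>\<tau>>0. \<forall>S c. simplex_collection X S \<longrightarrow> mesh S \<le> \<tau> \<longrightarrow> c \<in> Sc \<longrightarrow>
    (\<forall>x\<in>vertices_in S Xh. a \<le> V c x \<and> W c x \<le> - a) \<longrightarrow>
    Xh \<subseteq> certified_region S (V c) (W c) (mV c S) (mW c S)"
proof (rule ccontr)
  assume not: "\<not> ?thesis"
  have "\<exists>S c. simplex_collection X S \<and> mesh S \<le> inverse (real (Suc k)) \<and> c \<in> Sc \<and>
    (\<forall>x\<in>vertices_in S Xh. a \<le> V c x \<and> W c x \<le> - a) \<and>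
    \<not> Xh \<subseteq> certified_region S (V c) (W c) (mV c S) (mW c S)" for k
  proof -
    have "0 < inverse (real (Suc k))" by simp
    thus ?thesis using not by blast
  qed
  then obtain S c where S: "\<And>k. simplex_collection X (S k)" "\<And>k. mesh (S k) \<le> inverse (real (Suc k))"
    and c: "\<And>k. c k \<in> Sc" and at_vertices: "\<And>k x. x \<in> vertices_in (S k) Xh \<Longrightarrow> a \<le> V (c k) x \<and> W (c k) x \<le> - a"
    and uncertified: "\<And>k. \<not> Xh \<subseteq> certified_region (S k) (V (c k)) (W (c k)) (mV (c k) (S k)) (mW (c k) (S k))"
    by metis
  have tri: "triangulation X UNIV (S k)" for k using S(1) X(2) by unfold_locales auto
  have mesh: "(\<lambda>k. mesh (S k)) \<longlonglongrightarrow> 0"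
    by (rule tendsto_sandwich[OF _ _ tendsto_const LIMSEQ_inverse_real_of_nat])
      (use S(2) less_imp_le[OF triangulation.mesh_pos[OF tri]] in auto)
  obtain c' r where r: "c' \<in> Sc" "strict_mono r" "(c \<circ> r) \<longlonglongrightarrow> c'"
    using Sc c unfolding compact_def by metis
  have mesh_r: "(\<lambda>k. mesh (S (r k))) \<longlonglongrightarrow> 0"
    using LIMSEQ_subseq_LIMSEQ[OF mesh r(2)] by (simp add: o_def)
  have fine: "\<forall>\<^sub>F k in sequentially. mesh (S (r k)) < \<tau>'" by (rule order_tendstoD(2)[OF mesh_r small(1)])
  have V: "\<forall>\<^sub>F k in sequentially. \<forall>i\<in>idx (S (r k)). cell (S (r k)) i \<inter> Xh \<noteq> {} \<longrightarrow>
    (\<forall>j\<in>corners (S (r k)). a / 2 \<le> V (c (r k)) (verts (S (r k)) i j))"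
  proof (rule positive_near_region_along_sequence[OF X Xh cont_c(1) _ r(3)[unfolded o_def] r(1) cont(1)[OF r(1)] _ mesh_r _ a])
    show "\<forall>\<^sub>F k in sequentially. \<forall>c\<in>Sc. is_lower_margin (S (r k)) (V c) (CV * (mesh (S (r k)))\<^sup>2)"
      using fine
    proof eventually_elim
      case (elim k)
      show ?case
      proof
        fix c assume "c \<in> Sc"
        thus "is_lower_margin (S (r k)) (V c) (CV * (mesh (S (r k)))\<^sup>2)"
          using margins(1)[of c "S (r k)"] small(2)[of c "S (r k)"] elim S(1)
          unfolding is_lower_margin_def by force
      qed
    qed
  qed (use c S at_vertices in auto)
  have W: "\<forall>\<^sub>F k in sequentially. \<forall>i\<in>idx (S (r k)). cell (S (r k)) i \<inter> Xh \<noteq> {} \<longrightarrow>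
    (\<forall>j\<in>corners (S (r k)). a / 2 \<le> - W (c (r k)) (verts (S (r k)) i j))"
  proof (rule positive_near_region_along_sequence[where f = "\<lambda>c x. - W c x", OF X Xh _ _ r(3)[unfolded o_def] r(1) _ _ mesh_r _ a])
    show "\<forall>\<^sub>F k in sequentially. \<forall>c\<in>Sc. is_lower_margin (S (r k)) (\<lambda>x. - W c x) (CW * (mesh (S (r k)))\<^sup>2)"
      using fine
    proof eventually_elim
      case (elim k)
      show ?case
      proof
        fix c assume "c \<in> Sc"
        thus "is_lower_margin (S (r k)) (\<lambda>x. - W c x) (CW * (mesh (S (r k)))\<^sup>2)"
          using margins(2)[of c "S (r k)"] small(3)[of c "S (r k)"] elim S(1)
          unfolding is_lower_margin_def is_upper_margin_def weighted_value_uminus by force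
      qed
    qed
  qed (use c S at_vertices cont(2)[OF r(1)] cont_c(2) in \<open>auto intro!: continuous_intros\<close>, fastforce)
  have err: "(\<lambda>k. CV * (mesh (S (r k)))\<^sup>2) \<longlonglongrightarrow> 0" "(\<lambda>k. CW * (mesh (S (r k)))\<^sup>2) \<longlonglongrightarrow> 0"
    using tendsto_mult[OF tendsto_const tendsto_power[OF mesh_r, of 2]] by fastforce+
  have "\<forall>\<^sub>F k in sequentially. CV * (mesh (S (r k)))\<^sup>2 < a / 2" "\<forall>\<^sub>F k in sequentially. CW * (mesh (S (r k)))\<^sup>2 < a / 2"
    using a by (intro order_tendstoD(2)[OF err(1)] order_tendstoD(2)[OF err(2)]; simp)+
  hence "\<forall>\<^sub>F k in sequentially. False"
    using V W fine
  proof eventually_elim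
    case (elim k)
    let ?S = "S (r k)" and ?c = "c (r k)"
    have m: "mV ?c ?S < a / 2" "mW ?c ?S < a / 2"
      using small(2,3)[OF c S(1), of "r k" "r k"] elim(1,2,5) by force+
    have "x \<in> certified_region ?S (V ?c) (W ?c) (mV ?c ?S) (mW ?c ?S)" if x: "x \<in> Xh" for x
    proof -
      obtain i where i: "i \<in> idx ?S" "x \<in> cell ?S i"
        using x Xh(1) triangulation.cells[OF tri, of "r k"] by auto
      hence ne: "cell ?S i \<inter> Xh \<noteq> {}" using x by auto
      have fin: "finite (corners ?S)" "corners ?S \<noteq> {}" by (auto simp: corners_def)
      have "a / 2 \<le> Min ((\<lambda>j. V ?c (verts ?S i j)) ` corners ?S)"
        using fin elim(3) i(1) ne by (intro Min.boundedI) auto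
      moreover have "Max ((\<lambda>j. W ?c (verts ?S i j)) ` corners ?S) \<le> - (a / 2)"
        using fin elim(4) i(1) ne by (intro Max.boundedI) (auto simp: le_minus_iff)
      ultimately have "Min ((\<lambda>j. V ?c (verts ?S i j)) ` corners ?S) - mV ?c ?S > 0"
        "Max ((\<lambda>j. W ?c (verts ?S i j)) ` corners ?S) + mW ?c ?S < 0"
        using m by linarith+
      thus ?thesis using i unfolding certified_region_def by blast
    qed
    thus False using uncertified by blast
  qed
  thus False by simp
qed

section \<open>Minimizers of the penalized objective\<close>

text \<open>A feasible parameter costs at most \<open>\<beta>\<close> times its performance index plus two penalties of
  size \<open>\<delta>\<close> per vertex. All terms of the objective are nonnegative, so this also bounds each
  single penalty of the minimizer, and a penalty dominates the violation it measures.\<close>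

lemma minimizer_nearly_feasible:
  assumes S: "simplex_collection X S"
    and min: "is_arg_min (objective J \<zeta> \<epsilon>V \<epsilon>W V W \<delta> \<beta> Xh S) (\<lambda>c. c \<in> Sc) c"
    and J: "0 \<le> J c Xh S" and nonneg: "0 \<le> \<beta>" "0 \<le> \<delta>"
    and \<zeta>: "\<And>z. 0 \<le> \<zeta> z \<delta>" "\<And>z. 0 < z \<Longrightarrow> z + \<delta> \<le> \<zeta> z \<delta>" "\<And>z. z \<le> 0 \<Longrightarrow> \<zeta> z \<delta> \<le> \<delta>"
    and feasible: "c0 \<in> Sc" "\<And>x. x \<in> Xh \<Longrightarrow> \<epsilon>V x \<le> V c0 x \<and> W c0 x \<le> - \<epsilon>W x"
    and x: "x \<in> vertices_in S Xh"
  shows "\<epsilon>V x - V c x \<le> \<beta> * J c0 Xh S + 2 * real (card (vertices_in S Xh)) * \<delta>"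
    and "\<epsilon>W x + W c x \<le> \<beta> * J c0 Xh S + 2 * real (card (vertices_in S Xh)) * \<delta>"
proof -
  let ?L = "objective J \<zeta> \<epsilon>V \<epsilon>W V W \<delta> \<beta> Xh S" and ?P = "vertices_in S Xh"
  let ?R = "\<beta> * J c0 Xh S + 2 * real (card ?P) * \<delta>"
  have "?P \<subseteq> (\<lambda>(i, j). verts S i j) ` (idx S \<times> corners S)" unfolding vertices_in_def by auto
  hence fin: "finite ?P"
    using S finite_corners[of S] unfolding simplex_collection_def by (meson finite_SigmaI finite_imageI finite_subset)
  have PX: "y \<in> Xh" if "y \<in> ?P" for y using that unfolding vertices_in_def by auto
  have "(\<Sum>x\<in>?P. \<zeta> (\<epsilon>V x - V c0 x) \<delta> + \<zeta> (\<epsilon>W x + W c0 x) \<delta>) \<le> (\<Sum>x\<in>?P. \<delta> + \<delta>)"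
    using feasible(2) PX by (intro sum_mono add_mono \<zeta>(3)) force+
  hence feas: "?L c0 \<le> ?R" unfolding objective_def by (simp add: mult_ac)
  have opt: "?L c \<le> ?L c0" using min feasible(1) unfolding is_arg_min_def by force
  have "\<zeta> (\<epsilon>V x - V c x) \<delta> + \<zeta> (\<epsilon>W x + W c x) \<delta> \<le> (\<Sum>x\<in>?P. \<zeta> (\<epsilon>V x - V c x) \<delta> + \<zeta> (\<epsilon>W x + W c x) \<delta>)"
    by (rule member_le_sum[OF x _ fin]) (simp add: \<zeta>(1))
  also have "\<dots> \<le> ?L c" unfolding objective_def using J nonneg by simp
  finally have penalty: "\<zeta> (\<epsilon>V x - V c x) \<delta> + \<zeta> (\<epsilon>W x + W c x) \<delta> \<le> ?R" using opt feas by linarith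
  have excess: "z \<le> ?R" if "\<zeta> z \<delta> \<le> ?R" for z
    using that \<zeta>(2)[of z] \<zeta>(1)[of z] nonneg by (cases "0 < z") auto
  show "\<epsilon>V x - V c x \<le> ?R" by (rule excess) (use penalty \<zeta>(1)[of "\<epsilon>W x + W c x"] in linarith)
  show "\<epsilon>W x + W c x \<le> ?R" by (rule excess) (use penalty \<zeta>(1)[of "\<epsilon>V x - V c x"] in linarith)
qed

text \<open>The two optimality inequalities are added; all terms other than \<open>\<beta>\<close> times the performance
  index cancel.\<close>

lemma performance_of_minimizer_le:
  assumes c: "is_arg_min (objective J \<zeta> \<epsilon>V \<epsilon>W V W \<delta> \<beta> Xh S) (\<lambda>c. c \<in> Sc) c"
    and c0: "is_arg_min (objective J \<zeta> \<epsilon>V \<epsilon>W V W \<delta> 0 Xh S) (\<lambda>c. c \<in> Sc) c0"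
    and "0 < \<beta>"
  shows "J c Xh S \<le> J c0 Xh S"
proof -
  have "objective J \<zeta> \<epsilon>V \<epsilon>W V W \<delta> \<beta> Xh S c \<le> objective J \<zeta> \<epsilon>V \<epsilon>W V W \<delta> \<beta> Xh S c0"
    "objective J \<zeta> \<epsilon>V \<epsilon>W V W \<delta> 0 Xh S c0 \<le> objective J \<zeta> \<epsilon>V \<epsilon>W V W \<delta> 0 Xh S c"
    using c c0 unfolding is_arg_min_def by force+
  hence "\<beta> * J c Xh S \<le> \<beta> * J c0 Xh S" unfolding objective_def by simp
  thus ?thesis using \<open>0 < \<beta>\<close> by simp
qed

lemma positive_continuous_lower_bound:
  fixes f :: "'a::topological_space \<Rightarrow> real"
  assumes "compact X" "continuous_on X f" "\<And>x. x \<in> X \<Longrightarrow> 0 < f x"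
  obtains e where "0 < e" "\<And>x. x \<in> X \<Longrightarrow> e \<le> f x"
proof (cases "X = {}")
  case False
  then obtain z where "z \<in> X" "\<forall>x\<in>X. f z \<le> f x" using continuous_attains_inf[OF assms(1) _ assms(2)] by blast
  thus ?thesis using that[of "f z"] assms(3) by auto
qed (use that[of 1] in auto)

theorem theorem10:
  fixes X Xt Xh :: "(real^'n::finite) set"
    and \<mu> \<sigma> :: "real^'n \<Rightarrow> real^'u::finite \<Rightarrow> real^'n"
    and Sc :: "(real^'c::finite) set"
    and V :: "real^'c \<Rightarrow> real^'n \<Rightarrow> real"
    and u :: "real^'c \<Rightarrow> real^'n \<Rightarrow> real^'u"
    and W :: "real^'c \<Rightarrow> real^'n \<Rightarrow> real"
    and \<epsilon>V \<epsilon>W :: "real^'n \<Rightarrow> real"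
    and J :: "real^'c \<Rightarrow> (real^'n) set \<Rightarrow> 'n simplexes \<Rightarrow> real"
    and \<zeta> :: "real \<Rightarrow> real \<Rightarrow> real"
    and T :: nat
    and N\<mu> N\<sigma> NV NdV :: "real^'c \<Rightarrow> nat"
    and DV DM DS :: "real^'c \<Rightarrow> 'n tree"
    and mV mW :: "real^'c \<Rightarrow> 'n simplexes \<Rightarrow> real"
    and c_opt :: "real \<Rightarrow> 'n simplexes \<Rightarrow> real \<Rightarrow> real^'c"
  assumes X: "bounded X" "closed X" "0 \<in> X"
    and Xt: "bounded Xt" "open Xt" "X \<subseteq> Xt"
    and \<sigma>_nonneg: "\<And>x a s. 0 \<le> \<sigma> x a $ s"
    and Sc: "Sc \<noteq> {}" "bounded Sc" "closed Sc"
    and V_C1: "\<And>c. c \<in> Sc \<Longrightarrow> C1_on UNIV (V c)"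
    and W: "\<And>c. W c = W_fun \<mu> \<sigma> (V c) (u c)"
    and V_cont: "\<And>x. continuous_on Sc (\<lambda>c. V c x)"
    and W_cont: "\<And>x. continuous_on Sc (\<lambda>c. W c x)"
    and Xh: "Xh \<subseteq> X"
    and \<epsilon>V: "continuous_on X \<epsilon>V" "\<And>x. x \<in> X \<Longrightarrow> 0 < \<epsilon>V x"
    and \<epsilon>W: "continuous_on X \<epsilon>W" "\<And>x. x \<in> X \<Longrightarrow> 0 < \<epsilon>W x"
    and J_cont: "\<And>S. simplex_collection X S \<Longrightarrow> continuous_on Sc (\<lambda>c. J c Xh S)"
    and J_nonneg: "\<And>S c. simplex_collection X S \<Longrightarrow> c \<in> Sc \<Longrightarrow> 0 \<le> J c Xh S"
    and \<zeta>_mono: "\<And>\<delta>. 0 \<le> \<delta> \<Longrightarrow> mono (\<lambda>z. \<zeta> z \<delta>)"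
    and \<zeta>_cont: "\<And>\<delta>. 0 \<le> \<delta> \<Longrightarrow> continuous_on UNIV (\<lambda>z. \<zeta> z \<delta>)"
    and \<zeta>_nonneg: "\<And>\<delta> z. 0 \<le> \<delta> \<Longrightarrow> 0 \<le> \<zeta> z \<delta>"
    and \<zeta>_pos: "\<And>\<delta> z. 0 \<le> \<delta> \<Longrightarrow> 0 < z \<Longrightarrow> z + \<delta> \<le> \<zeta> z \<delta>"
    and \<zeta>_nonpos: "\<And>\<delta> z. 0 \<le> \<delta> \<Longrightarrow> z \<le> 0 \<Longrightarrow> \<zeta> z \<delta> \<le> \<delta>"
    and c_opt: "\<And>\<beta> \<delta> S. 0 \<le> \<beta> \<Longrightarrow> 0 \<le> \<delta> \<Longrightarrow> simplex_collection X S \<Longrightarrow>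
        is_arg_min (objective J \<zeta> \<epsilon>V \<epsilon>W V W \<delta> \<beta> Xh S) (\<lambda>c. c \<in> Sc) (c_opt \<beta> S \<delta>)"
    and mV: "\<And>c S. mV c S = lower_margin T S (DV c)"
    and mW: "\<And>c S. mW c S = upper_margin T S (DM c) + upper_margin T S (DS c)"
  shows
    "((\<forall>c\<in>Sc. class_assumption X Xt T \<mu> \<sigma> (V c) (u c) (N\<mu> c) (N\<sigma> c) (NV c) (NdV c) \<and>
          decomposition_F X Xt T (NV c) (DV c) (V c) \<and>
          decomposition_F X Xt T (max (NdV c) (N\<mu> c) + 1) (DM c) (M_fun \<mu> (V c) (u c)) \<and>
          decomposition_F_plus X Xt T (max (NdV c) (N\<sigma> c) + 2) (DS c) (S_fun \<sigma> (V c) (u c))) \<and>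
      (\<exists>c\<in>Sc. \<forall>x\<in>Xh. V c x \<ge> \<epsilon>V x \<and> W c x \<le> - \<epsilon>W x) \<and>
      (\<exists>\<tau>'>0. \<exists>CV>0. \<exists>CW>0. \<forall>c\<in>Sc. \<forall>S. simplex_collection X S \<longrightarrow> mesh S \<le> \<tau>' \<longrightarrow>
          mV c S \<le> CV * (mesh S)\<^sup>2 \<and> mW c S \<le> CW * (mesh S)\<^sup>2) \<and>
      admissible_intervals X Xh \<noteq> {}
      \<longrightarrow>
      (\<exists>\<tau>U>0. \<forall>\<tau> \<in> {0<..\<tau>U} \<inter> admissible_intervals X Xh.
         \<forall>S. simplex_collection X S \<and> mesh S = \<tau> \<longrightarrow>
           (\<exists>\<beta>U>0. \<exists>\<delta>U>0. \<forall>\<beta>\<in>{0..\<beta>U}. \<forall>\<delta>\<in>{0..\<delta>U}.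
              let c = c_opt \<beta> S \<delta>;
                  XS = certified_region S (V c) (W c) (mV c S) (mW c S)
              in stability_region X (V c) (W c) XS \<and> Xh \<subseteq> XS))) \<and>
     (\<forall>S \<beta> \<delta>. simplex_collection X S \<and> 0 \<le> \<beta> \<and> 0 \<le> \<delta> \<longrightarrow>
        J (c_opt \<beta> S \<delta>) Xh S \<le> J (c_opt 0 S \<delta>) Xh S)"
proof -
  have cX: "compact X" and X_ne: "X \<noteq> {}" using X by (auto simp: compact_eq_bounded_closed)
  have cSc: "compact Sc" using Sc by (simp add: compact_eq_bounded_closed)
  have tri: "triangulation X Xt S" if "simplex_collection X S" for S
    using that X_ne Xt(2,3) by unfold_locales
  have part2: "J (c_opt \<beta> S \<delta>) Xh S \<le> J (c_opt 0 S \<delta>) Xh S"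
    if "simplex_collection X S" "0 \<le> \<beta>" "0 \<le> \<delta>" for S \<beta> \<delta>
    using performance_of_minimizer_le[OF c_opt[OF that(2,3,1)] c_opt[OF order_refl that(3,1)]] that(2)
    by (cases "\<beta> = 0") auto
  have part1: "\<exists>\<tau>U>0. \<forall>\<tau> \<in> {0<..\<tau>U} \<inter> admissible_intervals X Xh.
         \<forall>S. simplex_collection X S \<and> mesh S = \<tau> \<longrightarrow>
           (\<exists>\<beta>U>0. \<exists>\<delta>U>0. \<forall>\<beta>\<in>{0..\<beta>U}. \<forall>\<delta>\<in>{0..\<delta>U}.
              let c = c_opt \<beta> S \<delta>;
                  XS = certified_region S (V c) (W c) (mV c S) (mW c S)
              in stability_region X (V c) (W c) XS \<and> Xh \<subseteq> XS)"
    if D: "\<And>c. c \<in> Sc \<Longrightarrow> decomposition_F X Xt T (NV c) (DV c) (V c)"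
      "\<And>c. c \<in> Sc \<Longrightarrow> decomposition_F X Xt T (max (NdV c) (N\<mu> c) + 1) (DM c) (M_fun \<mu> (V c) (u c))"
      "\<And>c. c \<in> Sc \<Longrightarrow> decomposition_F_plus X Xt T (max (NdV c) (N\<sigma> c) + 2) (DS c) (S_fun \<sigma> (V c) (u c))"
    and feasible: "c0 \<in> Sc" "\<And>x. x \<in> Xh \<Longrightarrow> \<epsilon>V x \<le> V c0 x \<and> W c0 x \<le> - \<epsilon>W x"
    and \<tau>': "0 < \<tau>'"
    and small: "\<And>c S. c \<in> Sc \<Longrightarrow> simplex_collection X S \<Longrightarrow> mesh S \<le> \<tau>' \<Longrightarrow>
          mV c S \<le> CV * (mesh S)\<^sup>2 \<and> mW c S \<le> CW * (mesh S)\<^sup>2"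
    and admissible: "admissible_intervals X Xh \<noteq> {}" for c0 \<tau>' CV CW
  proof -
    have W_sum: "W c = (\<lambda>x. M_fun \<mu> (V c) (u c) x + S_fun \<sigma> (V c) (u c) x)" for c
      unfolding W W_fun_def by (rule refl)
    have margins: "is_lower_margin S (V c) (mV c S)" "is_upper_margin S (W c) (mW c S)"
      if "c \<in> Sc" "simplex_collection X S" for c S
    proof -
      interpret triangulation X Xt S by (rule tri[OF that(2)])
      show "is_lower_margin S (V c) (mV c S)"
        unfolding mV by (rule decomposition_F_margins[OF D(1)[OF that(1)]])
      show "is_upper_margin S (W c) (mW c S)"
        unfolding mW W_sum
        by (intro upper_margin_add decomposition_F_margins(2)[OF D(2)[OF that(1)]]
            decomposition_F_plus_margin[OF cX D(3)[OF that(1)]])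
    qed
    have cont: "continuous_on X (V c)" "continuous_on X (W c)" if "c \<in> Sc" for c
      using decomposition_F_continuous[OF D(1)[OF that]] decomposition_F_continuous[OF D(2)[OF that]]
        decomposition_F_plus_continuous[OF D(3)[OF that]] Xt(3)
      unfolding W_sum by (auto intro!: continuous_on_add intro: continuous_on_subset)
    obtain S0 Ih where "simplex_collection X S0" "Ih \<subseteq> idx S0" "Xh = (\<Union>i\<in>Ih. cell S0 i)"
      using admissible unfolding admissible_intervals_def by blast
    hence Xh_regular: "Xh \<subseteq> closure (interior Xh)" by (rule union_of_cells_subset_closure_interior)
    obtain eV eW where e: "0 < eV" "\<And>x. x \<in> X \<Longrightarrow> eV \<le> \<epsilon>V x" "0 < eW" "\<And>x. x \<in> X \<Longrightarrow> eW \<le> \<epsilon>W x"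
      using positive_continuous_lower_bound[OF cX \<epsilon>V] positive_continuous_lower_bound[OF cX \<epsilon>W] by metis
    (* One half of the tolerances is given away to the violations at the vertices. *)
    define a where "a = min eV eW / 2"
    have a: "0 < a" "2 * a \<le> eV" "2 * a \<le> eW" using e(1,3) unfolding a_def by auto
    have "\<exists>\<tau>>0. \<forall>S c. simplex_collection X S \<longrightarrow> mesh S \<le> \<tau> \<longrightarrow> c \<in> Sc \<longrightarrow>
        (\<forall>x\<in>vertices_in S Xh. a \<le> V c x \<and> W c x \<le> - a) \<longrightarrow>
        Xh \<subseteq> certified_region S (V c) (W c) (mV c S) (mW c S)"
      by (rule fine_collections_certify[OF cX X_ne Xh Xh_regular cSc V_cont W_cont cont margins \<tau>'
            conjunct1[OF small] conjunct2[OF small] a(1)]; assumption)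
    then obtain \<tau>U where \<tau>U: "0 < \<tau>U" "\<And>S c. simplex_collection X S \<Longrightarrow> mesh S \<le> \<tau>U \<Longrightarrow> c \<in> Sc \<Longrightarrow>
        \<forall>x\<in>vertices_in S Xh. a \<le> V c x \<and> W c x \<le> - a \<Longrightarrow>
        Xh \<subseteq> certified_region S (V c) (W c) (mV c S) (mW c S)"
      by blast
    have "\<exists>\<beta>U>0. \<exists>\<delta>U>0. \<forall>\<beta>\<in>{0..\<beta>U}. \<forall>\<delta>\<in>{0..\<delta>U}.
        stability_region X (V (c_opt \<beta> S \<delta>)) (W (c_opt \<beta> S \<delta>))
          (certified_region S (V (c_opt \<beta> S \<delta>)) (W (c_opt \<beta> S \<delta>)) (mV (c_opt \<beta> S \<delta>) S) (mW (c_opt \<beta> S \<delta>) S)) \<and>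
        Xh \<subseteq> certified_region S (V (c_opt \<beta> S \<delta>)) (W (c_opt \<beta> S \<delta>)) (mV (c_opt \<beta> S \<delta>) S) (mW (c_opt \<beta> S \<delta>) S)"
      if S: "simplex_collection X S" "mesh S \<le> \<tau>U" for S
    proof -
      define j where "j = J c0 Xh S"
      define p where "p = 2 * real (card (vertices_in S Xh))"
      have jp: "0 \<le> j" "0 \<le> p" unfolding j_def p_def using J_nonneg[OF S(1) feasible(1)] by auto
      (* Each of the two contributions to the violation is held below a / 2; adding 1 avoids a zero
         denominator. *)
      define \<beta>U where "\<beta>U = a / (2 * (j + 1))"
      define \<delta>U where "\<delta>U = a / (2 * (p + 1))"
      have pos: "0 < \<beta>U" "0 < \<delta>U" using a(1) jp unfolding \<beta>U_def \<delta>U_def by auto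
      have bound: "\<beta>U * j \<le> a / 2" "p * \<delta>U \<le> a / 2"
        using a(1) jp unfolding \<beta>U_def \<delta>U_def by (auto simp: field_simps)
      show ?thesis
      proof (rule exI[of _ \<beta>U], rule conjI[OF pos(1)], rule exI[of _ \<delta>U], rule conjI[OF pos(2)], intro ballI)
        fix \<beta> \<delta> assume \<beta>: "\<beta> \<in> {0..\<beta>U}" and \<delta>: "\<delta> \<in> {0..\<delta>U}"
        define c where "c = c_opt \<beta> S \<delta>"
        have nn: "0 \<le> \<beta>" "0 \<le> \<delta>" using \<beta> \<delta> by auto
        have min: "is_arg_min (objective J \<zeta> \<epsilon>V \<epsilon>W V W \<delta> \<beta> Xh S) (\<lambda>c. c \<in> Sc) c"
          unfolding c_def by (rule c_opt[OF nn S(1)])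
        hence c: "c \<in> Sc" by (simp add: is_arg_min_def)
        have "\<beta> * j \<le> \<beta>U * j" "p * \<delta> \<le> p * \<delta>U"
          using \<beta> \<delta> jp by (auto intro: mult_left_mono mult_right_mono)
        hence slack: "\<beta> * j + p * \<delta> \<le> a" using bound by linarith
        have "a \<le> V c x \<and> W c x \<le> - a" if x: "x \<in> vertices_in S Xh" for x
        proof -
          have "x \<in> X" using x Xh unfolding vertices_in_def by auto
          moreover have "\<epsilon>V x - V c x \<le> \<beta> * j + p * \<delta>" "\<epsilon>W x + W c x \<le> \<beta> * j + p * \<delta>"
            unfolding j_def p_def
            by (rule minimizer_nearly_feasible[OF S(1) min J_nonneg[OF S(1) c] nn \<zeta>_nonneg[OF nn(2)]
                  \<zeta>_pos[OF nn(2)] \<zeta>_nonpos[OF nn(2)] feasible x]; assumption)+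
          ultimately show ?thesis using e(2,4) a slack by force
        qed
        hence "Xh \<subseteq> certified_region S (V c) (W c) (mV c S) (mW c S)" using \<tau>U(2)[OF S c] by blast
        thus "stability_region X (V (c_opt \<beta> S \<delta>)) (W (c_opt \<beta> S \<delta>))
          (certified_region S (V (c_opt \<beta> S \<delta>)) (W (c_opt \<beta> S \<delta>)) (mV (c_opt \<beta> S \<delta>) S) (mW (c_opt \<beta> S \<delta>) S)) \<and>
          Xh \<subseteq> certified_region S (V (c_opt \<beta> S \<delta>)) (W (c_opt \<beta> S \<delta>)) (mV (c_opt \<beta> S \<delta>) S) (mW (c_opt \<beta> S \<delta>) S)"
          using certified_region_is_stability_region[OF S(1) margins[OF c S(1)]] unfolding c_def by blast
      qed
    qed
    note radii = this
    show ?thesis unfolding Let_def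
    proof (rule exI[of _ \<tau>U], rule conjI[OF \<tau>U(1)], intro ballI allI impI, goal_cases)
      case (1 \<tau> S)
      thus ?case by (intro radii) auto
    qed
  qed
  show ?thesis
  proof (rule conjI, rule impI, goal_cases)
    case 1
    then obtain c0 \<tau>' CV CW where
      "c0 \<in> Sc" "\<And>x. x \<in> Xh \<Longrightarrow> \<epsilon>V x \<le> V c0 x \<and> W c0 x \<le> - \<epsilon>W x" "0 < \<tau>'"
      "\<And>c S. c \<in> Sc \<Longrightarrow> simplex_collection X S \<Longrightarrow> mesh S \<le> \<tau>' \<Longrightarrow>
          mV c S \<le> CV * (mesh S)\<^sup>2 \<and> mW c S \<le> CW * (mesh S)\<^sup>2"
      by blast
    from part1[OF _ _ _ this] 1 show ?case by blast
  next
    case 2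
    thus ?case using part2 by blast
  qed
qed

end
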